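(* Let $T$ be a selfadjoint Yang-Baxter-Hecke operator on $\mathcal H\otimes\mathcal H$, $\mathcal H=\ell^2(\mathbb Z)$, with matrix $t$ defined by $T(e_i\otimes e_j)=\sum_{k,l}t_{ij}^{kl}\,e_k\otimes e_l$. Suppose that for all $i,j\in\mathbb Z$ the sum $\sum_{k,l\in\mathbb Z}t_{jl}^{ik}a_k^\dagger a_l$ appearing in the commutation rule $a_ia_j^\dagger-\sum_{k,l\in\mathbb Z}t_{jl}^{ik}a_k^\dagger a_l=\delta_{ij}I$ is finite, that $M_T:=\sup_{n}\|R^{(n)}\|<\infty$, and that $[T,U\otimes U]=0$, where $U$ is the right shift $Ue_i=e_{i+1}$ on $\ell^2(\mathbb Z)$. Then the $C^*$-dynamical system $(\mathfrak R_T,\alpha)$ is uniquely mixing, with the Fock vacuum state $\omega=\langle\,\cdot\,\Omega,\Omega\rangle$ as the unique invariant state; that is, $$\lim_{n\to+\infty}f(\alpha^n(X))=f(I)\,\omega(X),\qquad X\in\mathfrak R_T,\ f\in\mathfrak R_T^*.$$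
   Context: A Yang-Baxter operator on a Hilbert space $\mathcal H$ is a selfadjoint operator $T$ on $\mathcal H\otimes\mathcal H$ with $T\ge -I$ and $T_1T_2T_1=T_2T_1T_2$ on $\mathcal H^{\otimes 3}$, where $T_1=T\otimes I$, $T_2=I\otimes T$. It is Yang-Baxter-Hecke if in addition there is $q\ge -1$ with $T^2=(q-1)T+qI$ (then $T$ is bounded). On $\mathcal H^{\otimes n}$ let $T_k=I^{\otimes(k-1)}\otimes T\otimes I^{\otimes(n-k-1)}$, $R^{(n)}=I+T_1+T_1T_2+\cdots+T_1T_2\cdots T_{n-1}$ (so $R^{(1)}=I$), and define $P^{(1)}=I$, $P^{(n+1)}=(I\otimes P^{(n)})R^{(n+1)}$; these are positive operators. The $T$-deformed pre-inner product is $\langle\xi,\eta\rangle_T=\delta_{n,m}\langle\xi,P^{(n)}\eta\rangle$ for $\xi\in\mathcal H^{\otimes n}$, $\eta\in\mathcal H^{\otimes m}$. $\mathcal H_T^n$ is the Hilbert space completion of $\mathcal H^{\otimes n}$ modulo the kernel of $\langle\cdot,\cdot\rangle_T$, $\mathcal H_T^0=\mathbb C$, and $\mathcal F_T(\mathcal H)=\bigoplus_{n\ge0}\mathcal H_T^n$ with vacuum vector $\Omega=(1,0,0,\dots)$. The creation operator is $a^\dagger(f)\xi=f\otimes\xi$, and the annihilator $a(f)$ is its adjoint for $\langle\cdot,\cdot\rangle_T$, with $a(f)\Omega=0$. When $M_T<\infty$ one has $\|a(f)\|=\|a^\dagger(f)\|\le\sqrt{M_T}\|f\|$. For $\mathcal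 H=\ell^2(\mathbb Z)$ with canonical basis $\{e_i\}$, put $a_i=a(e_i)$, $a_i^\dagger=a^\dagger(e_i)$. $\mathfrak R_T$ is the unital $C^*$-algebra on $\mathcal F_T(\mathcal H)$ generated by $\{a_i\mid i\in\mathbb Z\}$. If $U$ is the right shift and $[T,U\otimes U]=0$, then $\Omega\mapsto\Omega$ and $U^{\otimes n}$ define a unitary on $\mathcal F_T(\mathcal H)$ whose adjoint action gives the automorphism $\alpha$ of $\mathfrak R_T$ with $\alpha(a_i)=a_{i+1}$. "The sum is finite" means that for all $i,j$ only finitely many pairs $(k,l)$ have $t_{jl}^{ik}\neq0$. *)

theory Defs
  imports "HOL-Analysis.Analysis"
begin

section \<open>Complex (semi-)inner product spaces on explicit carriers\<close>

text \<open>
  The Fock space depends on the operator \<open>T\<close>, hence cannot be a type; spaces are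
  therefore records with a carrier. Inner products are linear in the first and
  conjugate-linear in the second argument, and may be degenerate.
\<close>

record 'v cip_space =
  vcar :: "'v set"
  vzero :: 'v
  vadd :: "'v \<Rightarrow> 'v \<Rightarrow> 'v"
  vscale :: "complex \<Rightarrow> 'v \<Rightarrow> 'v"
  vinner :: "'v \<Rightarrow> 'v \<Rightarrow> complex"

definition vnorm :: "'v cip_space \<Rightarrow> 'v \<Rightarrow> real" where
  "vnorm V x = sqrt (Re (vinner V x x))"

definition vdiff :: "'v cip_space \<Rightarrow> 'v \<Rightarrow> 'v \<Rightarrow> 'v" where
  "vdiff V x y = vadd V x (vscale V (-1) y)"

definition linear_op :: "'v cip_space \<Rightarrow> ('v \<Rightarrow> 'v) \<Rightarrow> bool" where
  "linear_op V X \<longleftrightarrow>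
     X \<in> vcar V \<rightarrow> vcar V \<and>
     (\<forall>x\<in>vcar V. \<forall>y\<in>vcar V. X (vadd V x y) = vadd V (X x) (X y)) \<and>
     (\<forall>c. \<forall>x\<in>vcar V. X (vscale V c x) = vscale V c (X x))"

definition opnorm :: "'v cip_space \<Rightarrow> ('v \<Rightarrow> 'v) \<Rightarrow> ennreal" where
  "opnorm V X = (SUP x\<in>{x\<in>vcar V. vnorm V x \<le> 1}. ennreal (vnorm V (X x)))"


subsection \<open>Hilbert space completion modulo the kernel\<close>

definition cauchy_seqs :: "'v cip_space \<Rightarrow> (nat \<Rightarrow> 'v) set" where
  "cauchy_seqs V = {s. (\<forall>k. s k \<in> vcar V) \<and>
     (\<forall>e>0. \<exists>N. \<forall>m\<ge>N. \<forall>k\<ge>N. vnorm V (vdiff V (s m) (s k)) < e)}"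

definition cauchy_rel :: "'v cip_space \<Rightarrow> ((nat \<Rightarrow> 'v) \<times> (nat \<Rightarrow> 'v)) set" where
  "cauchy_rel V = {(s, t). s \<in> cauchy_seqs V \<and> t \<in> cauchy_seqs V \<and>
     (\<lambda>k. vnorm V (vdiff V (s k) (t k))) \<longlonglongrightarrow> 0}"

text \<open>The canonical map of a space into its completion.\<close>

definition embed :: "'v cip_space \<Rightarrow> 'v \<Rightarrow> (nat \<Rightarrow> 'v) set" where
  "embed V x = cauchy_rel V `` {\<lambda>_. x}"

text \<open>
  Continuous extension to the completions of a bounded linear map \<open>\<phi>\<close> into \<open>W\<close>: the class
  of \<open>s\<close> is sent to the class of \<open>\<phi> \<circ> s\<close>.
\<close>

definition extend :: "'w cip_space \<Rightarrow> ('v \<Rightarrow> 'w) \<Rightarrow> (nat \<Rightarrow> 'v) set \<Rightarrow> (nat \<Rightarrow> 'w) set" where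
  "extend W \<phi> A = cauchy_rel W `` {\<phi> \<circ> s |s. s \<in> A}"

text \<open>
  Vectors of seminorm 0 are identified with 0 by \<^const>\<open>cauchy_rel\<close>, so the kernel of the
  form is divided out.
\<close>

definition completion :: "'v cip_space \<Rightarrow> (nat \<Rightarrow> 'v) set cip_space" where
  "completion V = \<lparr>
     vcar = cauchy_seqs V // cauchy_rel V,
     vzero = embed V (vzero V),
     vadd = (\<lambda>A B. cauchy_rel V `` {\<lambda>k. vadd V (s k) (t k) |s t. s \<in> A \<and> t \<in> B}),
     vscale = (\<lambda>c. extend V (vscale V c)),
     vinner = (\<lambda>A B. THE z. \<forall>s\<in>A. \<forall>t\<in>B. (\<lambda>k. vinner V (s k) (t k)) \<longlonglongrightarrow> z) \<rparr>"

definition hilbert_sum :: "(nat \<Rightarrow> 'v cip_space) \<Rightarrow> (nat \<Rightarrow> 'v) cip_space" where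
  "hilbert_sum V = \<lparr>
     vcar = {x. (\<forall>n. x n \<in> vcar (V n)) \<and> summable (\<lambda>n. (vnorm (V n) (x n))\<^sup>2)},
     vzero = (\<lambda>n. vzero (V n)),
     vadd = (\<lambda>x y n. vadd (V n) (x n) (y n)),
     vscale = (\<lambda>c x n. vscale (V n) c (x n)),
     vinner = (\<lambda>x y. \<Sum>n. vinner (V n) (x n) (y n)) \<rparr>"


section \<open>Bounded operators and generated C*-algebras\<close>

text \<open>
  Elements of \<open>B(F)\<close> are extensional functions (arbitrary but fixed outside the carrier),
  so that equality of operators is equality of functions.
\<close>

definition bounded_ops :: "'v cip_space \<Rightarrow> ('v \<Rightarrow> 'v) set" where
  "bounded_ops F = {X \<in> extensional (vcar F). linear_op F X \<and> opnorm F X < \<infinity>}"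

definition op_id :: "'v cip_space \<Rightarrow> 'v \<Rightarrow> 'v" where
  "op_id F = (\<lambda>x\<in>vcar F. x)"

definition op_add :: "'v cip_space \<Rightarrow> ('v \<Rightarrow> 'v) \<Rightarrow> ('v \<Rightarrow> 'v) \<Rightarrow> 'v \<Rightarrow> 'v" where
  "op_add F X Y = (\<lambda>x\<in>vcar F. vadd F (X x) (Y x))"

definition op_scale :: "'v cip_space \<Rightarrow> complex \<Rightarrow> ('v \<Rightarrow> 'v) \<Rightarrow> 'v \<Rightarrow> 'v" where
  "op_scale F c X = (\<lambda>x\<in>vcar F. vscale F c (X x))"

definition op_diff :: "'v cip_space \<Rightarrow> ('v \<Rightarrow> 'v) \<Rightarrow> ('v \<Rightarrow> 'v) \<Rightarrow> 'v \<Rightarrow> 'v" where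
  "op_diff F X Y = (\<lambda>x\<in>vcar F. vdiff F (X x) (Y x))"

abbreviation op_mult :: "'v cip_space \<Rightarrow> ('v \<Rightarrow> 'v) \<Rightarrow> ('v \<Rightarrow> 'v) \<Rightarrow> 'v \<Rightarrow> 'v" where
  "op_mult F X Y \<equiv> compose (vcar F) X Y"

definition op_adj :: "'v cip_space \<Rightarrow> ('v \<Rightarrow> 'v) \<Rightarrow> 'v \<Rightarrow> 'v" where
  "op_adj F X = (\<lambda>y\<in>vcar F. THE z. z \<in> vcar F \<and>
     (\<forall>x\<in>vcar F. vinner F (X x) y = vinner F x z))"

definition op_converges ::
    "'v cip_space \<Rightarrow> (nat \<Rightarrow> 'v \<Rightarrow> 'v) \<Rightarrow> ('v \<Rightarrow> 'v) \<Rightarrow> bool" where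
  "op_converges F X Y \<longleftrightarrow> (\<lambda>k. opnorm F (op_diff F (X k) Y)) \<longlonglongrightarrow> 0"

inductive_set star_alg_gen :: "'v cip_space \<Rightarrow> ('v \<Rightarrow> 'v) set \<Rightarrow> ('v \<Rightarrow> 'v) set"
  for F :: "'v cip_space" and S :: "('v \<Rightarrow> 'v) set" where
  gen: "X \<in> S \<Longrightarrow> X \<in> star_alg_gen F S"
| one: "op_id F \<in> star_alg_gen F S"
| add: "X \<in> star_alg_gen F S \<Longrightarrow> Y \<in> star_alg_gen F S \<Longrightarrow> op_add F X Y \<in> star_alg_gen F S"
| scale: "X \<in> star_alg_gen F S \<Longrightarrow> op_scale F c X \<in> star_alg_gen F S"
| mult: "X \<in> star_alg_gen F S \<Longrightarrow> Y \<in> star_alg_gen F S \<Longrightarrow> op_mult F X Y \<in> star_alg_gen F S"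
| adj: "X \<in> star_alg_gen F S \<Longrightarrow> op_adj F X \<in> star_alg_gen F S"

definition cstar_gen :: "'v cip_space \<Rightarrow> ('v \<Rightarrow> 'v) set \<Rightarrow> ('v \<Rightarrow> 'v) set" where
  "cstar_gen F S = {Y \<in> bounded_ops F. \<exists>X. (\<forall>k. X k \<in> star_alg_gen F S) \<and> op_converges F X Y}"

definition unital_cstar_subalgebra :: "'v cip_space \<Rightarrow> ('v \<Rightarrow> 'v) set \<Rightarrow> bool" where
  "unital_cstar_subalgebra F A \<longleftrightarrow>
     A \<subseteq> bounded_ops F \<and> op_id F \<in> A \<and>
     (\<forall>X\<in>A. \<forall>Y\<in>A. op_add F X Y \<in> A \<and> op_mult F X Y \<in> A) \<and>
     (\<forall>c. \<forall>X\<in>A. op_scale F c X \<in> A) \<and>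
     (\<forall>X\<in>A. op_adj F X \<in> A) \<and>
     (\<forall>X. \<forall>Y\<in>bounded_ops F. (\<forall>k. X k \<in> A) \<and> op_converges F X Y \<longrightarrow> Y \<in> A)"

text \<open>The acting group is the group of integers, through the powers of the automorphism.\<close>

definition cstar_dynamical_system ::
    "'v cip_space \<Rightarrow> ('v \<Rightarrow> 'v) set \<Rightarrow> (('v \<Rightarrow> 'v) \<Rightarrow> ('v \<Rightarrow> 'v)) \<Rightarrow> bool" where
  "cstar_dynamical_system F A \<alpha> \<longleftrightarrow>
     unital_cstar_subalgebra F A \<and> bij_betw \<alpha> A A \<and>
     (\<forall>X\<in>A. \<forall>Y\<in>A. \<alpha> (op_add F X Y) = op_add F (\<alpha> X) (\<alpha> Y) \<and>
                      \<alpha> (op_mult F X Y) = op_mult F (\<alpha> X) (\<alpha> Y)) \<and>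
     (\<forall>c. \<forall>X\<in>A. \<alpha> (op_scale F c X) = op_scale F c (\<alpha> X)) \<and>
     (\<forall>X\<in>A. \<alpha> (op_adj F X) = op_adj F (\<alpha> X))"

definition cstar_dual :: "'v cip_space \<Rightarrow> ('v \<Rightarrow> 'v) set \<Rightarrow> (('v \<Rightarrow> 'v) \<Rightarrow> complex) set" where
  "cstar_dual F A = {f.
     (\<forall>X\<in>A. \<forall>Y\<in>A. f (op_add F X Y) = f X + f Y) \<and>
     (\<forall>c. \<forall>X\<in>A. f (op_scale F c X) = c * f X) \<and>
     (\<exists>C. \<forall>X\<in>A. cmod (f X) \<le> C * enn2real (opnorm F X))}"

definition cstar_state :: "'v cip_space \<Rightarrow> ('v \<Rightarrow> 'v) set \<Rightarrow> (('v \<Rightarrow> 'v) \<Rightarrow> complex) \<Rightarrow> bool" where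
  "cstar_state F A \<phi> \<longleftrightarrow> \<phi> \<in> cstar_dual F A \<and> \<phi> (op_id F) = 1 \<and>
     (\<forall>X\<in>A. \<phi> (op_mult F (op_adj F X) X) \<in> \<real>\<^sub>\<ge>\<^sub>0)"

definition invariant_state ::
    "'v cip_space \<Rightarrow> ('v \<Rightarrow> 'v) set \<Rightarrow> (('v \<Rightarrow> 'v) \<Rightarrow> ('v \<Rightarrow> 'v)) \<Rightarrow>
     (('v \<Rightarrow> 'v) \<Rightarrow> complex) \<Rightarrow> bool" where
  "invariant_state F A \<alpha> \<phi> \<longleftrightarrow> cstar_state F A \<phi> \<and> (\<forall>X\<in>A. \<phi> (\<alpha> X) = \<phi> X)"

definition unique_invariant_state ::
    "'v cip_space \<Rightarrow> ('v \<Rightarrow> 'v) set \<Rightarrow> (('v \<Rightarrow> 'v) \<Rightarrow> ('v \<Rightarrow> 'v)) \<Rightarrow>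
     (('v \<Rightarrow> 'v) \<Rightarrow> complex) \<Rightarrow> bool" where
  "unique_invariant_state F A \<alpha> \<omega> \<longleftrightarrow> invariant_state F A \<alpha> \<omega> \<and>
     (\<forall>\<phi>. invariant_state F A \<alpha> \<phi> \<longrightarrow> (\<forall>X\<in>A. \<phi> X = \<omega> X))"


section \<open>Tensor powers of l2(Z) and Yang-Baxter operators\<close>

text \<open>
  The \<open>n\<close>-th Hilbert space tensor power of \<open>\<ell>\<^sup>2(\<int>)\<close> is \<open>\<ell>\<^sup>2(\<int>\<^sup>n)\<close>, realised
  as the square-summable functions on integer words that vanish on words of length other
  than \<open>n\<close>; the basis vector indexed by the word \<open>[i\<^sub>1, \<dots>, i\<^sub>n]\<close> is the elementary
  tensor of the corresponding basis vectors of \<open>\<ell>\<^sup>2(\<int>)\<close>.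
\<close>

type_synonym tvec = "int list \<Rightarrow> complex"

definition ket :: "'i \<Rightarrow> 'i \<Rightarrow> complex" where
  "ket i = (\<lambda>j. if j = i then 1 else 0)"

definition tpow :: "nat \<Rightarrow> tvec cip_space" where
  "tpow n = \<lparr>
     vcar = {x. (\<lambda>w. (cmod (x w))\<^sup>2) summable_on UNIV \<and> (\<forall>w. length w \<noteq> n \<longrightarrow> x w = 0)},
     vzero = (\<lambda>_. 0),
     vadd = (\<lambda>x y w. x w + y w),
     vscale = (\<lambda>c x w. c * x w),
     vinner = (\<lambda>x y. \<Sum>\<^sub>\<infinity>w. x w * cnj (y w)) \<rparr>"

text \<open>\<open>f \<otimes> \<xi>\<close>\<close>

definition tens :: "(int \<Rightarrow> complex) \<Rightarrow> tvec \<Rightarrow> tvec" where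
  "tens f \<xi> w = (case w of [] \<Rightarrow> 0 | i # v \<Rightarrow> f i * \<xi> v)"

text \<open>\<open>I \<otimes> X\<close>, where \<open>I\<close> acts on the first tensor factor\<close>

definition id_tens :: "(tvec \<Rightarrow> tvec) \<Rightarrow> tvec \<Rightarrow> tvec" where
  "id_tens X \<xi> w = (case w of [] \<Rightarrow> 0 | i # v \<Rightarrow> X (\<lambda>u. \<xi> (i # u)) v)"

text \<open>
  The operator \<open>T\<^sub>k\<close> (with \<open>1 \<le> k < n\<close>) applies \<open>T\<close> to the tensor factors \<open>k\<close> and
  \<open>k+1\<close>: for fixed values of all other letters of the word, \<open>\<xi>\<close> is a vector of the second
  tensor power as a function of letters \<open>k\<close> and \<open>k+1\<close>, and \<open>T\<close> is applied to it.
\<close>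

definition ampl :: "(tvec \<Rightarrow> tvec) \<Rightarrow> nat \<Rightarrow> tvec \<Rightarrow> tvec" where
  "ampl T k \<xi> w = (if 1 \<le> k \<and> k < length w
     then T (\<lambda>v. if length v = 2 then \<xi> (take (k - 1) w @ v @ drop (k + 1) w) else 0)
            [w ! (k - 1), w ! k]
     else 0)"

text \<open>
  \<open>T\<close> is defined on all of the second tensor power; being symmetric it is then
  selfadjoint (and bounded).
\<close>

definition yang_baxter :: "(tvec \<Rightarrow> tvec) \<Rightarrow> bool" where
  "yang_baxter T \<longleftrightarrow>
     linear_op (tpow 2) T \<and>
     (\<forall>\<xi>\<in>vcar (tpow 2). \<forall>\<eta>\<in>vcar (tpow 2).
        vinner (tpow 2) (T \<xi>) \<eta> = vinner (tpow 2) \<xi> (T \<eta>)) \<and>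
     (\<forall>\<xi>\<in>vcar (tpow 2). Re (vinner (tpow 2) (T \<xi>) \<xi>) \<ge> - Re (vinner (tpow 2) \<xi> \<xi>)) \<and>
     (\<forall>\<xi>\<in>vcar (tpow 3).
        ampl T 1 (ampl T 2 (ampl T 1 \<xi>)) = ampl T 2 (ampl T 1 (ampl T 2 \<xi>)))"

definition yang_baxter_hecke :: "(tvec \<Rightarrow> tvec) \<Rightarrow> bool" where
  "yang_baxter_hecke T \<longleftrightarrow> yang_baxter T \<and>
     (\<exists>q::real. q \<ge> -1 \<and>
        (\<forall>\<xi>\<in>vcar (tpow 2). T (T \<xi>) = (\<lambda>w. complex_of_real (q - 1) * T \<xi> w
                                             + complex_of_real q * \<xi> w)))"

text \<open>\<open>tmat T i j k l\<close> is \<open>t\<^sub>i\<^sub>j\<^sup>k\<^sup>l\<close>, the coefficient of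
  \<open>e\<^sub>k \<otimes> e\<^sub>l\<close> in \<open>T (e\<^sub>i \<otimes> e\<^sub>j)\<close>.\<close>

definition tmat :: "(tvec \<Rightarrow> tvec) \<Rightarrow> int \<Rightarrow> int \<Rightarrow> int \<Rightarrow> int \<Rightarrow> complex" where
  "tmat T i j k l = T (ket [i, j]) [k, l]"

text \<open>\<open>T\<^sub>1 T\<^sub>2 \<cdots> T\<^sub>k\<close>\<close>

primrec ampl_prod :: "(tvec \<Rightarrow> tvec) \<Rightarrow> nat \<Rightarrow> tvec \<Rightarrow> tvec" where
  "ampl_prod T 0 = id"
| "ampl_prod T (Suc k) = ampl_prod T k \<circ> ampl T (Suc k)"

definition Rop :: "(tvec \<Rightarrow> tvec) \<Rightarrow> nat \<Rightarrow> tvec \<Rightarrow> tvec" where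
  "Rop T n \<xi> w = (\<Sum>k<n. ampl_prod T k \<xi> w)"

text \<open>The value at \<open>0\<close> gives the usual inner product on the zeroth power, the complex
  numbers.\<close>

fun Pop :: "(tvec \<Rightarrow> tvec) \<Rightarrow> nat \<Rightarrow> tvec \<Rightarrow> tvec" where
  "Pop T 0 = id"
| "Pop T (Suc 0) = id"
| "Pop T (Suc (Suc n)) = id_tens (Pop T (Suc n)) \<circ> Rop T (Suc (Suc n))"

definition MT :: "(tvec \<Rightarrow> tvec) \<Rightarrow> ennreal" where
  "MT T = (SUP n\<in>{1..}. opnorm (tpow n) (Rop T n))"


section \<open>The T-deformed Fock space and the algebra of its annihilators\<close>

definition pre_fock :: "(tvec \<Rightarrow> tvec) \<Rightarrow> nat \<Rightarrow> tvec cip_space" where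
  "pre_fock T n = (tpow n)\<lparr>vinner := (\<lambda>\<xi> \<eta>. vinner (tpow n) \<xi> (Pop T n \<eta>))\<rparr>"

type_synonym fock_vec = "nat \<Rightarrow> (nat \<Rightarrow> tvec) set"

definition fock :: "(tvec \<Rightarrow> tvec) \<Rightarrow> fock_vec cip_space" where
  "fock T = hilbert_sum (\<lambda>n. completion (pre_fock T n))"

definition vacuum :: "(tvec \<Rightarrow> tvec) \<Rightarrow> fock_vec" where
  "vacuum T = (\<lambda>n. embed (pre_fock T n) (if n = 0 then ket [] else (\<lambda>_. 0)))"

definition creation :: "(tvec \<Rightarrow> tvec) \<Rightarrow> (int \<Rightarrow> complex) \<Rightarrow> fock_vec \<Rightarrow> fock_vec" where
  "creation T f = (\<lambda>x\<in>vcar (fock T). \<lambda>n. case n of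
       0 \<Rightarrow> vzero (completion (pre_fock T 0))
     | Suc m \<Rightarrow> extend (pre_fock T (Suc m)) (tens f) (x m))"

definition annihilation :: "(tvec \<Rightarrow> tvec) \<Rightarrow> (int \<Rightarrow> complex) \<Rightarrow> fock_vec \<Rightarrow> fock_vec" where
  "annihilation T f = op_adj (fock T) (creation T f)"

definition RT :: "(tvec \<Rightarrow> tvec) \<Rightarrow> (fock_vec \<Rightarrow> fock_vec) set" where
  "RT T = cstar_gen (fock T) (range (\<lambda>i::int. annihilation T (ket i)))"

text \<open>The tensor powers of the right shift \<open>U\<close>; on basis vectors, every letter of the word
  is increased by 1.\<close>

definition shift :: "tvec \<Rightarrow> tvec" where
  "shift \<xi> = (\<lambda>w. \<xi> (map (\<lambda>i. i - 1) w))"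

definition fock_shift :: "(tvec \<Rightarrow> tvec) \<Rightarrow> fock_vec \<Rightarrow> fock_vec" where
  "fock_shift T = (\<lambda>x\<in>vcar (fock T). \<lambda>n. extend (pre_fock T n) shift (x n))"

definition shift_aut :: "(tvec \<Rightarrow> tvec) \<Rightarrow> (fock_vec \<Rightarrow> fock_vec) \<Rightarrow> fock_vec \<Rightarrow> fock_vec" where
  "shift_aut T X =
     op_mult (fock T) (fock_shift T) (op_mult (fock T) X (op_adj (fock T) (fock_shift T)))"

definition vacuum_state :: "(tvec \<Rightarrow> tvec) \<Rightarrow> (fock_vec \<Rightarrow> fock_vec) \<Rightarrow> complex" where
  "vacuum_state T X = vinner (fock T) (X (vacuum T)) (vacuum T)"

end

(*
  Idea. For a Yang-Baxter-Hecke operator one has P T_k = q P, hence P P^* = [n]_q! P for P = P^(n):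
  the deformed inner product is the pull-back of the ordinary one under P^*, up to the factor
  1/[n]_q!. Together with sup ||R^(n)|| < oo this gives the row bound
  || sum_k a_k^+ x_k ||^2 <= const * sum_k ||x_k||^2. Hence for X = a_i^+ Z, unimodular z_n and a
  finite set S of indices, || sum_{n in S} z_n alpha^n(X) || <= const * sqrt |S|; choosing z_n to be
  the conjugate phases of f(alpha^n(X)) shows that |f(alpha^n(X))| >= e for only finitely many n,
  so f(alpha^n(X)) -> 0. Taking adjoints gives the same for X = Z a_i. By the (finite) commutation
  rule the Wick-ordered words span the star-algebra generated by the a_i, which is dense, and the
  only Wick-ordered word not of the form a_i^+ Z or Z a_i is the identity.
*)
theory Submission
  imports Defs
begin

text \<open>Why P T_k = q P: P expands through R into products T_1...T_j followed by I \<otimes> P.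
  After right multiplication by T_k, commutation and the braid relation reduce every term except j =
  k-1 and j = k to a T absorbed by I \<otimes> P; the Hecke relation settles those two together. A
  product of j factors inside the adjoint of P is then absorbed as q^j, and these powers add up to
  the q-factorial.

  Selfadjointness and positivity of P are not known in advance; both are read off P P^* = [n]_q! P.
  The factorial may vanish (q = -1, n \<ge> 2). Then P P^* = 0 forces P = 0, and the convention
  \<open>inverse 0 = 0\<close> keeps the formulas valid.

  The weight of the proof lies in the uniformity of the row bound. Two consecutive q-factorials
  leave only 1/[n+1]_q, which is at most max 1 (1/(1+q)), so the constant depends neither on the
  degree n nor on the number of indices. Bounding each creation operator separately would give
  growth |S| for the sum of translates, which says nothing against the lower bound e |S| for the
  functional; the row bound gives sqrt |S|.\<close>

section \<open>Semi-inner product spaces\<close>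

text \<open>No vector space laws are assumed: in a definite space they follow from the
  behaviour of the inner product.\<close>

locale cip =
  fixes V :: "'v cip_space"
  assumes zero_mem [simp, intro]: "vzero V \<in> vcar V"
    and add_mem [simp, intro]: "\<lbrakk>x \<in> vcar V; y \<in> vcar V\<rbrakk> \<Longrightarrow> vadd V x y \<in> vcar V"
    and scale_mem [simp, intro]: "x \<in> vcar V \<Longrightarrow> vscale V c x \<in> vcar V"
    and inner_zero_left [simp]: "x \<in> vcar V \<Longrightarrow> vinner V (vzero V) x = 0"
    and inner_add_left [simp]: "\<lbrakk>x \<in> vcar V; y \<in> vcar V; z \<in> vcar V\<rbrakk> \<Longrightarrow>
      vinner V (vadd V x y) z = vinner V x z + vinner V y z"
    and inner_scale_left [simp]: "\<lbrakk>x \<in> vcar V; z \<in> vcar V\<rbrakk> \<Longrightarrow>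
      vinner V (vscale V c x) z = c * vinner V x z"
    and cnj_inner [simp]: "\<lbrakk>x \<in> vcar V; y \<in> vcar V\<rbrakk> \<Longrightarrow> cnj (vinner V x y) = vinner V y x"
    and inner_nonneg [simp]: "x \<in> vcar V \<Longrightarrow> 0 \<le> Re (vinner V x x)"
begin

lemma diff_mem [simp, intro]: "\<lbrakk>x \<in> vcar V; y \<in> vcar V\<rbrakk> \<Longrightarrow> vdiff V x y \<in> vcar V"
  by (simp add: vdiff_def)

lemma inner_zero_right [simp]: "x \<in> vcar V \<Longrightarrow> vinner V x (vzero V) = 0"
  by (metis cnj_inner complex_cnj_zero inner_zero_left zero_mem)

lemma inner_add_right [simp]:
  assumes "x \<in> vcar V" "y \<in> vcar V" "z \<in> vcar V"
  shows "vinner V z (vadd V x y) = vinner V z x + vinner V z y"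
proof -
  have "vinner V z (vadd V x y) = cnj (vinner V (vadd V x y) z)"
    using assms by (simp only: cnj_inner add_mem)
  also have "\<dots> = vinner V z x + vinner V z y"
    using assms by simp
  finally show ?thesis .
qed

lemma inner_scale_right [simp]:
  assumes "x \<in> vcar V" "z \<in> vcar V"
  shows "vinner V z (vscale V c x) = cnj c * vinner V z x"
proof -
  have "vinner V z (vscale V c x) = cnj (vinner V (vscale V c x) z)"
    using assms by (simp only: cnj_inner scale_mem)
  also have "\<dots> = cnj c * vinner V z x"
    using assms by simp
  finally show ?thesis .
qed

lemma inner_diff_left [simp]: "\<lbrakk>x \<in> vcar V; y \<in> vcar V; z \<in> vcar V\<rbrakk> \<Longrightarrow>
    vinner V (vdiff V x y) z = vinner V x z - vinner V y z"
  and inner_diff_right [simp]: "\<lbrakk>x \<in> vcar V; y \<in> vcar V; z \<in> vcar V\<rbrakk> \<Longrightarrow>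
    vinner V z (vdiff V x y) = vinner V z x - vinner V z y"
  by (simp_all add: vdiff_def)

lemma Re_inner_commute: "\<lbrakk>x \<in> vcar V; y \<in> vcar V\<rbrakk> \<Longrightarrow> Re (vinner V y x) = Re (vinner V x y)"
  by (metis cnj_inner cnj.sel(1))

lemma norm_nonneg [simp]: "x \<in> vcar V \<Longrightarrow> 0 \<le> vnorm V x"
  by (simp add: vnorm_def)

lemma norm_sq: "x \<in> vcar V \<Longrightarrow> (vnorm V x)\<^sup>2 = Re (vinner V x x)"
  by (simp add: vnorm_def)

lemma inner_self: "x \<in> vcar V \<Longrightarrow> vinner V x x = of_real ((vnorm V x)\<^sup>2)"
proof -
  assume x: "x \<in> vcar V"
  have "Im (vinner V x x) = 0"
    using arg_cong[OF cnj_inner[OF x x], of Im] by simp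
  then show ?thesis using x by (simp add: complex_eq_iff norm_sq)
qed

lemma norm_cong:
  assumes "x \<in> vcar V" "y \<in> vcar V" "\<And>z. z \<in> vcar V \<Longrightarrow> vinner V x z = vinner V y z"
  shows "vnorm V x = vnorm V y"
  using assms by (metis Re_inner_commute vnorm_def)

lemma norm_scale [simp]:
  assumes x: "x \<in> vcar V"
  shows "vnorm V (vscale V c x) = cmod c * vnorm V x"
proof -
  have "vinner V (vscale V c x) (vscale V c x) = (c * cnj c) * vinner V x x"
    using x by simp
  also have "\<dots> = of_real ((cmod c * vnorm V x)\<^sup>2)"
    using x by (simp only: inner_self complex_norm_square[symmetric] power_mult_distrib
        of_real_mult of_real_power)
  finally show ?thesis
    using x by (simp add: vnorm_def[of V "vscale V c x"] del: inner_scale_left inner_scale_right)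
qed

lemma norm_zero [simp]: "vnorm V (vzero V) = 0"
  by (simp add: vnorm_def)

lemma Cauchy_Schwarz:
  assumes x: "x \<in> vcar V" and y: "y \<in> vcar V"
  shows "cmod (vinner V x y) \<le> vnorm V x * vnorm V y"
proof -
  define a where "a = vinner V x y"
  define A where "A = (cmod a)\<^sup>2"
  have aa: "a * cnj a = of_real A" "cnj a * a = of_real A"
    by (simp_all only: A_def complex_norm_square mult.commute)
  have yx: "vinner V y x = cnj a"
    using x y by (simp add: a_def)
  \<comment> \<open>This is the squared seminorm of x - t a y. The factor a absorbs the phase of the
    inner product, which leaves a real quadratic in t.\<close>
  have key: "0 \<le> (vnorm V x)\<^sup>2 - 2 * t * A + t\<^sup>2 * A * (vnorm V y)\<^sup>2" for t :: real
  proof -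
    let ?z = "vadd V x (vscale V (- (of_real t * a)) y)"
    have "vinner V ?z ?z = vinner V x x - of_real t * (a * cnj a) - of_real t * (a * cnj a)
        + of_real t * of_real t * (a * cnj a) * vinner V y y"
      using x y by (simp add: yx flip: a_def) (simp add: algebra_simps)
    also have "\<dots> = of_real ((vnorm V x)\<^sup>2 - 2 * t * A + t\<^sup>2 * A * (vnorm V y)\<^sup>2)"
      using x y by (simp add: inner_self aa power2_eq_square algebra_simps)
    finally show ?thesis
      using inner_nonneg[of ?z] x y by simp
  qed
  have "A \<le> (vnorm V x)\<^sup>2 * (vnorm V y)\<^sup>2"
  proof (cases "(vnorm V y)\<^sup>2 = 0")
    case True
    have "A = 0"
    proof (rule ccontr)
      assume "A \<noteq> 0"
      then have "A > 0" by (simp add: A_def)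
      \<comment> \<open>When y has seminorm 0 the quadratic is affine in t, and this t would make it
        equal to -1. Otherwise the minimiser t = 1/Y is used.\<close>
      have "0 \<le> (vnorm V x)\<^sup>2 - 2 * (((vnorm V x)\<^sup>2 + 1) / (2 * A)) * A"
        using key[of "((vnorm V x)\<^sup>2 + 1) / (2 * A)"] True by simp
      then show False using \<open>A > 0\<close> by (simp add: field_simps)
    qed
    then show ?thesis by simp
  next
    case False
    define Y where "Y = (vnorm V y)\<^sup>2"
    have "Y > 0" using False by (simp add: Y_def)
    have "0 \<le> (vnorm V x)\<^sup>2 - 2 * (1/Y) * A + (1/Y)\<^sup>2 * A * Y"
      using key[of "1/Y"] by (simp add: Y_def)
    then have "0 \<le> (vnorm V x)\<^sup>2 - A / Y"
      using \<open>Y > 0\<close> by (simp add: power2_eq_square field_simps)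
    then show ?thesis using \<open>Y > 0\<close> by (simp add: field_simps flip: Y_def)
  qed
  then have "(cmod a)\<^sup>2 \<le> (vnorm V x * vnorm V y)\<^sup>2"
    by (simp add: A_def power_mult_distrib)
  then show ?thesis
    unfolding a_def by (rule power2_le_imp_le) (use x y in simp)
qed

lemma Re_inner_le: "\<lbrakk>x \<in> vcar V; y \<in> vcar V\<rbrakk> \<Longrightarrow> Re (vinner V x y) \<le> vnorm V x * vnorm V y"
  using Cauchy_Schwarz complex_Re_le_cmod order_trans by blast

lemma norm_add_sq:
  assumes "x \<in> vcar V" "y \<in> vcar V"
  shows "(vnorm V (vadd V x y))\<^sup>2 = (vnorm V x)\<^sup>2 + 2 * Re (vinner V y x) + (vnorm V y)\<^sup>2"
  using assms by (simp add: norm_sq Re_inner_commute[OF assms])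

lemma norm_triangle:
  assumes x: "x \<in> vcar V" and y: "y \<in> vcar V"
  shows "vnorm V (vadd V x y) \<le> vnorm V x + vnorm V y"
proof (rule power2_le_imp_le)
  have "(vnorm V (vadd V x y))\<^sup>2 = (vnorm V x)\<^sup>2 + 2 * Re (vinner V y x) + (vnorm V y)\<^sup>2"
    using x y by (rule norm_add_sq)
  also have "\<dots> \<le> (vnorm V x + vnorm V y)\<^sup>2"
    using Re_inner_le[OF y x] by (simp add: power2_sum mult.commute)
  finally show "(vnorm V (vadd V x y))\<^sup>2 \<le> (vnorm V x + vnorm V y)\<^sup>2" .
qed (use x y in simp)

lemma norm_diff_commute: "\<lbrakk>x \<in> vcar V; y \<in> vcar V\<rbrakk> \<Longrightarrow> vnorm V (vdiff V x y) = vnorm V (vdiff V y x)"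
  by (simp add: vnorm_def)

lemma norm_diff_self [simp]: "x \<in> vcar V \<Longrightarrow> vnorm V (vdiff V x x) = 0"
  by (simp add: vnorm_def)

lemma norm_diff_triangle:
  assumes "x \<in> vcar V" "y \<in> vcar V" "z \<in> vcar V"
  shows "vnorm V (vdiff V x z) \<le> vnorm V (vdiff V x y) + vnorm V (vdiff V y z)"
proof -
  have "vnorm V (vdiff V x z) = vnorm V (vadd V (vdiff V x y) (vdiff V y z))"
    using assms by (intro norm_cong) auto
  then show ?thesis using assms by (simp add: norm_triangle)
qed

lemma norm_le_add_diff:
  assumes "x \<in> vcar V" "y \<in> vcar V"
  shows "vnorm V x \<le> vnorm V y + vnorm V (vdiff V x y)"
proof -
  have "vnorm V x = vnorm V (vadd V y (vdiff V x y))"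
    using assms by (intro norm_cong) auto
  then show ?thesis using assms by (metis diff_mem norm_triangle)
qed

lemma abs_norm_diff_le:
  assumes "x \<in> vcar V" "y \<in> vcar V"
  shows "\<bar>vnorm V x - vnorm V y\<bar> \<le> vnorm V (vdiff V x y)"
  using norm_le_add_diff[OF assms] norm_le_add_diff[OF assms(2,1)] norm_diff_commute[OF assms]
  by linarith

lemma norm_diff_add_le:
  assumes "x \<in> vcar V" "y \<in> vcar V" "x' \<in> vcar V" "y' \<in> vcar V"
  shows "vnorm V (vdiff V (vadd V x y) (vadd V x' y')) \<le> vnorm V (vdiff V x x') + vnorm V (vdiff V y y')"
proof -
  have "vnorm V (vdiff V (vadd V x y) (vadd V x' y')) = vnorm V (vadd V (vdiff V x x') (vdiff V y y'))"
    using assms by (intro norm_cong) auto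
  then show ?thesis using assms by (simp add: norm_triangle)
qed

lemma norm_diff_scale:
  assumes "x \<in> vcar V" "y \<in> vcar V"
  shows "vnorm V (vdiff V (vscale V c x) (vscale V c y)) = cmod c * vnorm V (vdiff V x y)"
proof -
  have "vnorm V (vdiff V (vscale V c x) (vscale V c y)) = vnorm V (vscale V c (vdiff V x y))"
    using assms by (intro norm_cong) (auto simp: algebra_simps)
  then show ?thesis using assms by simp
qed

lemma inner_diff_le:
  assumes "x \<in> vcar V" "y \<in> vcar V" "x' \<in> vcar V" "y' \<in> vcar V"
  shows "cmod (vinner V x y - vinner V x' y')
    \<le> vnorm V (vdiff V x x') * vnorm V y + vnorm V x' * vnorm V (vdiff V y y')"
proof -
  have "vinner V x y - vinner V x' y' = vinner V (vdiff V x x') y + vinner V x' (vdiff V y y')"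
    using assms by simp
  then have "cmod (vinner V x y - vinner V x' y')
      \<le> cmod (vinner V (vdiff V x x') y) + cmod (vinner V x' (vdiff V y y'))"
    by (simp add: norm_triangle_ineq)
  also have "\<dots> \<le> vnorm V (vdiff V x x') * vnorm V y + vnorm V x' * vnorm V (vdiff V y y')"
    using assms by (intro add_mono Cauchy_Schwarz) auto
  finally show ?thesis .
qed

lemma norm_tendsto:
  assumes "\<And>k. s k \<in> vcar V" "x \<in> vcar V" "(\<lambda>k. vnorm V (vdiff V (s k) x)) \<longlonglongrightarrow> 0"
  shows "(\<lambda>k. vnorm V (s k)) \<longlonglongrightarrow> vnorm V x"
proof -
  have "(\<lambda>k. vnorm V (s k) - vnorm V x) \<longlonglongrightarrow> 0"
    by (rule Lim_null_comparison[OF _ assms(3)]) (use assms(1,2) abs_norm_diff_le in auto)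
  then show ?thesis by (simp add: LIM_zero_iff)
qed

lemma inner_tendsto:
  assumes s: "\<And>k. s k \<in> vcar V" "x \<in> vcar V" "(\<lambda>k. vnorm V (vdiff V (s k) x)) \<longlonglongrightarrow> 0"
    and t: "\<And>k. t k \<in> vcar V" "y \<in> vcar V" "(\<lambda>k. vnorm V (vdiff V (t k) y)) \<longlonglongrightarrow> 0"
  shows "(\<lambda>k. vinner V (s k) (t k)) \<longlonglongrightarrow> vinner V x y"
proof -
  have "(\<lambda>k. vnorm V (vdiff V (s k) x) * vnorm V (t k) + vnorm V x * vnorm V (vdiff V (t k) y))
      \<longlonglongrightarrow> 0 * vnorm V y + vnorm V x * 0"
    by (intro tendsto_intros s t norm_tendsto)
  then have lim: "(\<lambda>k. vnorm V (vdiff V (s k) x) * vnorm V (t k) + vnorm V x * vnorm V (vdiff V (t k) y))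
      \<longlonglongrightarrow> 0"
    by simp
  have "(\<lambda>k. vinner V (s k) (t k) - vinner V x y) \<longlonglongrightarrow> 0"
    by (rule Lim_null_comparison[OF always_eventually lim]) (intro allI inner_diff_le s t)
  then show ?thesis by (simp add: LIM_zero_iff)
qed

text \<open>Transfers a bound from an operator to its adjoint: apply it with x the adjoint image of
  z and y the image of x under the operator.\<close>

lemma adjoint_norm_le:
  assumes x: "x \<in> vcar V" "y \<in> vcar V" "z \<in> vcar V" and eq: "vinner V x x = vinner V y z"
    and y: "vnorm V y \<le> C * vnorm V x" and "0 \<le> C"
  shows "vnorm V x \<le> C * vnorm V z"
proof (cases "vnorm V x = 0")
  case False
  have "(vnorm V x)\<^sup>2 \<le> vnorm V y * vnorm V z"
    using x by (simp add: norm_sq eq Re_inner_le)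
  also have "\<dots> \<le> C * vnorm V x * vnorm V z"
    using x y by (intro mult_right_mono) auto
  finally have "vnorm V x * vnorm V x \<le> vnorm V x * (C * vnorm V z)"
    by (simp add: power2_eq_square mult_ac)
  then show ?thesis
    using False norm_nonneg[OF x(1)] by (simp add: mult_le_cancel_left)
qed (use x assms in simp)

end

lemma linear_opD:
  assumes "linear_op V X" "x \<in> vcar V"
  shows "X x \<in> vcar V" "y \<in> vcar V \<Longrightarrow> X (vadd V x y) = vadd V (X x) (X y)"
    "X (vscale V c x) = vscale V c (X x)" "y \<in> vcar V \<Longrightarrow> cip V \<Longrightarrow> X (vdiff V x y) = vdiff V (X x) (X y)"
  using assms by (auto simp: linear_op_def vdiff_def cip.scale_mem)

text \<open>Rescaling to the unit ball. A vector of seminorm 0 cannot be normalised, but all its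
  multiples lie in the ball, so a finite supremum forces its image to have seminorm 0 as
  well.\<close>

lemma (in cip) vnorm_le_opnorm:
  assumes X: "linear_op V X" and fin: "opnorm V X < \<infinity>" and x: "x \<in> vcar V"
  shows "vnorm V (X x) \<le> enn2real (opnorm V X) * vnorm V x"
proof -
  have unit: "vnorm V (X y) \<le> enn2real (opnorm V X)" if "y \<in> vcar V" "vnorm V y \<le> 1" for y
  proof -
    have "ennreal (vnorm V (X y)) \<le> opnorm V X"
      unfolding opnorm_def by (rule SUP_upper) (use that in auto)
    then have "enn2real (ennreal (vnorm V (X y))) \<le> enn2real (opnorm V X)"
      by (rule enn2real_mono) (use fin in \<open>simp add: top.not_eq_extremum\<close>)
    then show ?thesis using linear_opD(1)[OF X that(1)] by simp
  qed
  have sc: "cmod c * vnorm V (X x) \<le> enn2real (opnorm V X)" if "cmod c * vnorm V x \<le> 1" for c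
    using unit[of "vscale V c x"] that x linear_opD[OF X x] by simp
  show ?thesis
  proof (cases "vnorm V x = 0")
    case True
    have "vnorm V (X x) = 0"
    proof (rule ccontr)
      assume "vnorm V (X x) \<noteq> 0"
      then have p: "vnorm V (X x) > 0"
        using norm_nonneg[OF linear_opD(1)[OF X x]] by linarith
      define r where "r = (enn2real (opnorm V X) + 1) / vnorm V (X x)"
      have "r \<ge> 0" using p by (simp add: r_def add_nonneg_nonneg)
      then have "r * vnorm V (X x) \<le> enn2real (opnorm V X)"
        using sc[of "of_real r"] True by simp
      then have "enn2real (opnorm V X) + 1 \<le> enn2real (opnorm V X)"
        using p by (simp add: r_def)
      then show False by linarith
    qed
    then show ?thesis using True by simp
  next
    case False
    then have p: "vnorm V x > 0" using norm_nonneg[OF x] by linarith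
    have "(1 / vnorm V x) * vnorm V (X x) \<le> enn2real (opnorm V X)"
      using sc[of "of_real (1 / vnorm V x)"] p by (simp add: norm_divide)
    then show ?thesis using p by (simp add: field_simps)
  qed
qed

lemma (in cip) opnorm_le:
  assumes "\<And>x. x \<in> vcar V \<Longrightarrow> vnorm V (X x) \<le> C * vnorm V x" "0 \<le> C"
  shows "opnorm V X \<le> ennreal C"
  unfolding opnorm_def
proof (rule SUP_least)
  fix x assume x: "x \<in> {x \<in> vcar V. vnorm V x \<le> 1}"
  then have "vnorm V (X x) \<le> C * vnorm V x" using assms by blast
  also have "\<dots> \<le> C * 1" using x assms(2) by (intro mult_left_mono) auto
  finally show "ennreal (vnorm V (X x)) \<le> ennreal C" by (simp add: ennreal_leI)
qed

lemma (in cip) bounded_ops_iff: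
  "X \<in> bounded_ops V \<longleftrightarrow> X \<in> extensional (vcar V) \<and> linear_op V X \<and>
     (\<exists>C\<ge>0. \<forall>x\<in>vcar V. vnorm V (X x) \<le> C * vnorm V x)"
proof -
  have "opnorm V X < \<infinity>" if "C \<ge> 0" "\<forall>x\<in>vcar V. vnorm V (X x) \<le> C * vnorm V x" for C
    using opnorm_le[of X C] that by (simp add: le_less_trans)
  then show ?thesis
    unfolding bounded_ops_def using vnorm_le_opnorm[of X] enn2real_nonneg by blast
qed


section \<open>Hilbert spaces and their bounded operators\<close>

locale hilb = cip +
  assumes definite: "\<lbrakk>x \<in> vcar V; y \<in> vcar V; vnorm V (vdiff V x y) = 0\<rbrakk> \<Longrightarrow> x = y"
    and complete: "s \<in> cauchy_seqs V \<Longrightarrow> \<exists>x\<in>vcar V. (\<lambda>k. vnorm V (vdiff V (s k) x)) \<longlonglongrightarrow> 0"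
begin

lemma vec_eqI:
  assumes x: "x \<in> vcar V" and y: "y \<in> vcar V"
    and eq: "\<And>z. z \<in> vcar V \<Longrightarrow> vinner V x z = vinner V y z"
  shows "x = y"
  by (rule definite[OF x y]) (use x y eq in \<open>simp add: vnorm_def del: inner_diff_right\<close>)

lemma vec_eqI':
  assumes x: "x \<in> vcar V" and y: "y \<in> vcar V"
    and eq: "\<And>z. z \<in> vcar V \<Longrightarrow> vinner V z x = vinner V z y"
  shows "x = y"
  by (rule vec_eqI[OF x y]) (metis cnj_inner eq x y)

text \<open>The representing vector minimises \<open>\<parallel>x\<parallel>\<^sup>2 - 2 Re (\<phi> x)\<close>.\<close>

lemma Riesz:
  assumes add: "\<And>x y. x \<in> vcar V \<Longrightarrow> y \<in> vcar V \<Longrightarrow> \<phi> (vadd V x y) = \<phi> x + \<phi> y"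
    and scale: "\<And>c x. x \<in> vcar V \<Longrightarrow> \<phi> (vscale V c x) = c * \<phi> x"
    and bound: "\<And>x. x \<in> vcar V \<Longrightarrow> cmod (\<phi> x) \<le> C * vnorm V x"
  shows "\<exists>z\<in>vcar V. \<forall>x\<in>vcar V. \<phi> x = vinner V x z"
proof -
  define J where "J x = (vnorm V x)\<^sup>2 - 2 * Re (\<phi> x)" for x
  define m where "m = Inf (J ` vcar V)"
  \<comment> \<open>Completing the square: the expression is at least (|x| - C)^2 - C^2.\<close>
  have lower: "- C\<^sup>2 \<le> J x" if x: "x \<in> vcar V" for x
  proof -
    have "Re (\<phi> x) \<le> C * vnorm V x"
      using bound[OF x] complex_Re_le_cmod order_trans by blast
    then have "J x \<ge> (vnorm V x)\<^sup>2 - 2 * (C * vnorm V x)" by (simp add: J_def)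
    moreover have "0 \<le> (vnorm V x - C)\<^sup>2" by simp
    ultimately show ?thesis by (simp add: power2_diff algebra_simps)
  qed
  then have bdd: "bdd_below (J ` vcar V)" by (auto simp: bdd_below_def)
  have m_le: "m \<le> J x" if "x \<in> vcar V" for x
    unfolding m_def using bdd that by (simp add: cINF_lower)
  have "\<exists>x\<in>vcar V. J x < m + e" if "e > 0" for e
  proof (rule ccontr)
    assume "\<not> ?thesis"
    then have "m + e \<le> m"
      unfolding m_def by (intro cINF_greatest) (auto simp: m_def not_less)
    then show False using that by simp
  qed
  then have "\<exists>x\<in>vcar V. J x < m + inverse (Suc k)" for k :: nat
    by simp
  then obtain s where s: "\<And>k. s k \<in> vcar V" "\<And>k. J (s k) < m + inverse (Suc k)"
    by metis
  \<comment> \<open>Parallelogram identity applied to the midpoint, where \<open>J\<close> is still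
    at least m. It makes a minimising sequence Cauchy.\<close>
  have para: "(vnorm V (vdiff V x y))\<^sup>2 \<le> 2 * (J x - m) + 2 * (J y - m)"
    if x: "x \<in> vcar V" and y: "y \<in> vcar V" for x y
  proof -
    let ?z = "vscale V (1/2) (vadd V x y)"
    have "J ?z = ((vnorm V x)\<^sup>2 + (vnorm V y)\<^sup>2 + 2 * Re (vinner V x y)) / 4 - Re (\<phi> x) - Re (\<phi> y)"
      using x y by (simp add: J_def norm_sq add scale Re_inner_commute[OF x y] power_divide field_simps)
    moreover have "(vnorm V (vdiff V x y))\<^sup>2 = (vnorm V x)\<^sup>2 + (vnorm V y)\<^sup>2 - 2 * Re (vinner V x y)"
      using x y by (simp add: norm_sq Re_inner_commute[OF x y])
    moreover have "m \<le> J ?z" using x y by (intro m_le) auto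
    ultimately have "4 * m \<le> (vnorm V x)\<^sup>2 + (vnorm V y)\<^sup>2 + 2 * Re (vinner V x y) - 4 * Re (\<phi> x) - 4 * Re (\<phi> y)"
      "(vnorm V (vdiff V x y))\<^sup>2 = (vnorm V x)\<^sup>2 + (vnorm V y)\<^sup>2 - 2 * Re (vinner V x y)"
      by (auto simp: field_simps)
    then show ?thesis unfolding J_def by argo
  qed
  have "s \<in> cauchy_seqs V"
    unfolding cauchy_seqs_def
  proof (intro CollectI conjI allI impI)
    fix e :: real assume e: "e > 0"
    obtain N where N: "inverse (Suc N) < e\<^sup>2 / 4"
      using reals_Archimedean[of "e\<^sup>2 / 4"] e by auto
    show "\<exists>N. \<forall>m\<ge>N. \<forall>k\<ge>N. vnorm V (vdiff V (s m) (s k)) < e"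
    proof (intro exI allI impI)
      fix i k assume ik: "N \<le> i" "N \<le> k"
      have "inverse (Suc i) \<le> inverse (real (Suc N))" "inverse (Suc k) \<le> inverse (real (Suc N))"
        using ik by (auto intro!: le_imp_inverse_le)
      then have "J (s i) - m < e\<^sup>2 / 4" "J (s k) - m < e\<^sup>2 / 4"
        using s(2)[of i] s(2)[of k] N by linarith+
      then have "(vnorm V (vdiff V (s i) (s k)))\<^sup>2 < e\<^sup>2"
        using para[OF s(1)[of i] s(1)[of k]] by simp
      then show "vnorm V (vdiff V (s i) (s k)) < e"
        using e by (simp add: power_less_imp_less_base)
    qed
  qed (use s in auto)
  then obtain z where z: "z \<in> vcar V" "(\<lambda>k. vnorm V (vdiff V (s k) z)) \<longlonglongrightarrow> 0"
    using complete by blast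
  have phi_diff: "\<phi> (vdiff V x y) = \<phi> x - \<phi> y" if "x \<in> vcar V" "y \<in> vcar V" for x y
    using that by (simp add: vdiff_def add scale)
  have "(\<lambda>k. \<phi> (s k) - \<phi> z) \<longlonglongrightarrow> 0"
  proof (rule Lim_null_comparison)
    show "(\<lambda>k. C * vnorm V (vdiff V (s k) z)) \<longlonglongrightarrow> 0"
      using tendsto_mult_right_zero[OF z(2)] .
    show "\<forall>\<^sub>F k in sequentially. cmod (\<phi> (s k) - \<phi> z) \<le> C * vnorm V (vdiff V (s k) z)"
      using bound s z phi_diff by (metis (mono_tags, lifting) always_eventually diff_mem)
  qed
  then have "(\<lambda>k. \<phi> (s k)) \<longlonglongrightarrow> \<phi> z" by (simp add: LIM_zero_iff)
  then have "(\<lambda>k. J (s k)) \<longlonglongrightarrow> J z"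
    unfolding J_def by (intro tendsto_intros norm_tendsto s z)
  moreover have "(\<lambda>k. m + inverse (real (Suc k))) \<longlonglongrightarrow> m + 0"
    by (intro tendsto_intros LIMSEQ_inverse_real_of_nat)
  ultimately have "J z \<le> m + 0"
    by (rule LIMSEQ_le) (use s(2) less_imp_le in blast)
  then have min: "J z \<le> J x" if "x \<in> vcar V" for x
    using m_le that by fastforce
  have "\<phi> x = vinner V x z" if x: "x \<in> vcar V" for x
  proof -
    define d where "d = vinner V x z - \<phi> x"
    \<comment> \<open>Moving z by c x changes \<open>J\<close> by t |d|^2 (t |x|^2 - 2). The
      denominator keeps t |x|^2 below 1, so a nonzero d would lower the minimum; the summand 1 also
      admits vectors of norm 0.\<close>
    define t where "t = 1 / ((vnorm V x)\<^sup>2 + 1)"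
    define c where "c = - (of_real t * cnj d)"
    have t: "t > 0" "t * (vnorm V x)\<^sup>2 < 1"
      by (auto simp: t_def add_nonneg_pos)
    have cd: "c * d = - of_real (t * (cmod d)\<^sup>2)"
      unfolding of_real_mult complex_norm_square by (simp add: c_def)
    have "J (vadd V z (vscale V c x)) - J z = 2 * Re (c * d) + (cmod c)\<^sup>2 * (vnorm V x)\<^sup>2"
    proof -
      have "(vnorm V (vadd V z (vscale V c x)))\<^sup>2
          = (vnorm V z)\<^sup>2 + 2 * Re (c * vinner V x z) + (vnorm V (vscale V c x))\<^sup>2"
        using x z norm_add_sq[of z "vscale V c x"] by (simp del: norm_scale)
      then show ?thesis using x z
        by (simp add: J_def add scale d_def power_mult_distrib algebra_simps)
    qed
    moreover have "(cmod c)\<^sup>2 = t\<^sup>2 * (cmod d)\<^sup>2"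
      by (simp add: c_def norm_mult power_mult_distrib)
    moreover have "0 \<le> J (vadd V z (vscale V c x)) - J z"
      using min x z by simp
    ultimately have "0 \<le> 2 * - (t * (cmod d)\<^sup>2) + (t\<^sup>2 * (cmod d)\<^sup>2) * (vnorm V x)\<^sup>2"
      by (simp only: cd) simp
    also have "\<dots> = t * (cmod d)\<^sup>2 * (t * (vnorm V x)\<^sup>2 - 2)"
      by (simp add: power2_eq_square algebra_simps)
    finally have "0 \<le> t * (cmod d)\<^sup>2 * (t * (vnorm V x)\<^sup>2 - 2)" .
    moreover have "t * (vnorm V x)\<^sup>2 - 2 < 0" using t by simp
    ultimately have "t * (cmod d)\<^sup>2 \<le> 0"
      by (metis mult_pos_neg not_le)
    then have "d = 0" using t by (simp add: mult_le_0_iff)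
    then show ?thesis by (simp add: d_def)
  qed
  then show ?thesis using z by blast
qed


section \<open>Bounded operators and their adjoints\<close>

lemma bounded_opsD:
  assumes "X \<in> bounded_ops V"
  shows bounded_ops_mem: "x \<in> vcar V \<Longrightarrow> X x \<in> vcar V"
    and bounded_ops_add: "\<lbrakk>x \<in> vcar V; y \<in> vcar V\<rbrakk> \<Longrightarrow> X (vadd V x y) = vadd V (X x) (X y)"
    and bounded_ops_scale: "x \<in> vcar V \<Longrightarrow> X (vscale V c x) = vscale V c (X x)"
    and bounded_ops_bound: "\<exists>C\<ge>0. \<forall>x\<in>vcar V. vnorm V (X x) \<le> C * vnorm V x"
    and bounded_ops_ext: "X \<in> extensional (vcar V)"
    and bounded_ops_opnorm: "x \<in> vcar V \<Longrightarrow> vnorm V (X x) \<le> enn2real (opnorm V X) * vnorm V x"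
  using assms linear_opD[of V X] vnorm_le_opnorm[of X] bounded_ops_iff[of X]
  by (auto simp: bounded_ops_def)

lemma bounded_opsI:
  assumes "X \<in> extensional (vcar V)" "\<And>x. x \<in> vcar V \<Longrightarrow> X x \<in> vcar V"
    "\<And>x y. \<lbrakk>x \<in> vcar V; y \<in> vcar V\<rbrakk> \<Longrightarrow> X (vadd V x y) = vadd V (X x) (X y)"
    "\<And>c x. x \<in> vcar V \<Longrightarrow> X (vscale V c x) = vscale V c (X x)"
    "\<And>x. x \<in> vcar V \<Longrightarrow> vnorm V (X x) \<le> C * vnorm V x"
  shows "X \<in> bounded_ops V"
proof -
  have "vnorm V (X x) \<le> max C 0 * vnorm V x" if "x \<in> vcar V" for x
    using assms(5)[OF that] mult_right_mono[of C "max C 0" "vnorm V x"] that by fastforce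
  then show ?thesis
    unfolding bounded_ops_iff linear_op_def using assms by (auto intro!: exI[of _ "max C 0"])
qed

lemma op_apply [simp]:
  assumes "x \<in> vcar V"
  shows "op_id V x = x" "op_add V X Y x = vadd V (X x) (Y x)" "op_scale V c X x = vscale V c (X x)"
    "op_diff V X Y x = vdiff V (X x) (Y x)" "op_mult V X Y x = X (Y x)"
  using assms by (auto simp: op_id_def op_add_def op_scale_def op_diff_def compose_def)

lemma op_ext [simp, intro]:
  "op_id V \<in> extensional (vcar V)" "op_add V X Y \<in> extensional (vcar V)"
  "op_scale V c X \<in> extensional (vcar V)" "op_diff V X Y \<in> extensional (vcar V)"
  "op_mult V X Y \<in> extensional (vcar V)" "op_adj V X \<in> extensional (vcar V)"
  by (auto simp: op_id_def op_add_def op_scale_def op_diff_def compose_def op_adj_def)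

lemma op_eqI:
  assumes X: "X \<in> bounded_ops V" and Y: "Y \<in> bounded_ops V"
    and eq: "\<And>x y. x \<in> vcar V \<Longrightarrow> y \<in> vcar V \<Longrightarrow> vinner V (X x) y = vinner V (Y x) y"
  shows "X = Y"
  using X Y by (intro extensionalityI[of _ "vcar V"] vec_eqI eq) (auto intro: bounded_opsD)

lemma op_id_bounded [simp, intro]: "op_id V \<in> bounded_ops V"
  by (rule bounded_opsI[where C = 1]) auto

lemma op_scale_bounded [simp, intro]:
  assumes X: "X \<in> bounded_ops V"
  shows "op_scale V c X \<in> bounded_ops V"
proof (rule bounded_opsI)
  fix x assume x: "x \<in> vcar V"
  show "vnorm V (op_scale V c X x) \<le> (cmod c * enn2real (opnorm V X)) * vnorm V x"
    using bounded_ops_opnorm[OF X x] x X by (simp add: bounded_opsD mult.assoc mult_left_mono)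
  show "op_scale V c X (vscale V d x) = vscale V d (op_scale V c X x)" for d
    using X x by (intro vec_eqI) (auto simp: bounded_opsD)
qed (use X in \<open>auto simp: bounded_opsD intro!: vec_eqI simp: algebra_simps\<close>)

lemma op_add_bounded [simp, intro]:
  assumes X: "X \<in> bounded_ops V" and Y: "Y \<in> bounded_ops V"
  shows "op_add V X Y \<in> bounded_ops V"
proof (rule bounded_opsI)
  fix x assume x: "x \<in> vcar V"
  show "vnorm V (op_add V X Y x) \<le> (enn2real (opnorm V X) + enn2real (opnorm V Y)) * vnorm V x"
    using bounded_ops_opnorm[OF X x] bounded_ops_opnorm[OF Y x] x
      norm_triangle[OF bounded_ops_mem[OF X x] bounded_ops_mem[OF Y x]] by (simp add: distrib_right)
qed (use X Y in \<open>auto simp: bounded_opsD intro!: vec_eqI simp: algebra_simps\<close>)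

lemma op_diff_eq: "X \<in> bounded_ops V \<Longrightarrow> Y \<in> bounded_ops V \<Longrightarrow> op_diff V X Y = op_add V X (op_scale V (-1) Y)"
  by (intro extensionalityI[of _ "vcar V"]) (auto simp: vdiff_def)

lemma op_diff_bounded [simp, intro]:
  "X \<in> bounded_ops V \<Longrightarrow> Y \<in> bounded_ops V \<Longrightarrow> op_diff V X Y \<in> bounded_ops V"
  by (simp add: op_diff_eq op_add_bounded op_scale_bounded)

lemma op_mult_bound:
  assumes X: "X \<in> bounded_ops V" and Y: "Y \<in> bounded_ops V" and x: "x \<in> vcar V"
  shows "vnorm V (X (Y x)) \<le> (enn2real (opnorm V X) * enn2real (opnorm V Y)) * vnorm V x"
proof -
  have "vnorm V (X (Y x)) \<le> enn2real (opnorm V X) * vnorm V (Y x)"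
    using X Y x by (simp add: bounded_opsD)
  also have "\<dots> \<le> enn2real (opnorm V X) * (enn2real (opnorm V Y) * vnorm V x)"
    by (rule mult_left_mono[OF bounded_ops_opnorm[OF Y x]]) simp
  finally show ?thesis by (simp add: mult.assoc)
qed

lemma op_mult_bounded [simp, intro]:
  assumes X: "X \<in> bounded_ops V" and Y: "Y \<in> bounded_ops V"
  shows "op_mult V X Y \<in> bounded_ops V"
  by (rule bounded_opsI[where C = "enn2real (opnorm V X) * enn2real (opnorm V Y)"])
    (use X Y op_mult_bound[OF X Y] in \<open>auto simp: bounded_opsD\<close>)

lemma op_mult_assoc:
  "\<lbrakk>X \<in> bounded_ops V; Y \<in> bounded_ops V; Z \<in> bounded_ops V\<rbrakk> \<Longrightarrow>
    op_mult V (op_mult V X Y) Z = op_mult V X (op_mult V Y Z)"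
  by (intro extensionalityI[of _ "vcar V"]) (auto simp: bounded_opsD)

lemma op_id_mult [simp]: "X \<in> bounded_ops V \<Longrightarrow> op_mult V (op_id V) X = X"
    "X \<in> bounded_ops V \<Longrightarrow> op_mult V X (op_id V) = X"
  by (intro extensionalityI[of _ "vcar V"]; auto simp: bounded_opsD)+

text \<open>Makes the definite description in \<open>op_adj\<close> meaningful: existence is the
  Riesz representation of x \<mapsto> \<langle>X x, y\<rangle>, uniqueness is definiteness.\<close>

lemma op_adj_ex1:
  assumes X: "X \<in> bounded_ops V" and y: "y \<in> vcar V"
  shows "\<exists>!z. z \<in> vcar V \<and> (\<forall>x\<in>vcar V. vinner V (X x) y = vinner V x z)"
proof -
  have bnd: "cmod (vinner V (X x) y) \<le> (enn2real (opnorm V X) * vnorm V y) * vnorm V x"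
    if x: "x \<in> vcar V" for x
  proof -
    have "cmod (vinner V (X x) y) \<le> vnorm V (X x) * vnorm V y"
      using X x y by (simp add: Cauchy_Schwarz bounded_opsD)
    also have "\<dots> \<le> (enn2real (opnorm V X) * vnorm V x) * vnorm V y"
      using X x y by (intro mult_right_mono) (auto simp: bounded_opsD)
    finally show ?thesis by (simp add: mult_ac)
  qed
  have "\<exists>z\<in>vcar V. \<forall>x\<in>vcar V. vinner V (X x) y = vinner V x z"
    by (rule Riesz[where C = "enn2real (opnorm V X) * vnorm V y"])
      (use X y bnd in \<open>auto simp: bounded_opsD\<close>)
  moreover have "z = z'" if "z \<in> vcar V" "z' \<in> vcar V"
    "\<forall>x\<in>vcar V. vinner V (X x) y = vinner V x z" "\<forall>x\<in>vcar V. vinner V (X x) y = vinner V x z'"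
    for z z'
    using that by (intro vec_eqI') auto
  ultimately show ?thesis by blast
qed

lemma op_adj_mem [simp, intro]: "X \<in> bounded_ops V \<Longrightarrow> y \<in> vcar V \<Longrightarrow> op_adj V X y \<in> vcar V"
  and inner_op_adj: "X \<in> bounded_ops V \<Longrightarrow> x \<in> vcar V \<Longrightarrow> y \<in> vcar V \<Longrightarrow>
    vinner V x (op_adj V X y) = vinner V (X x) y"
  using theI'[OF op_adj_ex1[of X y]] by (auto simp: op_adj_def)

lemma inner_op_adj_left:
  assumes "X \<in> bounded_ops V" "x \<in> vcar V" "y \<in> vcar V"
  shows "vinner V (op_adj V X x) y = vinner V x (X y)"
proof -
  have "vinner V (op_adj V X x) y = cnj (vinner V y (op_adj V X x))"
    using assms by (simp only: cnj_inner op_adj_mem)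
  also have "\<dots> = vinner V x (X y)"
    using assms by (simp add: inner_op_adj bounded_opsD)
  finally show ?thesis .
qed

lemma op_adj_bounded [simp, intro]:
  assumes X: "X \<in> bounded_ops V"
  shows "op_adj V X \<in> bounded_ops V"
proof (rule bounded_opsI)
  fix y assume y: "y \<in> vcar V"
  show "vnorm V (op_adj V X y) \<le> enn2real (opnorm V X) * vnorm V y"
    by (rule adjoint_norm_le[where y = "X (op_adj V X y)"])
      (use X y in \<open>auto simp: bounded_opsD inner_op_adj\<close>)
qed (use X in \<open>auto intro!: vec_eqI' simp: inner_op_adj bounded_opsD\<close>)

lemma op_adj_eqI:
  assumes "X \<in> bounded_ops V" "Y \<in> bounded_ops V"
    and "\<And>x y. x \<in> vcar V \<Longrightarrow> y \<in> vcar V \<Longrightarrow> vinner V (X x) y = vinner V x (Y y)"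
  shows "op_adj V X = Y"
  by (rule op_eqI) (use assms in \<open>auto simp: inner_op_adj_left intro!: op_adj_bounded\<close>, metis assms(1,2) bounded_ops_mem cnj_inner)

lemma op_adj_simps [simp]:
  assumes "X \<in> bounded_ops V"
  shows "op_adj V (op_adj V X) = X" "op_adj V (op_scale V c X) = op_scale V (cnj c) (op_adj V X)"
    "Y \<in> bounded_ops V \<Longrightarrow> op_adj V (op_add V X Y) = op_add V (op_adj V X) (op_adj V Y)"
    "Y \<in> bounded_ops V \<Longrightarrow> op_adj V (op_mult V X Y) = op_mult V (op_adj V Y) (op_adj V X)"
    "op_adj V (op_id V) = op_id V"
  using assms by (auto intro!: op_adj_eqI simp: inner_op_adj inner_op_adj_left bounded_opsD)


subsection \<open>The C*-algebra generated by a set of bounded operators\<close>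

text \<open>Encodes that the operator norm of X - Y is at most e while staying in the reals instead
  of \<open>ennreal\<close>.\<close>

definition op_close :: "real \<Rightarrow> ('a \<Rightarrow> 'a) \<Rightarrow> ('a \<Rightarrow> 'a) \<Rightarrow> bool" where
  "op_close e X Y \<longleftrightarrow> (\<forall>x\<in>vcar V. vnorm V (vdiff V (X x) (Y x)) \<le> e * vnorm V x)"

lemma op_converges_iff:
  assumes X: "\<And>k. X k \<in> bounded_ops V" and Y: "Y \<in> bounded_ops V"
  shows "op_converges V X Y \<longleftrightarrow> (\<forall>e>0. \<exists>N. \<forall>k\<ge>N. op_close e (X k) Y)"
proof
  assume lim: "op_converges V X Y"
  show "\<forall>e>0. \<exists>N. \<forall>k\<ge>N. op_close e (X k) Y"
  proof (intro allI impI)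
    fix e :: real assume e: "e > 0"
    have "\<forall>\<^sub>F k in sequentially. opnorm V (op_diff V (X k) Y) < ennreal e"
      using lim e unfolding op_converges_def by (intro order_tendstoD) auto
    then obtain N where N: "\<And>k. k \<ge> N \<Longrightarrow> opnorm V (op_diff V (X k) Y) < ennreal e"
      by (auto simp: eventually_sequentially)
    have "op_close e (X k) Y" if k: "k \<ge> N" for k
      unfolding op_close_def
    proof
      fix x assume x: "x \<in> vcar V"
      have "enn2real (opnorm V (op_diff V (X k) Y)) \<le> e"
        using N[OF k] e by (metis enn2real_leI less_imp_le)
      then have "enn2real (opnorm V (op_diff V (X k) Y)) * vnorm V x \<le> e * vnorm V x"
        using x by (intro mult_right_mono) auto
      moreover have "vnorm V (op_diff V (X k) Y x) \<le> enn2real (opnorm V (op_diff V (X k) Y)) * vnorm V x"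
        using X Y x by (intro bounded_ops_opnorm) auto
      ultimately show "vnorm V (vdiff V (X k x) (Y x)) \<le> e * vnorm V x"
        using x by simp
    qed
    then show "\<exists>N. \<forall>k\<ge>N. op_close e (X k) Y" by blast
  qed
next
  assume close: "\<forall>e>0. \<exists>N. \<forall>k\<ge>N. op_close e (X k) Y"
  show "op_converges V X Y"
    unfolding op_converges_def
  proof (rule order_tendstoI)
    fix a :: ennreal assume a: "0 < a"
    obtain e where e: "e > 0" "ennreal e < a"
    proof (cases a)
      case (real r)
      then have "r > 0" using a by simp
      then show ?thesis using that[of "r / 2"] real by (simp add: ennreal_lessI)
    next
      case top
      then show ?thesis using that[of 1] by simp
    qed
    then obtain N where N: "\<And>k. k \<ge> N \<Longrightarrow> op_close e (X k) Y" using close by blast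
    have "opnorm V (op_diff V (X k) Y) < a" if "k \<ge> N" for k
      using opnorm_le[of "op_diff V (X k) Y" e] N[OF that] e
      unfolding op_close_def by (simp add: le_less_trans)
    then show "\<forall>\<^sub>F k in sequentially. opnorm V (op_diff V (X k) Y) < a"
      by (auto simp: eventually_sequentially)
  qed simp
qed

lemma op_close_trans:
  assumes XY: "op_close d X Y" and YZ: "op_close e Y Z"
    and "X \<in> bounded_ops V" "Y \<in> bounded_ops V" "Z \<in> bounded_ops V"
  shows "op_close (d + e) X Z"
  unfolding op_close_def
proof
  fix x assume x: "x \<in> vcar V"
  have "vnorm V (vdiff V (X x) (Z x)) \<le> vnorm V (vdiff V (X x) (Y x)) + vnorm V (vdiff V (Y x) (Z x))"
    using assms x by (intro norm_diff_triangle) (auto simp: bounded_opsD)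
  also have "\<dots> \<le> (d + e) * vnorm V x"
    using XY YZ x unfolding op_close_def by (simp add: distrib_right add_mono)
  finally show "vnorm V (vdiff V (X x) (Z x)) \<le> (d + e) * vnorm V x" .
qed

lemma op_close_add:
  assumes "op_close d X Y" "op_close e X' Y'"
    and "X \<in> bounded_ops V" "Y \<in> bounded_ops V" "X' \<in> bounded_ops V" "Y' \<in> bounded_ops V"
  shows "op_close (d + e) (op_add V X X') (op_add V Y Y')"
  unfolding op_close_def
proof
  fix x assume x: "x \<in> vcar V"
  have "vnorm V (vdiff V (vadd V (X x) (X' x)) (vadd V (Y x) (Y' x)))
      \<le> vnorm V (vdiff V (X x) (Y x)) + vnorm V (vdiff V (X' x) (Y' x))"
    using assms x by (intro norm_diff_add_le) (auto simp: bounded_opsD)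
  also have "\<dots> \<le> (d + e) * vnorm V x"
    using assms(1,2) x unfolding op_close_def by (simp add: distrib_right add_mono)
  finally show "vnorm V (vdiff V (op_add V X X' x) (op_add V Y Y' x)) \<le> (d + e) * vnorm V x"
    using x by simp
qed

lemma op_close_scale:
  assumes "op_close d X Y" "X \<in> bounded_ops V" "Y \<in> bounded_ops V"
  shows "op_close (cmod c * d) (op_scale V c X) (op_scale V c Y)"
  using assms unfolding op_close_def
  by (auto simp: norm_diff_scale bounded_opsD mult.assoc intro!: mult_left_mono)

lemma op_close_adj:
  assumes c: "op_close d X Y" and X: "X \<in> bounded_ops V" and Y: "Y \<in> bounded_ops V" and "0 \<le> d"
  shows "op_close d (op_adj V X) (op_adj V Y)"
  unfolding op_close_def
proof
  fix z assume z: "z \<in> vcar V"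
  let ?w = "vdiff V (op_adj V X z) (op_adj V Y z)"
  have w: "?w \<in> vcar V" using X Y z by (intro diff_mem op_adj_mem)
  note w = w bounded_ops_mem[OF X w] bounded_ops_mem[OF Y w]
  have "vinner V ?w ?w = vinner V ?w (op_adj V X z) - vinner V ?w (op_adj V Y z)"
    using w X Y z by (intro inner_diff_right) auto
  also have "\<dots> = vinner V (X ?w) z - vinner V (Y ?w) z"
    using w(1) X Y z by (simp only: inner_op_adj)
  also have "\<dots> = vinner V (vdiff V (X ?w) (Y ?w)) z"
    using w z by (intro inner_diff_left[symmetric])
  finally have "vinner V ?w ?w = vinner V (vdiff V (X ?w) (Y ?w)) z" .
  then show "vnorm V ?w \<le> d * vnorm V z"
    by (rule adjoint_norm_le[OF w(1) diff_mem[OF w(2,3)] z])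
      (use w z c \<open>0 \<le> d\<close> in \<open>simp_all only: op_close_def\<close>)
qed

text \<open>From X X' - Y Y' = (X - Y) X' + Y (X' - Y'), where the norm of X' is at most that of Y'
  plus e.\<close>

lemma op_close_mult:
  assumes XY: "op_close d X Y" and XY': "op_close e X' Y'"
    and X: "X \<in> bounded_ops V" and Y: "Y \<in> bounded_ops V"
    and X': "X' \<in> bounded_ops V" and Y': "Y' \<in> bounded_ops V" and "0 \<le> d"
  shows "op_close (d * (enn2real (opnorm V Y') + e) + enn2real (opnorm V Y) * e)
    (op_mult V X X') (op_mult V Y Y')"
  unfolding op_close_def
proof
  fix x assume x: "x \<in> vcar V"
  have mem: "X' x \<in> vcar V" "Y' x \<in> vcar V" "X (X' x) \<in> vcar V" "Y (X' x) \<in> vcar V" "Y (Y' x) \<in> vcar V"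
    using X Y X' Y' x by (auto simp: bounded_opsD)
  have e: "vnorm V (vdiff V (X' x) (Y' x)) \<le> e * vnorm V x"
    using XY' x by (simp add: op_close_def)
  have "vnorm V (X' x) \<le> vnorm V (Y' x) + vnorm V (vdiff V (X' x) (Y' x))"
    using mem by (intro norm_le_add_diff)
  also have "\<dots> \<le> (enn2real (opnorm V Y') + e) * vnorm V x"
    using bounded_ops_opnorm[OF Y' x] e by (simp add: distrib_right)
  finally have X'x: "vnorm V (X' x) \<le> (enn2real (opnorm V Y') + e) * vnorm V x" .
  have "vnorm V (vdiff V (X (X' x)) (Y (X' x))) \<le> d * vnorm V (X' x)"
    using XY mem by (simp add: op_close_def)
  also have "\<dots> \<le> d * ((enn2real (opnorm V Y') + e) * vnorm V x)"
    using X'x \<open>0 \<le> d\<close> by (rule mult_left_mono)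
  finally have 1: "vnorm V (vdiff V (X (X' x)) (Y (X' x))) \<le> d * ((enn2real (opnorm V Y') + e) * vnorm V x)" .
  have "vdiff V (Y (X' x)) (Y (Y' x)) = Y (vdiff V (X' x) (Y' x))"
    using Y mem by (simp add: vdiff_def bounded_opsD)
  then have "vnorm V (vdiff V (Y (X' x)) (Y (Y' x))) \<le> enn2real (opnorm V Y) * vnorm V (vdiff V (X' x) (Y' x))"
    using bounded_ops_opnorm[OF Y] mem by simp
  also have "\<dots> \<le> enn2real (opnorm V Y) * (e * vnorm V x)"
    using e by (intro mult_left_mono) auto
  finally have 2: "vnorm V (vdiff V (Y (X' x)) (Y (Y' x))) \<le> enn2real (opnorm V Y) * (e * vnorm V x)" .
  show "vnorm V (vdiff V (op_mult V X X' x) (op_mult V Y Y' x))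
      \<le> (d * (enn2real (opnorm V Y') + e) + enn2real (opnorm V Y) * e) * vnorm V x"
    using norm_diff_triangle[OF mem(3,4,5)] 1 2 x by (simp add: distrib_right mult.assoc)
qed

lemma star_alg_gen_bounded:
  assumes "S \<subseteq> bounded_ops V" "X \<in> star_alg_gen V S"
  shows "X \<in> bounded_ops V"
  using assms(2) by induction (use assms(1) in auto)

text \<open>All closure arguments use this epsilon form of density. Conversely, a sequence is
  recovered by choosing the k-th approximant within \<open>inverse (Suc k)\<close>.\<close>

lemma cstar_gen_iff:
  assumes S: "S \<subseteq> bounded_ops V"
  shows "Y \<in> cstar_gen V S \<longleftrightarrow>
    Y \<in> bounded_ops V \<and> (\<forall>e>0. \<exists>X\<in>star_alg_gen V S. op_close e X Y)"
proof (cases "Y \<in> bounded_ops V")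
  case Y: True
  have "(\<exists>X. (\<forall>k. X k \<in> star_alg_gen V S) \<and> op_converges V X Y) \<longleftrightarrow>
      (\<forall>e>0. \<exists>X\<in>star_alg_gen V S. op_close e X Y)"
  proof
    assume "\<exists>X. (\<forall>k. X k \<in> star_alg_gen V S) \<and> op_converges V X Y"
    then obtain X where X: "\<And>k. X k \<in> star_alg_gen V S" "op_converges V X Y" by blast
    then have "\<forall>e>0. \<exists>N. \<forall>k\<ge>N. op_close e (X k) Y"
      using op_converges_iff[of X Y] Y star_alg_gen_bounded[OF S] by blast
    then show "\<forall>e>0. \<exists>X\<in>star_alg_gen V S. op_close e X Y"
      using X(1) by blast
  next
    assume "\<forall>e>0. \<exists>X\<in>star_alg_gen V S. op_close e X Y"
    then have "\<forall>k::nat. \<exists>X\<in>star_alg_gen V S. op_close (inverse (Suc k)) X Y" by simp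
    then obtain X where X: "\<And>k. X k \<in> star_alg_gen V S" "\<And>k::nat. op_close (inverse (Suc k)) (X k) Y"
      by metis
    have "\<exists>N. \<forall>k\<ge>N. op_close e (X k) Y" if e: "e > 0" for e
    proof -
      obtain N where N: "inverse (Suc N) < e" using reals_Archimedean[OF e] by auto
      have "op_close e (X k) Y" if k: "k \<ge> N" for k
        unfolding op_close_def
      proof
        fix x assume x: "x \<in> vcar V"
        have "inverse (real (Suc k)) \<le> inverse (real (Suc N))"
          using k by (auto intro!: le_imp_inverse_le)
        then have "inverse (real (Suc k)) \<le> e" using N by linarith
        then have "inverse (real (Suc k)) * vnorm V x \<le> e * vnorm V x"
          using x by (intro mult_right_mono) auto
        then show "vnorm V (vdiff V (X k x) (Y x)) \<le> e * vnorm V x"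
          using X(2)[of k] x unfolding op_close_def by fastforce
      qed
      then show ?thesis by blast
    qed
    then have "op_converges V X Y"
      using op_converges_iff[of X Y] X(1) Y star_alg_gen_bounded[OF S] by blast
    then show "\<exists>X. (\<forall>k. X k \<in> star_alg_gen V S) \<and> op_converges V X Y" using X(1) by blast
  qed
  then show ?thesis using Y by (simp add: cstar_gen_def)
qed (simp add: cstar_gen_def)

lemma cstar_gen_close:
  assumes S: "S \<subseteq> bounded_ops V" and Y: "Y \<in> bounded_ops V"
    and close: "\<And>e. e > 0 \<Longrightarrow> \<exists>X\<in>cstar_gen V S. op_close e X Y"
  shows "Y \<in> cstar_gen V S"
  unfolding cstar_gen_iff[OF S]
proof (intro conjI allI impI Y)
  fix e :: real assume e: "e > 0"
  then obtain X where X: "X \<in> cstar_gen V S" "op_close (e/2) X Y"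
    using close[of "e/2"] by auto
  then obtain Z where Z: "Z \<in> star_alg_gen V S" "op_close (e/2) Z X"
    using e unfolding cstar_gen_iff[OF S] by (metis half_gt_zero)
  have "op_close (e/2 + e/2) Z Y"
    using X Z Y star_alg_gen_bounded[OF S] by (intro op_close_trans[of _ Z X]) (auto simp: cstar_gen_iff[OF S])
  then show "\<exists>X\<in>star_alg_gen V S. op_close e X Y" using Z by auto
qed

lemma star_alg_gen_subset_cstar_gen:
  assumes S: "S \<subseteq> bounded_ops V" and X: "X \<in> star_alg_gen V S"
  shows "X \<in> cstar_gen V S"
proof -
  have "X \<in> bounded_ops V" by (rule star_alg_gen_bounded[OF S X])
  moreover from this have "op_close e X X" if "e > 0" for e
    using that by (auto simp: op_close_def bounded_opsD)
  ultimately show ?thesis using X by (auto simp: cstar_gen_iff[OF S])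
qed

lemma unital_cstar_subalgebra_cstar_gen:
  assumes S: "S \<subseteq> bounded_ops V"
  shows "unital_cstar_subalgebra V (cstar_gen V S)"
proof -
  note iff = cstar_gen_iff[OF S]
  note bdd = star_alg_gen_bounded[OF S]
  show ?thesis
    unfolding unital_cstar_subalgebra_def
  proof (intro conjI ballI allI impI)
    show "cstar_gen V S \<subseteq> bounded_ops V" by (auto simp: iff)
    show "op_id V \<in> cstar_gen V S"
      by (intro star_alg_gen_subset_cstar_gen S star_alg_gen.one)
  next
    fix X Y assume X: "X \<in> cstar_gen V S" and Y: "Y \<in> cstar_gen V S"
    then have B: "X \<in> bounded_ops V" "Y \<in> bounded_ops V" by (auto simp: iff)
    show "op_add V X Y \<in> cstar_gen V S"
      unfolding iff
    proof (intro conjI allI impI)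
      fix e :: real assume "e > 0"
      then obtain X' Y' where *: "X' \<in> star_alg_gen V S" "op_close (e/2) X' X"
        "Y' \<in> star_alg_gen V S" "op_close (e/2) Y' Y"
        using X Y unfolding iff by (metis half_gt_zero)
      then have "op_close (e/2 + e/2) (op_add V X' Y') (op_add V X Y)"
        by (intro op_close_add B bdd)
      then show "\<exists>Z\<in>star_alg_gen V S. op_close e Z (op_add V X Y)"
        using * by (auto intro: star_alg_gen.add)
    qed (use B in auto)
    show "op_mult V X Y \<in> cstar_gen V S"
      unfolding iff
    proof (intro conjI allI impI)
      fix e :: real assume e: "e > 0"
      define C where "C = enn2real (opnorm V X) + enn2real (opnorm V Y) + 1"
      \<comment> \<open>Because d \<le> 1, the quadratic error d * d is at most d, so the total
        error in \<open>op_close_mult\<close> is at most d * C \<le> e.\<close>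
      define d where "d = min 1 (e / C)"
      have C: "C \<ge> 1" by (simp add: C_def)
      have d: "0 < d" "d \<le> 1" "d * C \<le> e"
        using e C by (auto simp: d_def min_def field_simps)
      obtain X' Y' where *: "X' \<in> star_alg_gen V S" "op_close d X' X"
        "Y' \<in> star_alg_gen V S" "op_close d Y' Y"
        using X Y d unfolding iff by metis
      then have close: "op_close (d * (enn2real (opnorm V Y) + d) + enn2real (opnorm V X) * d)
          (op_mult V X' Y') (op_mult V X Y)"
        using d by (intro op_close_mult B bdd) auto
      have "d * d \<le> d" using d by (simp add: mult_left_le)
      then have le: "d * (enn2real (opnorm V Y) + d) + enn2real (opnorm V X) * d \<le> e"
        using d(3) by (simp add: C_def algebra_simps)
      have "op_close e (op_mult V X' Y') (op_mult V X Y)"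
        using close mult_right_mono[OF le] unfolding op_close_def by (meson norm_nonneg order_trans)
      then show "\<exists>Z\<in>star_alg_gen V S. op_close e Z (op_mult V X Y)"
        using * by (auto intro: star_alg_gen.mult)
    qed (use B in auto)
  next
    fix c X assume X: "X \<in> cstar_gen V S"
    then have B: "X \<in> bounded_ops V" by (auto simp: iff)
    show "op_scale V c X \<in> cstar_gen V S"
      unfolding iff
    proof (intro conjI allI impI)
      fix e :: real assume e: "e > 0"
      define d where "d = e / (cmod c + 1)"
      have pos: "cmod c + 1 > 0" using norm_ge_zero[of c] by linarith
      then have d: "d > 0" "cmod c * d \<le> e" using e by (auto simp: d_def field_simps)
      then obtain X' where *: "X' \<in> star_alg_gen V S" "op_close d X' X"
        using X unfolding iff by metis
      then have "op_close (cmod c * d) (op_scale V c X') (op_scale V c X)"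
        by (intro op_close_scale B bdd)
      then have "op_close e (op_scale V c X') (op_scale V c X)"
        using mult_right_mono[OF d(2)] unfolding op_close_def by (meson norm_nonneg order_trans)
      then show "\<exists>Z\<in>star_alg_gen V S. op_close e Z (op_scale V c X)"
        using * by (auto intro: star_alg_gen.scale)
    qed (use B in auto)
  next
    fix X assume X: "X \<in> cstar_gen V S"
    then show "op_adj V X \<in> cstar_gen V S"
      unfolding iff using op_close_adj bdd star_alg_gen.adj by (meson less_imp_le op_adj_bounded)
  next
    fix X Y assume Y: "Y \<in> bounded_ops V" and X: "(\<forall>k. X k \<in> cstar_gen V S) \<and> op_converges V X Y"
    show "Y \<in> cstar_gen V S"
    proof (rule cstar_gen_close[OF S Y])
      fix e :: real assume "e > 0"
      then show "\<exists>X\<in>cstar_gen V S. op_close e X Y"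
        using op_converges_iff[of X Y] X Y by (metis iff order_refl)
    qed
  qed
qed

end

section \<open>Completion\<close>

context cip
begin

abbreviation cls :: "(nat \<Rightarrow> 'v) \<Rightarrow> (nat \<Rightarrow> 'v) set" where
  "cls s \<equiv> cauchy_rel V `` {s}"

lemma cauchy_seqs_mem: "s \<in> cauchy_seqs V \<Longrightarrow> s k \<in> vcar V"
  by (simp add: cauchy_seqs_def)

lemma cauchy_seqsD:
  "s \<in> cauchy_seqs V \<Longrightarrow> e > 0 \<Longrightarrow> \<exists>N. \<forall>m\<ge>N. \<forall>k\<ge>N. vnorm V (vdiff V (s m) (s k)) < e"
  by (simp add: cauchy_seqs_def)

lemma const_cauchy [simp, intro]: "x \<in> vcar V \<Longrightarrow> (\<lambda>_. x) \<in> cauchy_seqs V"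
  by (simp add: cauchy_seqs_def)

lemma cauchy_rel_iff: "(s, t) \<in> cauchy_rel V \<longleftrightarrow> s \<in> cauchy_seqs V \<and> t \<in> cauchy_seqs V \<and>
    (\<lambda>k. vnorm V (vdiff V (s k) (t k))) \<longlonglongrightarrow> 0"
  by (simp add: cauchy_rel_def)

lemma equiv_cauchy_rel: "equiv (cauchy_seqs V) (cauchy_rel V)"
proof (rule equivI)
  show "cauchy_rel V \<subseteq> cauchy_seqs V \<times> cauchy_seqs V"
    by (auto simp: cauchy_rel_def)
  show "refl_on (cauchy_seqs V) (cauchy_rel V)"
    by (auto simp: refl_on_def cauchy_rel_iff norm_diff_self[OF cauchy_seqs_mem])
  show "sym (cauchy_rel V)"
    by (auto simp: sym_def cauchy_rel_iff norm_diff_commute[OF cauchy_seqs_mem cauchy_seqs_mem])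
  show "trans (cauchy_rel V)"
  proof (rule transI)
    fix s t u assume st: "(s, t) \<in> cauchy_rel V" and tu: "(t, u) \<in> cauchy_rel V"
    have mem: "s k \<in> vcar V" "t k \<in> vcar V" "u k \<in> vcar V" for k
      using st tu by (auto simp: cauchy_rel_iff intro: cauchy_seqs_mem)
    have lim: "(\<lambda>k. vnorm V (vdiff V (s k) (t k)) + vnorm V (vdiff V (t k) (u k))) \<longlonglongrightarrow> 0"
      using st tu tendsto_add_zero unfolding cauchy_rel_iff by blast
    have "(\<lambda>k. vnorm V (vdiff V (s k) (u k))) \<longlonglongrightarrow> 0"
      by (rule Lim_null_comparison[OF always_eventually lim])
        (use mem norm_diff_triangle in auto)
    then show "(s, u) \<in> cauchy_rel V" using st tu by (simp add: cauchy_rel_iff)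
  qed
qed

lemma cauchy_rel_refl [simp]: "s \<in> cauchy_seqs V \<Longrightarrow> (s, s) \<in> cauchy_rel V"
  by (simp add: cauchy_rel_iff norm_diff_self[OF cauchy_seqs_mem])

text \<open>Operations on the completion are defined as the image of all combinations of
  representatives. This collapses such an image to a single class once the combinations are known to
  be equivalent.\<close>

lemma cauchy_rel_Image_eq:
  assumes "x \<in> G" "\<And>y. y \<in> G \<Longrightarrow> (x, y) \<in> cauchy_rel V"
  shows "cauchy_rel V `` G = cls x"
proof -
  have "cls y = cls x" if "y \<in> G" for y
    using equiv_class_eq[OF equiv_cauchy_rel assms(2)[OF that]] by simp
  then show ?thesis using assms(1) by blast
qed

lemma cls_eqI: "(s, t) \<in> cauchy_rel V \<Longrightarrow> cls s = cls t"
  by (rule equiv_class_eq[OF equiv_cauchy_rel])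

lemma cauchy_bounded:
  assumes s: "s \<in> cauchy_seqs V"
  shows "\<exists>B>0. \<forall>k. vnorm V (s k) \<le> B"
proof -
  note [simp] = cauchy_seqs_mem[OF s]
  obtain N where N: "\<forall>m\<ge>N. \<forall>k\<ge>N. vnorm V (vdiff V (s m) (s k)) < 1"
    using cauchy_seqsD[OF s, of 1] by auto
  define B where "B = 1 + (\<Sum>k\<le>N. vnorm V (s k))"
  have "vnorm V (s k) \<le> B" for k
  proof (cases "k \<le> N")
    case True
    then have "vnorm V (s k) \<le> (\<Sum>k\<le>N. vnorm V (s k))"
      using s by (intro member_le_sum) auto
    then show ?thesis by (simp add: B_def)
  next
    case False
    then have "vnorm V (vdiff V (s k) (s N)) < 1" using N by simp
    then have "vnorm V (s k) \<le> vnorm V (s N) + 1"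
      using norm_le_add_diff[of "s k" "s N"] s by simp
    moreover have "vnorm V (s N) \<le> (\<Sum>k\<le>N. vnorm V (s k))"
      using s by (intro member_le_sum) auto
    ultimately show ?thesis by (simp add: B_def)
  qed
  moreover have "B > 0"
    using s by (simp add: B_def add_pos_nonneg sum_nonneg)
  ultimately show ?thesis by blast
qed

lemma inner_convergent:
  assumes s: "s \<in> cauchy_seqs V" and t: "t \<in> cauchy_seqs V"
  shows "convergent (\<lambda>k. vinner V (s k) (t k))"
proof -
  note [simp] = cauchy_seqs_mem[OF s] cauchy_seqs_mem[OF t]
  obtain B where B: "B > 0" "\<And>k. vnorm V (s k) \<le> B"
    using cauchy_bounded[OF s] by blast
  obtain D where D: "D > 0" "\<And>k. vnorm V (t k) \<le> D"
    using cauchy_bounded[OF t] by blast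
  have "Cauchy (\<lambda>k. vinner V (s k) (t k))"
  proof (rule CauchyI)
    fix e :: real assume e: "e > 0"
    obtain M where M: "\<forall>m\<ge>M. \<forall>k\<ge>M. vnorm V (vdiff V (s m) (s k)) < e / (2 * D)"
      using cauchy_seqsD[OF s, of "e / (2 * D)"] e D by auto
    obtain N where N: "\<forall>m\<ge>N. \<forall>k\<ge>N. vnorm V (vdiff V (t m) (t k)) < e / (2 * B)"
      using cauchy_seqsD[OF t, of "e / (2 * B)"] e B by auto
    have "cmod (vinner V (s m) (t m) - vinner V (s k) (t k)) < e"
      if "max M N \<le> m" "max M N \<le> k" for m k
    proof -
      have 1: "vnorm V (vdiff V (s m) (s k)) < e / (2 * D)" "vnorm V (vdiff V (t m) (t k)) < e / (2 * B)"
        using M N that by auto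
      have "vnorm V (vdiff V (s m) (s k)) * vnorm V (t m) \<le> vnorm V (vdiff V (s m) (s k)) * D"
        using D s by (intro mult_left_mono) auto
      also have "\<dots> < e / 2" using 1 D by (simp add: field_simps)
      finally have a: "vnorm V (vdiff V (s m) (s k)) * vnorm V (t m) < e / 2" .
      have "vnorm V (s k) * vnorm V (vdiff V (t m) (t k)) \<le> B * vnorm V (vdiff V (t m) (t k))"
        using B t by (intro mult_right_mono) auto
      also have "\<dots> < e / 2" using 1 B by (simp add: field_simps)
      finally have b: "vnorm V (s k) * vnorm V (vdiff V (t m) (t k)) < e / 2" .
      show ?thesis
        using inner_diff_le[of "s m" "t m" "s k" "t k"] a b s t by simp
    qed
    then show "\<exists>M. \<forall>m\<ge>M. \<forall>k\<ge>M. cmod (vinner V (s m) (t m) - vinner V (s k) (t k)) < e"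
      by blast
  qed
  then show ?thesis by (simp add: Cauchy_convergent_iff)
qed

text \<open>Independence of representatives; with \<open>inner_convergent\<close> it shows that the
  limit in the definition of the completed inner product exists and is unique.\<close>

lemma inner_cong_lim:
  assumes s: "(s, s') \<in> cauchy_rel V" and t: "(t, t') \<in> cauchy_rel V"
    and z: "(\<lambda>k. vinner V (s k) (t k)) \<longlonglongrightarrow> z"
  shows "(\<lambda>k. vinner V (s' k) (t' k)) \<longlonglongrightarrow> z"
proof -
  have mem: "s \<in> cauchy_seqs V" "s' \<in> cauchy_seqs V" "t \<in> cauchy_seqs V" "t' \<in> cauchy_seqs V"
    using s t by (auto simp: cauchy_rel_iff)
  note [simp] = mem[THEN cauchy_seqs_mem]
  obtain B where B: "B > 0" "\<And>k. vnorm V (s' k) \<le> B"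
    using cauchy_bounded[OF mem(2)] by blast
  obtain D where D: "D > 0" "\<And>k. vnorm V (t k) \<le> D"
    using cauchy_bounded[OF mem(3)] by blast
  have "(\<lambda>k. vnorm V (vdiff V (s k) (s' k)) * D + B * vnorm V (vdiff V (t k) (t' k))) \<longlonglongrightarrow> 0 * D + B * 0"
    using s t unfolding cauchy_rel_iff by (intro tendsto_intros) auto
  then have lim: "(\<lambda>k. vnorm V (vdiff V (s k) (s' k)) * D + B * vnorm V (vdiff V (t k) (t' k))) \<longlonglongrightarrow> 0"
    by simp
  have "(\<lambda>k. vinner V (s k) (t k) - vinner V (s' k) (t' k)) \<longlonglongrightarrow> 0"
  proof (rule Lim_null_comparison[OF always_eventually lim], rule allI)
    fix k
    have "cmod (vinner V (s k) (t k) - vinner V (s' k) (t' k))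
        \<le> vnorm V (vdiff V (s k) (s' k)) * vnorm V (t k) + vnorm V (s' k) * vnorm V (vdiff V (t k) (t' k))"
      using mem by (intro inner_diff_le) auto
    also have "\<dots> \<le> vnorm V (vdiff V (s k) (s' k)) * D + B * vnorm V (vdiff V (t k) (t' k))"
      using mem B D by (intro add_mono mult_left_mono mult_right_mono) auto
    finally show "cmod (vinner V (s k) (t k) - vinner V (s' k) (t' k))
      \<le> vnorm V (vdiff V (s k) (s' k)) * D + B * vnorm V (vdiff V (t k) (t' k))" .
  qed
  from tendsto_diff[OF z this] show ?thesis by simp
qed

lemma inner_completion:
  assumes s: "s \<in> cauchy_seqs V" and t: "t \<in> cauchy_seqs V"
  shows "(\<lambda>k. vinner V (s k) (t k)) \<longlonglongrightarrow> vinner (completion V) (cls s) (cls t)"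
proof -
  obtain z where z: "(\<lambda>k. vinner V (s k) (t k)) \<longlonglongrightarrow> z"
    using inner_convergent[OF s t] by (auto simp: convergent_def)
  have "vinner (completion V) (cls s) (cls t) = z"
    unfolding completion_def cip_space.simps
  proof (rule the_equality)
    show "\<forall>u\<in>cls s. \<forall>v\<in>cls t. (\<lambda>k. vinner V (u k) (v k)) \<longlonglongrightarrow> z"
      using inner_cong_lim[OF _ _ z] by blast
    fix w assume "\<forall>u\<in>cls s. \<forall>v\<in>cls t. (\<lambda>k. vinner V (u k) (v k)) \<longlonglongrightarrow> w"
    then have "(\<lambda>k. vinner V (s k) (t k)) \<longlonglongrightarrow> w" using s t by auto
    then show "w = z" by (rule LIMSEQ_unique[OF _ z])
  qed
  then show ?thesis using z by simp
qed

lemma cls_mem [simp, intro]: "s \<in> cauchy_seqs V \<Longrightarrow> cls s \<in> vcar (completion V)"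
  by (simp add: completion_def quotientI)

lemma completion_cases:
  assumes "A \<in> vcar (completion V)"
  obtains s where "s \<in> cauchy_seqs V" "A = cls s"
  using assms by (auto simp: completion_def elim: quotientE)

lemma add_cauchy:
  assumes s: "s \<in> cauchy_seqs V" and t: "t \<in> cauchy_seqs V"
  shows "(\<lambda>k. vadd V (s k) (t k)) \<in> cauchy_seqs V"
  unfolding cauchy_seqs_def
proof (intro CollectI conjI allI impI)
  note [simp] = cauchy_seqs_mem[OF s] cauchy_seqs_mem[OF t]
  fix e :: real assume e: "e > 0"
  obtain M where M: "\<forall>m\<ge>M. \<forall>k\<ge>M. vnorm V (vdiff V (s m) (s k)) < e / 2"
    using cauchy_seqsD[OF s, of "e/2"] e by auto
  obtain N where N: "\<forall>m\<ge>N. \<forall>k\<ge>N. vnorm V (vdiff V (t m) (t k)) < e / 2"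
    using cauchy_seqsD[OF t, of "e/2"] e by auto
  have "vnorm V (vdiff V (vadd V (s m) (t m)) (vadd V (s k) (t k))) < e"
    if "max M N \<le> m" "max M N \<le> k" for m k
  proof -
    have "vnorm V (vdiff V (s m) (s k)) < e / 2" "vnorm V (vdiff V (t m) (t k)) < e / 2"
      using M N that by auto
    then show ?thesis
      using norm_diff_add_le[of "s m" "t m" "s k" "t k"] s t by simp
  qed
  then show "\<exists>N. \<forall>m\<ge>N. \<forall>k\<ge>N. vnorm V (vdiff V (vadd V (s m) (t m)) (vadd V (s k) (t k))) < e"
    by blast
qed (use s t cauchy_seqs_mem in auto)

lemma add_cls:
  assumes s: "s \<in> cauchy_seqs V" and t: "t \<in> cauchy_seqs V"
  shows "vadd (completion V) (cls s) (cls t) = cls (\<lambda>k. vadd V (s k) (t k))"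
  unfolding completion_def cip_space.simps
proof (rule cauchy_rel_Image_eq)
  show "(\<lambda>k. vadd V (s k) (t k)) \<in> {\<lambda>k. vadd V (u k) (v k) |u v. u \<in> cls s \<and> v \<in> cls t}"
    using s t by force
  fix y assume "y \<in> {\<lambda>k. vadd V (u k) (v k) |u v. u \<in> cls s \<and> v \<in> cls t}"
  then obtain u v where y: "y = (\<lambda>k. vadd V (u k) (v k))"
    and u: "(s, u) \<in> cauchy_rel V" and v: "(t, v) \<in> cauchy_rel V" by auto
  have mem: "s k \<in> vcar V" "u k \<in> vcar V" "t k \<in> vcar V" "v k \<in> vcar V" for k
    using u v by (auto simp: cauchy_rel_iff intro: cauchy_seqs_mem)
  have lim: "(\<lambda>k. vnorm V (vdiff V (s k) (u k)) + vnorm V (vdiff V (t k) (v k))) \<longlonglongrightarrow> 0"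
    using u v tendsto_add_zero unfolding cauchy_rel_iff by blast
  have "(\<lambda>k. vnorm V (vdiff V (vadd V (s k) (t k)) (y k))) \<longlonglongrightarrow> 0"
    by (rule Lim_null_comparison[OF always_eventually lim])
      (use mem norm_diff_add_le in \<open>auto simp: y\<close>)
  then show "(\<lambda>k. vadd V (s k) (t k), y) \<in> cauchy_rel V"
    using u v by (simp add: cauchy_rel_iff add_cauchy y)
qed

end

text \<open>A Lipschitz bound on differences is what makes \<open>extend\<close> well defined on
  classes; additivity and homogeneity are supplied separately where they are used. The instances are
  scalar multiplication, tensoring with a basis vector, and translation.\<close>

locale cip_lipschitz = V: cip V + W: cip W
  for V :: "'v cip_space" and W :: "'w cip_space" +
  fixes \<phi> :: "'v \<Rightarrow> 'w" and C :: real
  assumes map_mem: "x \<in> vcar V \<Longrightarrow> \<phi> x \<in> vcar W"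
    and lipschitz: "\<lbrakk>x \<in> vcar V; y \<in> vcar V\<rbrakk> \<Longrightarrow>
      vnorm W (vdiff W (\<phi> x) (\<phi> y)) \<le> C * vnorm V (vdiff V x y)"
begin

lemma map_cauchy:
  assumes s: "s \<in> cauchy_seqs V"
  shows "\<phi> \<circ> s \<in> cauchy_seqs W"
  unfolding cauchy_seqs_def
proof (intro CollectI conjI allI impI)
  note [simp] = V.cauchy_seqs_mem[OF s]
  fix e :: real assume e: "e > 0"
  define D where "D = \<bar>C\<bar> + 1"
  have D: "D > 0" "C \<le> D" by (auto simp: D_def)
  obtain N where N: "\<forall>m\<ge>N. \<forall>k\<ge>N. vnorm V (vdiff V (s m) (s k)) < e / D"
    using V.cauchy_seqsD[OF s, of "e / D"] e D by auto
  have "vnorm W (vdiff W ((\<phi> \<circ> s) m) ((\<phi> \<circ> s) k)) < e" if "N \<le> m" "N \<le> k" for m k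
  proof -
    have "vnorm W (vdiff W (\<phi> (s m)) (\<phi> (s k))) \<le> C * vnorm V (vdiff V (s m) (s k))"
      using s by (intro lipschitz) auto
    also have "\<dots> \<le> D * vnorm V (vdiff V (s m) (s k))"
      using s D by (intro mult_right_mono) auto
    also have "\<dots> < e" using N that D by (simp add: field_simps)
    finally show ?thesis by simp
  qed
  then show "\<exists>N. \<forall>m\<ge>N. \<forall>k\<ge>N. vnorm W (vdiff W ((\<phi> \<circ> s) m) ((\<phi> \<circ> s) k)) < e"
    by blast
qed (use s map_mem V.cauchy_seqs_mem in auto)

lemma extend_cls:
  assumes s: "s \<in> cauchy_seqs V"
  shows "extend W \<phi> (V.cls s) = W.cls (\<phi> \<circ> s)"
  unfolding extend_def
proof (rule W.cauchy_rel_Image_eq)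
  show "\<phi> \<circ> s \<in> {\<phi> \<circ> u |u. u \<in> V.cls s}" using s by auto
  fix y assume "y \<in> {\<phi> \<circ> u |u. u \<in> V.cls s}"
  then obtain u where y: "y = \<phi> \<circ> u" and u: "(s, u) \<in> cauchy_rel V" by auto
  have mem: "s k \<in> vcar V" "u k \<in> vcar V" for k
    using u by (auto simp: V.cauchy_rel_iff intro: V.cauchy_seqs_mem)
  have lim: "(\<lambda>k. C * vnorm V (vdiff V (s k) (u k))) \<longlonglongrightarrow> 0"
    using u tendsto_mult_right_zero unfolding V.cauchy_rel_iff by blast
  have "(\<lambda>k. vnorm W (vdiff W ((\<phi> \<circ> s) k) (y k))) \<longlonglongrightarrow> 0"
    by (rule Lim_null_comparison[OF always_eventually lim])
      (use mem lipschitz map_mem in \<open>auto simp: y\<close>)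
  then show "(\<phi> \<circ> s, y) \<in> cauchy_rel W"
    using u s by (simp add: V.cauchy_rel_iff W.cauchy_rel_iff map_cauchy y)
qed

lemma extend_mem: "A \<in> vcar (completion V) \<Longrightarrow> extend W \<phi> A \<in> vcar (completion W)"
  by (erule V.completion_cases) (simp add: extend_cls map_cauchy W.cls_mem)

lemma extend_embed: "x \<in> vcar V \<Longrightarrow> extend W \<phi> (embed V x) = embed W (\<phi> x)"
  by (simp add: embed_def extend_cls o_def)

lemma extend_add:
  assumes hom: "\<And>x y. x \<in> vcar V \<Longrightarrow> y \<in> vcar V \<Longrightarrow> \<phi> (vadd V x y) = vadd W (\<phi> x) (\<phi> y)"
    and A: "A \<in> vcar (completion V)" and B: "B \<in> vcar (completion V)"
  shows "extend W \<phi> (vadd (completion V) A B) = vadd (completion W) (extend W \<phi> A) (extend W \<phi> B)"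
proof -
  obtain s t where s: "s \<in> cauchy_seqs V" "A = V.cls s" and t: "t \<in> cauchy_seqs V" "B = V.cls t"
    using A B by (metis V.completion_cases)
  then show ?thesis
    using W.add_cls[OF map_cauchy[OF s(1)] map_cauchy[OF t(1)]]
    by (simp add: V.add_cls V.add_cauchy extend_cls o_def hom V.cauchy_seqs_mem[OF s(1)] V.cauchy_seqs_mem[OF t(1)])
qed

end

context cip
begin

lemma scale_lipschitz: "cip_lipschitz V V (vscale V c) (cmod c)"
  by unfold_locales (auto simp: norm_diff_scale)

lemmas scale_cls = cip_lipschitz.extend_cls[OF scale_lipschitz]
  and scale_cauchy = cip_lipschitz.map_cauchy[OF scale_lipschitz, unfolded o_def]

lemma scale_completion: "vscale (completion V) c A = extend V (vscale V c) A"
  by (simp add: completion_def)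

lemma diff_cauchy:
  "\<lbrakk>s \<in> cauchy_seqs V; t \<in> cauchy_seqs V\<rbrakk> \<Longrightarrow> (\<lambda>k. vdiff V (s k) (t k)) \<in> cauchy_seqs V"
  using add_cauchy[OF _ scale_cauchy] by (simp add: vdiff_def)

lemma diff_cls:
  "\<lbrakk>s \<in> cauchy_seqs V; t \<in> cauchy_seqs V\<rbrakk> \<Longrightarrow>
    vdiff (completion V) (cls s) (cls t) = cls (\<lambda>k. vdiff V (s k) (t k))"
  by (simp add: vdiff_def scale_completion scale_cls o_def add_cls scale_cauchy)

lemma cip_completion: "cip (completion V)"
proof
  show "vzero (completion V) \<in> vcar (completion V)"
    by (auto simp: completion_def embed_def intro!: quotientI)
next
  fix A assume "A \<in> vcar (completion V)"
  then obtain s where s: "s \<in> cauchy_seqs V" "A = cls s" by (elim completion_cases)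
  note [simp] = cauchy_seqs_mem[OF s(1)]
  show "vscale (completion V) c A \<in> vcar (completion V)" for c
    using s by (simp add: scale_completion scale_cls scale_cauchy o_def cls_mem)
  have "vinner (completion V) (embed V (vzero V)) (cls s) = 0"
    unfolding embed_def by (rule LIMSEQ_unique[OF inner_completion]) (use s in auto)
  then show "vinner (completion V) (vzero (completion V)) A = 0"
    using s by (simp add: completion_def)
  have "(\<lambda>k. Re (vinner V (s k) (s k))) \<longlonglongrightarrow> Re (vinner (completion V) A A)"
    using tendsto_Re[OF inner_completion[OF s(1) s(1)]] s by simp
  then show "0 \<le> Re (vinner (completion V) A A)"
    by (rule LIMSEQ_le_const) (use s in auto)
next
  fix A B assume "A \<in> vcar (completion V)" "B \<in> vcar (completion V)"
  then obtain s t where s: "s \<in> cauchy_seqs V" "A = cls s" and t: "t \<in> cauchy_seqs V" "B = cls t"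
    by (metis completion_cases)
  note [simp] = cauchy_seqs_mem[OF s(1)] cauchy_seqs_mem[OF t(1)]
  show "vadd (completion V) A B \<in> vcar (completion V)"
    using s t by (simp add: add_cls add_cauchy cls_mem)
  show "vinner (completion V) (vscale (completion V) c A) B = c * vinner (completion V) A B" for c
  proof (rule LIMSEQ_unique)
    show "(\<lambda>k. vinner V (vscale V c (s k)) (t k)) \<longlonglongrightarrow> vinner (completion V) (vscale (completion V) c A) B"
      using inner_completion[OF scale_cauchy[OF s(1)] t(1)] s t
      by (simp add: scale_completion scale_cls o_def)
    show "(\<lambda>k. vinner V (vscale V c (s k)) (t k)) \<longlonglongrightarrow> c * vinner (completion V) A B"
      using tendsto_mult_left[OF inner_completion[OF s(1) t(1)]] s t by simp
  qed
  show "cnj (vinner (completion V) A B) = vinner (completion V) B A"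
  proof (rule LIMSEQ_unique)
    show "(\<lambda>k. vinner V (t k) (s k)) \<longlonglongrightarrow> vinner (completion V) B A"
      using inner_completion[OF t(1) s(1)] s t by simp
    show "(\<lambda>k. vinner V (t k) (s k)) \<longlonglongrightarrow> cnj (vinner (completion V) A B)"
      using tendsto_cnj[OF inner_completion[OF s(1) t(1)]] s t by simp
  qed
  fix D assume "D \<in> vcar (completion V)"
  then obtain u where u: "u \<in> cauchy_seqs V" "D = cls u" by (elim completion_cases)
  note [simp] = cauchy_seqs_mem[OF u(1)]
  show "vinner (completion V) (vadd (completion V) A B) D
      = vinner (completion V) A D + vinner (completion V) B D"
  proof (rule LIMSEQ_unique)
    show "(\<lambda>k. vinner V (vadd V (s k) (t k)) (u k)) \<longlonglongrightarrow> vinner (completion V) (vadd (completion V) A B) D"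
      using inner_completion[OF add_cauchy[OF s(1) t(1)] u(1)] s t u by (simp add: add_cls)
    show "(\<lambda>k. vinner V (vadd V (s k) (t k)) (u k))
        \<longlonglongrightarrow> vinner (completion V) A D + vinner (completion V) B D"
      using tendsto_add[OF inner_completion[OF s(1) u(1)] inner_completion[OF t(1) u(1)]] s t u by simp
  qed
qed

lemma norm_completion:
  assumes "s \<in> cauchy_seqs V"
  shows "(\<lambda>k. vnorm V (s k)) \<longlonglongrightarrow> vnorm (completion V) (cls s)"
  unfolding vnorm_def by (intro tendsto_intros inner_completion assms)

lemma embed_mem [simp, intro]: "x \<in> vcar V \<Longrightarrow> embed V x \<in> vcar (completion V)"
  by (simp add: embed_def cls_mem)

lemma inner_embed [simp]:
  "\<lbrakk>x \<in> vcar V; y \<in> vcar V\<rbrakk> \<Longrightarrow> vinner (completion V) (embed V x) (embed V y) = vinner V x y"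
  using LIMSEQ_unique[OF inner_completion[of "\<lambda>_. x" "\<lambda>_. y"] tendsto_const] by (simp add: embed_def)

text \<open>This is the density of V in its completion, on which completeness and the test for
  equality of vectors below both rest.\<close>

lemma embed_tendsto:
  assumes s: "s \<in> cauchy_seqs V"
  shows "(\<lambda>m. vnorm (completion V) (vdiff (completion V) (embed V (s m)) (cls s))) \<longlonglongrightarrow> 0"
proof (rule LIMSEQ_I)
  note [simp] = cauchy_seqs_mem[OF s]
  fix e :: real assume e: "e > 0"
  obtain N where N: "\<forall>m\<ge>N. \<forall>k\<ge>N. vnorm V (vdiff V (s m) (s k)) < e / 2"
    using cauchy_seqsD[OF s, of "e / 2"] e by auto
  have "vnorm (completion V) (vdiff (completion V) (embed V (s m)) (cls s)) \<le> e / 2" if m: "m \<ge> N" for m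
  proof (rule LIMSEQ_le_const2)
    show "(\<lambda>k. vnorm V (vdiff V (s m) (s k)))
        \<longlonglongrightarrow> vnorm (completion V) (vdiff (completion V) (embed V (s m)) (cls s))"
      using norm_completion[OF diff_cauchy[OF const_cauchy s]] s
      by (simp add: embed_def diff_cls)
    show "\<exists>N. \<forall>k\<ge>N. vnorm V (vdiff V (s m) (s k)) \<le> e / 2"
      using N m less_imp_le by blast
  qed
  then have "norm (vnorm (completion V) (vdiff (completion V) (embed V (s m)) (cls s)) - 0) < e"
    if m: "m \<ge> N" for m
    using e m s cip.norm_nonneg[OF cip_completion cip.diff_mem[OF cip_completion embed_mem cls_mem]]
    by fastforce
  then show "\<exists>N. \<forall>m\<ge>N. norm (vnorm (completion V) (vdiff (completion V) (embed V (s m)) (cls s)) - 0) < e"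
    by blast
qed

text \<open>For completeness, each class of a Cauchy sequence of classes is replaced by a vector of
  V within 1/(k+1) of it. These vectors form a Cauchy sequence in V, and its class is the
  limit.\<close>

theorem hilb_completion: "hilb (completion V)"
proof -
  interpret K: cip "completion V" by (rule cip_completion)
  show ?thesis
  proof
    fix A B assume "A \<in> vcar (completion V)" "B \<in> vcar (completion V)"
      and zero: "vnorm (completion V) (vdiff (completion V) A B) = 0"
    then obtain s t where s: "s \<in> cauchy_seqs V" "A = cls s" and t: "t \<in> cauchy_seqs V" "B = cls t"
      by (metis completion_cases)
    note [simp] = cauchy_seqs_mem[OF s(1)] cauchy_seqs_mem[OF t(1)]
    show "A = B"
      using norm_completion[OF diff_cauchy[OF s(1) t(1)]] s t zero
      by (auto intro!: cls_eqI simp: cauchy_rel_iff diff_cls)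
  next
    fix A assume A: "A \<in> cauchy_seqs (completion V)"
    let ?d = "\<lambda>X Y. vnorm (completion V) (vdiff (completion V) X Y)"
    have "\<exists>x\<in>vcar V. ?d (embed V x) (A k) < inverse (Suc k)" for k
    proof -
      obtain s where s: "s \<in> cauchy_seqs V" "A k = cls s"
        using K.cauchy_seqs_mem[OF A, of k] by (elim completion_cases)
      have "\<forall>\<^sub>F m in sequentially. ?d (embed V (s m)) (cls s) < inverse (Suc k)"
        by (rule order_tendstoD[OF embed_tendsto[OF s(1)]]) simp
      then obtain m where "?d (embed V (s m)) (cls s) < inverse (Suc k)"
        unfolding eventually_sequentially by blast
      then show ?thesis using s cauchy_seqs_mem[OF s(1), of m] by auto
    qed
    then obtain x where x: "\<And>k. x k \<in> vcar V" "\<And>k. ?d (embed V (x k)) (A k) < inverse (Suc k)"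
      by metis
    have Am: "A k \<in> vcar (completion V)" and xm: "embed V (x k) \<in> vcar (completion V)" for k
      using K.cauchy_seqs_mem[OF A] x by auto
    have embed_diff: "?d (embed V y) (embed V z) = vnorm V (vdiff V y z)" if "y \<in> vcar V" "z \<in> vcar V" for y z
      using that by (simp add: vnorm_def)
    have "x \<in> cauchy_seqs V"
      unfolding cauchy_seqs_def
    proof (intro CollectI conjI allI impI)
      fix e :: real assume e: "e > 0"
      obtain M where M: "inverse (Suc M) < e / 3"
        using reals_Archimedean[of "e / 3"] e by auto
      obtain N where N: "\<forall>m\<ge>N. \<forall>k\<ge>N. ?d (A m) (A k) < e / 3"
        using K.cauchy_seqsD[OF A, of "e / 3"] e by auto
      have "vnorm V (vdiff V (x m) (x k)) < e" if mk: "max M N \<le> m" "max M N \<le> k" for m k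
      proof -
        have "inverse (real (Suc m)) \<le> inverse (real (Suc M))" "inverse (real (Suc k)) \<le> inverse (real (Suc M))"
          using mk by (auto intro!: le_imp_inverse_le)
        then have "?d (embed V (x m)) (A m) < e / 3" "?d (A k) (embed V (x k)) < e / 3"
          using x(2)[of m] x(2)[of k] M K.norm_diff_commute[OF Am[of k] xm[of k]] by linarith+
        moreover have "?d (A m) (A k) < e / 3" using N mk by simp
        moreover have "?d (embed V (x m)) (embed V (x k))
            \<le> ?d (embed V (x m)) (A m) + (?d (A m) (A k) + ?d (A k) (embed V (x k)))"
          using K.norm_diff_triangle[OF xm[of m] Am[of m] xm[of k]]
            K.norm_diff_triangle[OF Am[of m] Am[of k] xm[of k]] by linarith
        ultimately show ?thesis using embed_diff x(1) by fastforce
      qed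
      then show "\<exists>N. \<forall>m\<ge>N. \<forall>k\<ge>N. vnorm V (vdiff V (x m) (x k)) < e" by blast
    qed (use x in auto)
    then have cx: "cls x \<in> vcar (completion V)" and lim: "(\<lambda>m. ?d (embed V (x m)) (cls x)) \<longlonglongrightarrow> 0"
      using embed_tendsto by auto
    have "(\<lambda>k. inverse (real (Suc k)) + ?d (embed V (x k)) (cls x)) \<longlonglongrightarrow> 0 + 0"
      by (intro tendsto_add lim LIMSEQ_inverse_real_of_nat)
    then have lim': "(\<lambda>k. inverse (real (Suc k)) + ?d (embed V (x k)) (cls x)) \<longlonglongrightarrow> 0"
      by simp
    have "(\<lambda>k. ?d (A k) (cls x)) \<longlonglongrightarrow> 0"
    proof (rule Lim_null_comparison[OF always_eventually lim'], rule allI)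
      fix k
      have "?d (A k) (cls x) \<le> ?d (A k) (embed V (x k)) + ?d (embed V (x k)) (cls x)"
        using Am xm cx by (rule K.norm_diff_triangle)
      then show "norm (?d (A k) (cls x)) \<le> inverse (real (Suc k)) + ?d (embed V (x k)) (cls x)"
        using x(2)[of k] K.norm_diff_commute[OF Am xm] Am cx by auto
    qed
    then show "\<exists>X\<in>vcar (completion V). (\<lambda>k. ?d (A k) X) \<longlonglongrightarrow> 0"
      using cx by blast
  qed
qed

text \<open>A vector of the completion is determined by its inner products with a dense set;
  continuity of the inner product extends the test to all vectors.\<close>

lemma completion_vec_eqI:
  assumes A: "A \<in> vcar (completion V)" and B: "B \<in> vcar (completion V)"
    and eq: "\<And>x. x \<in> vcar V \<Longrightarrow> vinner (completion V) A (embed V x) = vinner (completion V) B (embed V x)"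
  shows "A = B"
proof -
  interpret K: hilb "completion V" by (rule hilb_completion)
  show ?thesis
  proof (rule K.vec_eqI[OF A B])
    fix Z assume "Z \<in> vcar (completion V)"
    then obtain s where s: "s \<in> cauchy_seqs V" "Z = cls s" by (elim completion_cases)
    have lim: "(\<lambda>m. vinner (completion V) X (embed V (s m))) \<longlonglongrightarrow> vinner (completion V) X Z"
      if "X \<in> vcar (completion V)" for X
      unfolding s(2) by (rule K.inner_tendsto) (use that s embed_tendsto cauchy_seqs_mem in auto)
    show "vinner (completion V) A Z = vinner (completion V) B Z"
      using lim[OF A] lim[OF B] cauchy_seqs_mem[OF s(1)] by (simp add: eq LIMSEQ_unique)
  qed
qed

end

section \<open>Hilbert space direct sums\<close>

locale hilb_family =
  fixes V :: "nat \<Rightarrow> 'v cip_space"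
  assumes summand: "hilb (V n)"
begin

sublocale S: hilb "V n" for n
  by (rule summand)

definition slot :: "nat \<Rightarrow> 'v \<Rightarrow> nat \<Rightarrow> 'v" where
  "slot n v = (\<lambda>m. if m = n then v else vzero (V m))"

lemma hilbert_sum_mem: "x \<in> vcar (hilbert_sum V) \<longleftrightarrow>
    (\<forall>n. x n \<in> vcar (V n)) \<and> summable (\<lambda>n. (vnorm (V n) (x n))\<^sup>2)"
  by (simp add: hilbert_sum_def)

text \<open>Takes the place of Minkowski's inequality, through (a + b)^2 \<le> 2 a^2 + 2
  b^2.\<close>

lemma summable_sq_le:
  assumes x: "\<And>n. 0 \<le> a n" "summable (\<lambda>n. (a n)\<^sup>2)" and y: "\<And>n. 0 \<le> b n" "summable (\<lambda>n. (b n)\<^sup>2)"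
    and le: "\<And>n. 0 \<le> c n" "\<And>n. c n \<le> a n + (b n :: real)"
  shows "summable (\<lambda>n. (c n)\<^sup>2)"
proof (rule summable_comparison_test')
  show "summable (\<lambda>n. 2 * (a n)\<^sup>2 + 2 * (b n)\<^sup>2)"
    by (intro summable_add summable_mult x y)
  fix n
  have "(c n)\<^sup>2 \<le> (a n + b n)\<^sup>2" using le by (intro power_mono)
  also have "\<dots> \<le> 2 * (a n)\<^sup>2 + 2 * (b n)\<^sup>2"
    using sum_squares_bound[of "a n" "b n"] by (simp add: power2_sum)
  finally show "norm ((c n)\<^sup>2) \<le> 2 * (a n)\<^sup>2 + 2 * (b n)\<^sup>2" by simp
qed

lemma summable_inner:
  assumes x: "x \<in> vcar (hilbert_sum V)" and y: "y \<in> vcar (hilbert_sum V)"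
  shows "summable (\<lambda>n. vinner (V n) (x n) (y n))"
proof (rule summable_comparison_test')
  show "summable (\<lambda>n. (vnorm (V n) (x n))\<^sup>2 + (vnorm (V n) (y n))\<^sup>2)"
    using x y by (intro summable_add) (auto simp: hilbert_sum_mem)
  fix n
  have "cmod (vinner (V n) (x n) (y n)) \<le> vnorm (V n) (x n) * vnorm (V n) (y n)"
    using x y by (intro S.Cauchy_Schwarz) (auto simp: hilbert_sum_mem)
  also have "\<dots> \<le> (vnorm (V n) (x n))\<^sup>2 + (vnorm (V n) (y n))\<^sup>2"
    using sum_squares_bound[of "vnorm (V n) (x n)" "vnorm (V n) (y n)"]
      zero_le_power2[of "vnorm (V n) (x n)"] zero_le_power2[of "vnorm (V n) (y n)"] by linarith
  finally show "cmod (vinner (V n) (x n) (y n)) \<le> (vnorm (V n) (x n))\<^sup>2 + (vnorm (V n) (y n))\<^sup>2" .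
qed

lemma inner_hilbert_sum: "vinner (hilbert_sum V) x y = (\<Sum>n. vinner (V n) (x n) (y n))"
  by (simp add: hilbert_sum_def)

lemma hilbert_sum_add: "vadd (hilbert_sum V) x y = (\<lambda>n. vadd (V n) (x n) (y n))"
  and hilbert_sum_scale: "vscale (hilbert_sum V) c x = (\<lambda>n. vscale (V n) c (x n))"
  and hilbert_sum_zero: "vzero (hilbert_sum V) = (\<lambda>n. vzero (V n))"
  and hilbert_sum_diff: "vdiff (hilbert_sum V) x y = (\<lambda>n. vdiff (V n) (x n) (y n))"
  by (simp_all add: hilbert_sum_def vdiff_def)

lemma cip_hilbert_sum: "cip (hilbert_sum V)"
proof
  show "vzero (hilbert_sum V) \<in> vcar (hilbert_sum V)"
    by (simp add: hilbert_sum_mem hilbert_sum_zero)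
next
  fix x y assume x: "x \<in> vcar (hilbert_sum V)" and y: "y \<in> vcar (hilbert_sum V)"
  have [simp]: "x n \<in> vcar (V n)" "y n \<in> vcar (V n)" for n
    using x y by (auto simp: hilbert_sum_mem)
  have sx: "summable (\<lambda>n. (vnorm (V n) (x n))\<^sup>2)" "summable (\<lambda>n. (vnorm (V n) (y n))\<^sup>2)"
    using x y by (auto simp: hilbert_sum_mem)
  show "vadd (hilbert_sum V) x y \<in> vcar (hilbert_sum V)"
    unfolding hilbert_sum_mem hilbert_sum_add
    by (intro conjI allI summable_sq_le[OF _ sx(1) _ sx(2)] S.norm_triangle) auto
  show "cnj (vinner (hilbert_sum V) x y) = vinner (hilbert_sum V) y x"
    using sums_unique[OF sums_cnj[THEN iffD2, OF summable_sums[OF summable_inner[OF x y]]]]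
    by (simp add: inner_hilbert_sum)
  fix z assume z: "z \<in> vcar (hilbert_sum V)"
  then have [simp]: "z n \<in> vcar (V n)" for n by (auto simp: hilbert_sum_mem)
  show "vinner (hilbert_sum V) (vadd (hilbert_sum V) x y) z
      = vinner (hilbert_sum V) x z + vinner (hilbert_sum V) y z"
    using suminf_add[OF summable_inner[OF x z] summable_inner[OF y z]]
    by (simp add: inner_hilbert_sum hilbert_sum_add)
next
  fix c x assume x: "x \<in> vcar (hilbert_sum V)"
  then have [simp]: "x n \<in> vcar (V n)" for n by (auto simp: hilbert_sum_mem)
  show "vscale (hilbert_sum V) c x \<in> vcar (hilbert_sum V)"
    using x by (auto simp: hilbert_sum_mem hilbert_sum_scale power_mult_distrib intro: summable_mult)
  show "vinner (hilbert_sum V) (vzero (hilbert_sum V)) x = 0"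
    by (simp add: inner_hilbert_sum hilbert_sum_zero)
  show "0 \<le> Re (vinner (hilbert_sum V) x x)"
    unfolding inner_hilbert_sum Re_suminf[OF summable_inner[OF x x]]
    by (intro suminf_nonneg summable_Re summable_inner x) simp
  fix z assume z: "z \<in> vcar (hilbert_sum V)"
  then have [simp]: "z n \<in> vcar (V n)" for n by (auto simp: hilbert_sum_mem)
  show "vinner (hilbert_sum V) (vscale (hilbert_sum V) c x) z = c * vinner (hilbert_sum V) x z"
    using suminf_mult[OF summable_inner[OF x z]] by (simp add: inner_hilbert_sum hilbert_sum_scale)
qed

sublocale cip "hilbert_sum V"
  by (rule cip_hilbert_sum)

lemma component_mem: "x \<in> vcar (hilbert_sum V) \<Longrightarrow> x n \<in> vcar (V n)"
  by (simp add: hilbert_sum_mem)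

lemma norm_hilbert_sum:
  assumes x: "x \<in> vcar (hilbert_sum V)"
  shows "(vnorm (hilbert_sum V) x)\<^sup>2 = (\<Sum>n. (vnorm (V n) (x n))\<^sup>2)"
  using Re_suminf[OF summable_inner[OF x x]] component_mem[OF x] x
  by (simp add: norm_sq inner_hilbert_sum S.norm_sq)

lemma sum_norm_le:
  assumes x: "x \<in> vcar (hilbert_sum V)"
  shows "(\<Sum>n<L. (vnorm (V n) (x n))\<^sup>2) \<le> (vnorm (hilbert_sum V) x)\<^sup>2"
  unfolding norm_hilbert_sum[OF x] using x by (intro sum_le_suminf) (auto simp: hilbert_sum_mem)

lemma component_norm_le:
  assumes x: "x \<in> vcar (hilbert_sum V)"
  shows "vnorm (V n) (x n) \<le> vnorm (hilbert_sum V) x"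
proof (rule power2_le_imp_le)
  have "(vnorm (V n) (x n))\<^sup>2 \<le> (\<Sum>n<Suc n. (vnorm (V n) (x n))\<^sup>2)"
    by (simp add: sum_nonneg)
  then show "(vnorm (V n) (x n))\<^sup>2 \<le> (vnorm (hilbert_sum V) x)\<^sup>2"
    using sum_norm_le[OF x] order_trans by blast
qed (use x in simp)

theorem hilb_hilbert_sum: "hilb (hilbert_sum V)"
proof
  fix x y assume x: "x \<in> vcar (hilbert_sum V)" and y: "y \<in> vcar (hilbert_sum V)"
    and zero: "vnorm (hilbert_sum V) (vdiff (hilbert_sum V) x y) = 0"
  show "x = y"
  proof
    fix n
    have "vnorm (V n) (vdiff (V n) (x n) (y n)) = 0"
      using component_norm_le[of "vdiff (hilbert_sum V) x y" n] x y zero component_mem[of x n] component_mem[of y n]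
        S.norm_nonneg[of "vdiff (V n) (x n) (y n)" n]
      by (simp add: hilbert_sum_diff[symmetric] del: S.norm_nonneg)
        (simp add: hilbert_sum_diff)
    then show "x n = y n" using x y by (intro S.definite) (auto simp: component_mem)
  qed
next
  fix s assume s: "s \<in> cauchy_seqs (hilbert_sum V)"
  note [simp] = cauchy_seqs_mem[OF s] component_mem[OF cauchy_seqs_mem[OF s]]
  have comp_le: "vnorm (V n) (vdiff (V n) (s m n) (s k n)) \<le> vnorm (hilbert_sum V) (vdiff (hilbert_sum V) (s m) (s k))"
    for m k n
    using component_norm_le[OF diff_mem[OF cauchy_seqs_mem[OF s, of m] cauchy_seqs_mem[OF s, of k]], of n]
    by (simp add: hilbert_sum_diff)
  have "(\<lambda>k. s k n) \<in> cauchy_seqs (V n)" for n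
    unfolding cauchy_seqs_def
    using cauchy_seqsD[OF s] comp_le[of n] by (auto intro: le_less_trans) (meson le_less_trans)
  then have "\<exists>y\<in>vcar (V n). (\<lambda>k. vnorm (V n) (vdiff (V n) (s k n) y)) \<longlonglongrightarrow> 0" for n
    by (rule S.complete)
  then obtain y where y: "\<And>n. y n \<in> vcar (V n)"
      "\<And>n. (\<lambda>k. vnorm (V n) (vdiff (V n) (s k n) (y n))) \<longlonglongrightarrow> 0"
    by metis
  note [simp] = y(1)
  \<comment> \<open>The bound is first kept for finitely many components while k tends to infinity;
    only afterwards is L released. This yields convergence in the norm of the sum from componentwise
    limits.\<close>
  have part: "(\<Sum>n<L. (vnorm (V n) (vdiff (V n) (s m n) (y n)))\<^sup>2) \<le> e\<^sup>2"
    if e: "\<And>k. k \<ge> N \<Longrightarrow> vnorm (hilbert_sum V) (vdiff (hilbert_sum V) (s m) (s k)) \<le> e" for m N L e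
  proof (rule LIMSEQ_le_const2)
    have "(\<lambda>k. vnorm (V n) (vdiff (V n) (s m n) (s k n))) \<longlonglongrightarrow> vnorm (V n) (vdiff (V n) (s m n) (y n))" for n
    proof (rule S.norm_tendsto)
      have "vnorm (V n) (vdiff (V n) (vdiff (V n) (s m n) (s k n)) (vdiff (V n) (s m n) (y n)))
          = vnorm (V n) (vdiff (V n) (s k n) (y n))" for k
        by (simp add: vnorm_def)
      then show "(\<lambda>k. vnorm (V n) (vdiff (V n) (vdiff (V n) (s m n) (s k n)) (vdiff (V n) (s m n) (y n)))) \<longlonglongrightarrow> 0"
        using y(2) by simp
    qed auto
    then show "(\<lambda>k. \<Sum>n<L. (vnorm (V n) (vdiff (V n) (s m n) (s k n)))\<^sup>2)
        \<longlonglongrightarrow> (\<Sum>n<L. (vnorm (V n) (vdiff (V n) (s m n) (y n)))\<^sup>2)"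
      by (intro tendsto_intros)
    have "(\<Sum>n<L. (vnorm (V n) (vdiff (V n) (s m n) (s k n)))\<^sup>2) \<le> e\<^sup>2" if "k \<ge> N" for k
    proof -
      have "(\<Sum>n<L. (vnorm (V n) (vdiff (V n) (s m n) (s k n)))\<^sup>2)
          \<le> (vnorm (hilbert_sum V) (vdiff (hilbert_sum V) (s m) (s k)))\<^sup>2"
        using sum_norm_le[OF diff_mem[OF cauchy_seqs_mem[OF s, of m] cauchy_seqs_mem[OF s, of k]], of L]
        by (simp add: hilbert_sum_diff)
      also have "\<dots> \<le> e\<^sup>2" using e[OF that] by (intro power_mono) auto
      finally show ?thesis .
    qed
    then show "\<exists>N. \<forall>k\<ge>N. (\<Sum>n<L. (vnorm (V n) (vdiff (V n) (s m n) (s k n)))\<^sup>2) \<le> e\<^sup>2" by blast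
  qed
  have diff_summable: "summable (\<lambda>n. (vnorm (V n) (vdiff (V n) (s m n) (y n)))\<^sup>2)"
    and diff_le: "(\<Sum>n. (vnorm (V n) (vdiff (V n) (s m n) (y n)))\<^sup>2) \<le> e\<^sup>2"
    if e: "\<And>k. k \<ge> N \<Longrightarrow> vnorm (hilbert_sum V) (vdiff (hilbert_sum V) (s m) (s k)) \<le> e" for m N e
  proof -
    show *: "summable (\<lambda>n. (vnorm (V n) (vdiff (V n) (s m n) (y n)))\<^sup>2)"
      by (rule summableI_nonneg_bounded[where x = "e\<^sup>2"]) (use part[OF e] in auto)
    show "(\<Sum>n. (vnorm (V n) (vdiff (V n) (s m n) (y n)))\<^sup>2) \<le> e\<^sup>2"
      by (rule suminf_le_const[OF *]) (use part[OF e] in auto)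
  qed
  obtain N where "\<forall>m\<ge>N. \<forall>k\<ge>N. vnorm (hilbert_sum V) (vdiff (hilbert_sum V) (s m) (s k)) < 1"
    using cauchy_seqsD[OF s, of 1] by auto
  then have "summable (\<lambda>n. (vnorm (V n) (vdiff (V n) (s N n) (y n)))\<^sup>2)"
    by (intro diff_summable[of N N 1]) (simp add: less_imp_le)
  moreover have "summable (\<lambda>n. (vnorm (V n) (s N n))\<^sup>2)"
    using cauchy_seqs_mem[OF s] by (simp add: hilbert_sum_mem)
  moreover have "vnorm (V n) (y n) \<le> vnorm (V n) (s N n) + vnorm (V n) (vdiff (V n) (s N n) (y n))" for n
    using S.norm_le_add_diff[OF y(1) component_mem[OF cauchy_seqs_mem[OF s]], of n N]
      S.norm_diff_commute[OF y(1) component_mem[OF cauchy_seqs_mem[OF s]], of n N] by linarith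
  ultimately have "summable (\<lambda>n. (vnorm (V n) (y n))\<^sup>2)"
    by - (rule summable_sq_le[of "\<lambda>n. vnorm (V n) (s N n)" "\<lambda>n. vnorm (V n) (vdiff (V n) (s N n) (y n))"],
      simp_all only: S.norm_nonneg S.diff_mem y(1) component_mem[OF cauchy_seqs_mem[OF s]])
  then have ym: "y \<in> vcar (hilbert_sum V)" by (simp add: hilbert_sum_mem)
  have "(\<lambda>k. vnorm (hilbert_sum V) (vdiff (hilbert_sum V) (s k) y)) \<longlonglongrightarrow> 0"
  proof (rule LIMSEQ_I)
    fix e :: real assume e: "e > 0"
    obtain N where N: "\<forall>m\<ge>N. \<forall>k\<ge>N. vnorm (hilbert_sum V) (vdiff (hilbert_sum V) (s m) (s k)) < e / 2"
      using cauchy_seqsD[OF s, of "e / 2"] e by auto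
    have "norm (vnorm (hilbert_sum V) (vdiff (hilbert_sum V) (s k) y) - 0) < e" if k: "k \<ge> N" for k
    proof -
      have "(vnorm (hilbert_sum V) (vdiff (hilbert_sum V) (s k) y))\<^sup>2 \<le> (e / 2)\<^sup>2"
        unfolding norm_hilbert_sum[OF diff_mem[OF cauchy_seqs_mem[OF s] ym]]
        using diff_le[of N k "e / 2"] N k by (simp add: hilbert_sum_diff[of "s k" y] less_imp_le)
      then have "vnorm (hilbert_sum V) (vdiff (hilbert_sum V) (s k) y) \<le> e / 2"
        by (rule power2_le_imp_le) (use e in simp)
      then show ?thesis using e ym by simp
    qed
    then show "\<exists>N. \<forall>k\<ge>N. norm (vnorm (hilbert_sum V) (vdiff (hilbert_sum V) (s k) y) - 0) < e" by blast
  qed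
  then show "\<exists>x\<in>vcar (hilbert_sum V). (\<lambda>k. vnorm (hilbert_sum V) (vdiff (hilbert_sum V) (s k) x)) \<longlonglongrightarrow> 0"
    using ym by blast
qed

lemma slot_mem [simp, intro]:
  assumes "v \<in> vcar (V n)"
  shows "slot n v \<in> vcar (hilbert_sum V)"
proof -
  have "summable (\<lambda>m. (vnorm (V m) (slot n v m))\<^sup>2)"
    by (rule summable_finite[of "{n}"]) (auto simp: slot_def)
  then show ?thesis using assms by (simp add: hilbert_sum_mem slot_def)
qed

lemma slot_same [simp]: "slot n v n = v"
  by (simp add: slot_def)

lemma inner_slot:
  assumes x: "x \<in> vcar (hilbert_sum V)" and v: "v \<in> vcar (V n)"
  shows "vinner (hilbert_sum V) x (slot n v) = vinner (V n) (x n) v"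
proof -
  have "(\<Sum>m. vinner (V m) (x m) (slot n v m)) = (\<Sum>m\<in>{n}. vinner (V m) (x m) (slot n v m))"
    by (rule suminf_finite) (use component_mem[OF x] in \<open>auto simp: slot_def\<close>)
  then show ?thesis by (simp add: inner_hilbert_sum)
qed

end

section \<open>Tensor powers\<close>

lemma tpow_mem: "x \<in> vcar (tpow n) \<longleftrightarrow>
    (\<lambda>w. (cmod (x w))\<^sup>2) summable_on UNIV \<and> (\<forall>w. length w \<noteq> n \<longrightarrow> x w = 0)"
  by (simp add: tpow_def)

lemma tpow_simps [simp]:
  "vzero (tpow n) = (\<lambda>_. 0)" "vadd (tpow n) x y = (\<lambda>w. x w + y w)" "vscale (tpow n) c x = (\<lambda>w. c * x w)"
  by (simp_all add: tpow_def)

abbreviation ip :: "tvec \<Rightarrow> tvec \<Rightarrow> complex" where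
  "ip x y \<equiv> (\<Sum>\<^sub>\<infinity>w. x w * cnj (y w))"

lemma tpow_inner: "vinner (tpow n) x y = ip x y"
  by (simp add: tpow_def)

lemma tpow_summable: "x \<in> vcar (tpow n) \<Longrightarrow> (\<lambda>w. (cmod (x w))\<^sup>2) summable_on UNIV"
  and tpow_vanish: "x \<in> vcar (tpow n) \<Longrightarrow> length w \<noteq> n \<Longrightarrow> x w = 0"
  by (auto simp: tpow_mem)

lemma tpow_eqI:
  assumes "x \<in> vcar (tpow n)" "y \<in> vcar (tpow n)" "\<And>w. length w = n \<Longrightarrow> x w = y w"
  shows "x = y"
  using assms by (metis ext tpow_vanish)

lemma ip_summable:
  assumes "(\<lambda>w. (cmod (x w))\<^sup>2) summable_on A" "(\<lambda>w. (cmod (y w))\<^sup>2) summable_on A"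
  shows "(\<lambda>w. x w * cnj (y w)) summable_on A"
proof -
  have "(\<lambda>w. norm (x w * cnj (y w))) summable_on A"
  proof (rule Infinite_Sum.abs_summable_on_comparison_test')
    show "(\<lambda>w. (cmod (x w))\<^sup>2 + (cmod (y w))\<^sup>2) summable_on A"
      using assms by (rule summable_on_add)
    fix w
    show "norm (x w * cnj (y w)) \<le> (cmod (x w))\<^sup>2 + (cmod (y w))\<^sup>2"
      using sum_squares_bound[of "cmod (x w)" "cmod (y w)"]
        zero_le_power2[of "cmod (x w)"] zero_le_power2[of "cmod (y w)"]
      unfolding norm_mult complex_mod_cnj by linarith
  qed
  then show ?thesis by (rule abs_summable_summable)
qed

lemma sq_summable_add:
  assumes "(\<lambda>w. (cmod (x w))\<^sup>2) summable_on A" "(\<lambda>w. (cmod (y w))\<^sup>2) summable_on A"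
  shows "(\<lambda>w. (cmod (x w + y w))\<^sup>2) summable_on A"
proof (rule summable_on_comparison_test)
  show "(\<lambda>w. 2 * (cmod (x w))\<^sup>2 + 2 * (cmod (y w))\<^sup>2) summable_on A"
    using assms by (intro summable_on_add summable_on_cmult_right)
  fix w
  have "(cmod (x w + y w))\<^sup>2 \<le> (cmod (x w) + cmod (y w))\<^sup>2"
    by (intro power_mono norm_triangle_ineq) simp
  also have "\<dots> \<le> 2 * (cmod (x w))\<^sup>2 + 2 * (cmod (y w))\<^sup>2"
    using sum_squares_bound[of "cmod (x w)" "cmod (y w)"] by (simp add: power2_sum)
  finally show "(cmod (x w + y w))\<^sup>2 \<le> 2 * (cmod (x w))\<^sup>2 + 2 * (cmod (y w))\<^sup>2" .
qed simp

interpretation tpow: cip "tpow n" for n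
proof
  show "vzero (tpow n) \<in> vcar (tpow n)" by (simp add: tpow_mem)
next
  fix x y :: tvec assume x: "x \<in> vcar (tpow n)" and y: "y \<in> vcar (tpow n)"
  show "vadd (tpow n) x y \<in> vcar (tpow n)"
    using x y by (auto simp: tpow_mem intro: sq_summable_add)
  show "cnj (vinner (tpow n) x y) = vinner (tpow n) y x"
    by (simp add: tpow_inner mult.commute flip: infsum_cnj)
  fix z :: tvec assume z: "z \<in> vcar (tpow n)"
  show "vinner (tpow n) (vadd (tpow n) x y) z = vinner (tpow n) x z + vinner (tpow n) y z"
    unfolding tpow_inner tpow_simps distrib_right
    by (intro infsum_add ip_summable tpow_summable[OF x] tpow_summable[OF y] tpow_summable[OF z])
next
  fix c and x :: tvec assume x: "x \<in> vcar (tpow n)"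
  show "vscale (tpow n) c x \<in> vcar (tpow n)"
    using x by (auto simp: tpow_mem norm_mult power_mult_distrib intro: summable_on_cmult_right)
  show "vinner (tpow n) (vzero (tpow n)) x = 0" by (simp add: tpow_inner)
  show "0 \<le> Re (vinner (tpow n) x x)"
    unfolding tpow_inner
    by (subst infsum_Re[symmetric])
      (use x in \<open>auto intro!: infsum_nonneg ip_summable simp: tpow_mem\<close>)
  fix z :: tvec
  show "vinner (tpow n) (vscale (tpow n) c x) z = c * vinner (tpow n) x z"
    by (simp add: tpow_inner mult.assoc infsum_cmult_right')
qed

lemma infsum_singleton:
  fixes f :: "'a \<Rightarrow> complex"
  assumes "\<And>x. x \<noteq> a \<Longrightarrow> f x = 0"
  shows "infsum f UNIV = f a"
proof -
  have "infsum f UNIV = infsum f {a}" by (rule infsum_cong_neutral) (use assms in auto)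
  then show ?thesis by simp
qed

lemma ket_apply: "ket v w = (if w = v then 1 else 0)"
  by (simp add: ket_def)

lemma ket_mem [simp, intro]: "ket w \<in> vcar (tpow (length w))"
proof -
  have "(\<lambda>v. (cmod (ket w v))\<^sup>2) summable_on UNIV"
    by (rule finite_nonzero_values_imp_summable_on) (auto simp: ket_def)
  then show ?thesis by (auto simp: tpow_mem ket_def)
qed

lemma ket_mem': "length w = n \<Longrightarrow> ket w \<in> vcar (tpow n)"
  by auto

lemma ip_ket: "ip x (ket w) = x w"
  by (subst infsum_singleton[of w]) (auto simp: ket_def)

lemma tpow_definite:
  assumes "x \<in> vcar (tpow n)" "vinner (tpow n) x x = 0"
  shows "x = (\<lambda>_. 0)"
proof
  fix w
  show "x w = 0"
  proof (cases "length w = n")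
    case True
    have "vnorm (tpow n) x = 0" using assms by (simp add: vnorm_def)
    then have "vinner (tpow n) x (ket w) = 0"
      using tpow.Cauchy_Schwarz[OF assms(1) ket_mem'[OF True]] by simp
    then show ?thesis by (simp add: tpow_inner ip_ket)
  qed (use assms tpow_vanish in blast)
qed

lemma linear_op_tpowD:
  assumes "linear_op (tpow n) X" "x \<in> vcar (tpow n)"
  shows "X x \<in> vcar (tpow n)" "y \<in> vcar (tpow n) \<Longrightarrow> X (\<lambda>w. x w + y w) = (\<lambda>w. X x w + X y w)"
    "X (\<lambda>w. c * x w) = (\<lambda>w. c * X x w)"
  using linear_opD[OF assms] by simp_all

lemma tpow_add [simp]: "\<lbrakk>x \<in> vcar (tpow n); y \<in> vcar (tpow n)\<rbrakk> \<Longrightarrow> (\<lambda>w. x w + y w) \<in> vcar (tpow n)"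
  and tpow_scale [simp]: "x \<in> vcar (tpow n) \<Longrightarrow> (\<lambda>w. c * x w) \<in> vcar (tpow n)"
  and tpow_zero [simp]: "(\<lambda>w. 0) \<in> vcar (tpow n)"
  using tpow.add_mem[of x n y] tpow.scale_mem[of x n c] tpow.zero_mem[of n] by simp_all

lemma tpow_sum: "(\<And>k. k \<in> K \<Longrightarrow> x k \<in> vcar (tpow n)) \<Longrightarrow> (\<lambda>w. \<Sum>k\<in>K. x k w) \<in> vcar (tpow n)"
  by (induction K rule: infinite_finite_induct) auto

lemma linear_op_zero: "linear_op (tpow n) X \<Longrightarrow> X (\<lambda>w. 0) = (\<lambda>w. 0)"
  using linear_op_tpowD(3)[of n X "\<lambda>w. 0" 0] by simp

lemma linear_op_sum:
  assumes X: "linear_op (tpow n) X" and x: "\<And>k. k \<in> K \<Longrightarrow> x k \<in> vcar (tpow n)"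
  shows "X (\<lambda>w. \<Sum>k\<in>K. x k w) = (\<lambda>w. \<Sum>k\<in>K. X (x k) w)"
  using x
proof (induction K rule: infinite_finite_induct)
  case (insert a K)
  then show ?case
    using linear_op_tpowD(2)[OF X, of "x a" "\<lambda>w. \<Sum>k\<in>K. x k w"] by (simp add: tpow_sum)
qed (simp_all add: linear_op_zero[OF X])

lemma linear_op_tpowI:
  assumes "\<And>x. x \<in> vcar (tpow n) \<Longrightarrow> X x \<in> vcar (tpow n)"
    "\<And>x y. x \<in> vcar (tpow n) \<Longrightarrow> y \<in> vcar (tpow n) \<Longrightarrow> X (\<lambda>w. x w + y w) = (\<lambda>w. X x w + X y w)"
    "\<And>x c. x \<in> vcar (tpow n) \<Longrightarrow> X (\<lambda>w. c * x w) = (\<lambda>w. c * X x w)"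
  shows "linear_op (tpow n) X"
  using assms by (auto simp: linear_op_def)

lemma ip_sum_left:
  assumes "\<And>k. k \<in> K \<Longrightarrow> x k \<in> vcar (tpow n)" "y \<in> vcar (tpow n)"
  shows "ip (\<lambda>w. \<Sum>k\<in>K. x k w) y = (\<Sum>k\<in>K. ip (x k) y)"
  using assms(1)
proof (induction K rule: infinite_finite_induct)
  case (insert a K)
  then show ?case
    using tpow.inner_add_left[of "x a" n "\<lambda>w. \<Sum>k\<in>K. x k w" y] assms(2)
    by (simp add: tpow_sum tpow_inner)
qed simp_all

lemma ip_sum_right:
  assumes "\<And>k. k \<in> K \<Longrightarrow> x k \<in> vcar (tpow n)" "y \<in> vcar (tpow n)"
  shows "ip y (\<lambda>w. \<Sum>k\<in>K. x k w) = (\<Sum>k\<in>K. ip y (x k))"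
  using assms(1)
proof (induction K rule: infinite_finite_induct)
  case (insert a K)
  then show ?case
    using tpow.inner_add_right[of "x a" n "\<lambda>w. \<Sum>k\<in>K. x k w" y] assms(2)
    by (simp add: tpow_sum tpow_inner)
qed simp_all

subsection \<open>Removing and adding the first letter\<close>

text \<open>Left contraction with e_i, the adjoint of \<open>tens (ket i)\<close> for the undeformed
  inner product (\<open>ip_tens\<close>).\<close>

definition strip :: "int \<Rightarrow> tvec \<Rightarrow> tvec" where
  "strip i \<xi> = (\<lambda>u. \<xi> (i # u))"

lemma strip_mem:
  assumes "x \<in> vcar (tpow (Suc n))"
  shows "strip i x \<in> vcar (tpow n)"
proof -
  have "(\<lambda>w. (cmod (x w))\<^sup>2) summable_on range (Cons i)"
    using summable_on_subset_banach[OF tpow_summable[OF assms]] by blast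
  then have "(\<lambda>w. (cmod (x (i # w)))\<^sup>2) summable_on UNIV"
    by (subst (asm) summable_on_reindex) (auto simp: inj_on_def o_def)
  then show ?thesis using assms by (auto simp: tpow_mem strip_def)
qed

lemma tens_mem:
  assumes "x \<in> vcar (tpow n)"
  shows "tens (ket i) x \<in> vcar (tpow (Suc n))"
proof -
  have "((\<lambda>w. (cmod (tens (ket i) x w))\<^sup>2) \<circ> Cons i) summable_on UNIV"
    using assms by (simp add: o_def tens_def ket_def tpow_mem)
  then have "(\<lambda>w. (cmod (tens (ket i) x w))\<^sup>2) summable_on range (Cons i)"
    by (subst summable_on_reindex) (auto simp: inj_on_def)
  then have "(\<lambda>w. (cmod (tens (ket i) x w))\<^sup>2) summable_on UNIV"
    by (rule summable_on_cong_neutral[THEN iffD1, rotated -1])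
      (auto simp: tens_def ket_def split: list.splits)
  moreover have "tens (ket i) x w = 0" if "length w \<noteq> Suc n" for w
    using that assms by (auto simp: tens_def tpow_mem split: list.split)
  ultimately show ?thesis by (auto simp: tpow_mem)
qed

lemma strip_tens: "strip i (tens (ket j) x) = (if i = j then x else (\<lambda>_. 0))"
  by (auto simp: strip_def tens_def ket_def)

lemma tens_add: "tens f (\<lambda>w. x w + y w) = (\<lambda>w. tens f x w + tens f y w)"
  and tens_scale: "tens f (\<lambda>w. c * x w) = (\<lambda>w. c * tens f x w)"
  and tens_diff: "tens f (\<lambda>w. x w - y w) = (\<lambda>w. tens f x w - tens f y w)"
  by (auto simp: tens_def fun_eq_iff algebra_simps split: list.split)

lemma ip_tens: "ip (tens (ket i) x) y = ip x (strip i y)"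
proof -
  have "ip (tens (ket i) x) y = infsum (\<lambda>w. tens (ket i) x w * cnj (y w)) (range (Cons i))"
    by (rule infsum_cong_neutral) (auto simp: tens_def ket_def split: list.splits)
  also have "\<dots> = ip x (strip i y)"
    by (subst infsum_reindex) (auto simp: inj_on_def o_def tens_def ket_def strip_def)
  finally show ?thesis .
qed

subsection \<open>Slices and amplifications\<close>

text \<open>The middle part of a vector with the outer letters frozen. Slices with m = 2 are what
  \<open>T\<close> acts on in \<open>ampl\<close>; slices with m = 3 carry the braid relation to
  longer words.\<close>

definition slice :: "int list \<Rightarrow> int list \<Rightarrow> nat \<Rightarrow> tvec \<Rightarrow> tvec" where
  "slice p s m \<xi> = (\<lambda>v. if length v = m then \<xi> (p @ v @ s) else 0)"

lemma slice_mem: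
  assumes x: "x \<in> vcar (tpow n)"
  shows "slice p s m x \<in> vcar (tpow m)"
proof -
  let ?h = "\<lambda>v. p @ v @ s"
  have "(\<lambda>w. (cmod (x w))\<^sup>2) summable_on (?h ` {v. length v = m})"
    using summable_on_subset_banach[OF tpow_summable[OF x]] by blast
  then have "(\<lambda>v. (cmod (x (?h v)))\<^sup>2) summable_on {v. length v = m}"
    by (subst (asm) summable_on_reindex) (auto simp: inj_on_def o_def)
  then have "(\<lambda>v. (cmod (slice p s m x v))\<^sup>2) summable_on UNIV"
    by (rule summable_on_cong_neutral[THEN iffD1, rotated -1]) (auto simp: slice_def)
  then show ?thesis by (auto simp: tpow_mem slice_def)
qed

lemma slice_add: "slice p s m (\<lambda>w. x w + y w) = (\<lambda>v. slice p s m x v + slice p s m y v)"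
  and slice_scale: "slice p s m (\<lambda>w. c * x w) = (\<lambda>v. c * slice p s m x v)"
  by (auto simp: slice_def)

lemma ampl_append:
  assumes "1 \<le> k" "length p = k - 1" "length v = 2"
  shows "ampl T k \<xi> (p @ v @ s) = T (slice p s 2 \<xi>) v"
proof -
  obtain a b where v: "v = [a, b]"
    using assms(3) by (auto simp: length_Suc_conv numeral_2_eq_2)
  obtain j where k: "k = Suc j" "length p = j" using assms by (cases k) auto
  show ?thesis by (simp add: ampl_def slice_def v k nth_append cong: if_cong)
qed

lemma split_word:
  assumes "1 \<le> k" "k - 1 + m \<le> length w"
  obtains p v s where "w = p @ v @ s" "length p = k - 1" "length v = m" "length s = length w - (k - 1) - m"
proof
  show "w = take (k - 1) w @ take m (drop (k - 1) w) @ drop m (drop (k - 1) w)"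
    by (simp only: append_take_drop_id)
qed (use assms in auto)

section \<open>Amplifications of a Yang-Baxter-Hecke operator and their relations\<close>

locale hecke =
  fixes T :: "tvec \<Rightarrow> tvec" and q :: real
  assumes yang_baxter: "yang_baxter T" and q: "q \<ge> -1"
    and hecke_eq: "\<xi> \<in> vcar (tpow 2) \<Longrightarrow>
      T (T \<xi>) = (\<lambda>w. complex_of_real (q - 1) * T \<xi> w + complex_of_real q * \<xi> w)"
begin

lemma T_linear: "linear_op (tpow 2) T"
  using yang_baxter by (simp add: yang_baxter_def)

lemmas T_mem = linear_op_tpowD(1)[OF T_linear]
  and T_add = linear_op_tpowD(2)[OF T_linear]
  and T_scale = linear_op_tpowD(3)[OF T_linear]
  and T_zero = linear_op_zero[OF T_linear]

lemma T_sym: "\<lbrakk>x \<in> vcar (tpow 2); y \<in> vcar (tpow 2)\<rbrakk> \<Longrightarrow> ip (T x) y = ip x (T y)"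
  using yang_baxter by (simp add: yang_baxter_def tpow_inner)

text \<open>Symmetry and the Hecke relation give |T x|^2 = (q - 1) \<langle>x, T x\<rangle> + q
  |x|^2. If |T x| exceeds |x|, the right-hand side is at most (|q - 1| + |q|) |x| |T x|, and |T x|
  can be cancelled.\<close>

lemma T_bounded:
  "\<exists>C\<ge>0. \<forall>x\<in>vcar (tpow 2). vnorm (tpow 2) (T x) \<le> C * vnorm (tpow 2) x"
proof (intro exI conjI ballI)
  let ?n = "vnorm (tpow 2)"
  show "\<bar>q - 1\<bar> + \<bar>q\<bar> + 1 \<ge> 0" by simp
  fix x assume x: "x \<in> vcar (tpow 2)"
  show "?n (T x) \<le> (\<bar>q - 1\<bar> + \<bar>q\<bar> + 1) * ?n x"
  proof (cases "?n (T x) \<le> ?n x")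
    case True
    have "1 * ?n x \<le> (\<bar>q - 1\<bar> + \<bar>q\<bar> + 1) * ?n x"
      by (rule mult_right_mono) (use x in auto)
    then show ?thesis using True by linarith
  next
    case False
    have nx: "?n x \<ge> 0" using x by simp
    have "vinner (tpow 2) (T x) (T x) = vinner (tpow 2) x (T (T x))"
      unfolding tpow_inner by (rule T_sym) (use x T_mem in auto)
    also have "\<dots> = vinner (tpow 2) x (vadd (tpow 2) (vscale (tpow 2) (of_real (q - 1)) (T x))
        (vscale (tpow 2) (of_real q) x))"
      by (simp add: hecke_eq[OF x])
    also have "\<dots> = of_real (q - 1) * vinner (tpow 2) x (T x) + of_real q * vinner (tpow 2) x x"
      using x T_mem by (subst tpow.inner_add_right) (auto simp del: tpow_simps)
    finally have "(?n (T x))\<^sup>2 = Re (of_real (q - 1) * vinner (tpow 2) x (T x) + of_real q * vinner (tpow 2) x x)"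
      using x T_mem by (simp add: tpow.norm_sq)
    also have "\<dots> = (q - 1) * Re (vinner (tpow 2) x (T x)) + q * (?n x)\<^sup>2"
      using x by (simp add: tpow.norm_sq)
    also have "\<dots> \<le> \<bar>q - 1\<bar> * (?n x * ?n (T x)) + \<bar>q\<bar> * (?n x)\<^sup>2"
    proof (intro add_mono)
      have "(q - 1) * Re (vinner (tpow 2) x (T x)) \<le> \<bar>q - 1\<bar> * \<bar>Re (vinner (tpow 2) x (T x))\<bar>"
        by (metis abs_ge_self abs_mult)
      also have "\<dots> \<le> \<bar>q - 1\<bar> * (?n x * ?n (T x))"
        using tpow.Cauchy_Schwarz[OF x T_mem[OF x]] abs_Re_le_cmod order_trans
        by (blast intro: mult_left_mono abs_ge_zero)
      finally show "(q - 1) * Re (vinner (tpow 2) x (T x)) \<le> \<bar>q - 1\<bar> * (?n x * ?n (T x))" .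
    qed (auto intro: mult_right_mono)
    also have "\<dots> \<le> \<bar>q - 1\<bar> * (?n x * ?n (T x)) + \<bar>q\<bar> * (?n x * ?n (T x))"
      unfolding power2_eq_square by (intro add_left_mono mult_left_mono) (use False nx in auto)
    finally have "?n (T x) * ?n (T x) \<le> ((\<bar>q - 1\<bar> + \<bar>q\<bar>) * ?n x) * ?n (T x)"
      by (simp add: power2_eq_square algebra_simps)
    then have "?n (T x) \<le> (\<bar>q - 1\<bar> + \<bar>q\<bar>) * ?n x"
      using False nx by simp
    then show ?thesis using nx by (simp add: algebra_simps)
  qed
qed

lemma ampl_vanish:
  assumes x: "x \<in> vcar (tpow n)" and "length w \<noteq> n"
  shows "ampl T k x w = 0"
proof (cases "1 \<le> k \<and> k < length w")
  case True
  then have "(\<lambda>v. if length v = 2 then x (take (k - 1) w @ v @ drop (k + 1) w) else 0) = (\<lambda>_. 0)"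
    using assms tpow_vanish[OF x] by (auto simp: fun_eq_iff)
  then show ?thesis by (simp add: ampl_def T_zero)
qed (simp only: ampl_def if_False)

context
  fixes n k :: nat
  assumes k: "1 \<le> k" "k < n"
begin

text \<open>Words of length n are split into frozen outer letters (an element of \<open>A\<close>)
  and the two active letters (an element of \<open>B\<close>), so that a sum over words becomes an
  iterated sum whose inner part is taken over one slice.\<close>

private definition "A = {p :: int list. length p = k - 1} \<times> {s :: int list. length s = n - k - 1}"
private definition "B = {v :: int list. length v = 2}"
private definition "join = (\<lambda>((p, s), v). p @ v @ s :: int list)"

private lemma bij: "bij_betw join (A \<times> B) {w. length w = n}"
proof (rule bij_betwI')
  fix x y assume x: "x \<in> A \<times> B" and y: "y \<in> A \<times> B"
  show "join x = join y \<longleftrightarrow> x = y"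
    using x y by (auto simp: A_def B_def join_def)
next
  fix x assume "x \<in> A \<times> B"
  then show "join x \<in> {w. length w = n}" using k by (auto simp: A_def B_def join_def)
next
  fix w :: "int list" assume "w \<in> {w. length w = n}"
  then have n: "length w = n" by simp
  obtain p v s where "w = p @ v @ s" "length p = k - 1" "length v = 2" "length s = length w - (k - 1) - 2"
    by (rule split_word[of k 2 w, OF k(1)]) (use k n in linarith)
  then show "\<exists>x\<in>A \<times> B. w = join x"
    using k n by (intro bexI[of _ "((p, s), v)"]) (auto simp: A_def B_def join_def)
qed

private lemma sum_join:
  fixes f :: "int list \<Rightarrow> complex"
  assumes "f summable_on UNIV" "\<And>w. length w \<noteq> n \<Longrightarrow> f w = 0"
  shows "infsum f UNIV = (\<Sum>\<^sub>\<infinity>(p, s)\<in>A. \<Sum>\<^sub>\<infinity>v\<in>B. f (p @ v @ s))"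
proof -
  have "f summable_on {w. length w = n}"
    using summable_on_subset_banach[OF assms(1)] by blast
  then have s: "(\<lambda>x. f (join x)) summable_on A \<times> B"
    by (simp add: summable_on_reindex_bij_betw[OF bij])
  have "infsum f UNIV = infsum f {w. length w = n}"
    by (rule infsum_cong_neutral) (use assms(2) in auto)
  also have "\<dots> = infsum (\<lambda>x. f (join x)) (A \<times> B)"
    by (rule infsum_reindex_bij_betw[OF bij, symmetric])
  also have "\<dots> = (\<Sum>\<^sub>\<infinity>a\<in>A. \<Sum>\<^sub>\<infinity>v\<in>B. f (join (a, v)))"
    by (rule infsum_Sigma_banach[OF s, symmetric])
  also have "\<dots> = (\<Sum>\<^sub>\<infinity>(p, s)\<in>A. \<Sum>\<^sub>\<infinity>v\<in>B. f (p @ v @ s))"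
    by (intro infsum_cong) (auto simp: join_def)
  finally show ?thesis .
qed

private lemma ampl_join: "a \<in> A \<Longrightarrow> v \<in> B \<Longrightarrow> ampl T k x (join (a, v)) = T (slice (fst a) (snd a) 2 x) v"
  using k by (auto simp: A_def B_def join_def ampl_append)

private lemma norm_slice:
  assumes x: "x \<in> vcar (tpow 2)"
  shows "((\<lambda>v. (cmod (x v))\<^sup>2) has_sum (vnorm (tpow 2) x)\<^sup>2) B"
proof -
  have s: "(\<lambda>v. (cmod (x v))\<^sup>2) summable_on B"
    using summable_on_subset_banach[OF tpow_summable[OF x]] by blast
  have "(vnorm (tpow 2) x)\<^sup>2 = Re (ip x x)" using x by (simp add: tpow.norm_sq tpow_inner)
  also have "\<dots> = (\<Sum>\<^sub>\<infinity>w. Re (x w * cnj (x w)))"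
    by (intro infsum_Re[symmetric] ip_summable tpow_summable[OF x])
  also have "\<dots> = (\<Sum>\<^sub>\<infinity>v. (cmod (x v))\<^sup>2)"
    unfolding complex_norm_square[symmetric] Re_complex_of_real ..
  also have "\<dots> = infsum (\<lambda>v. (cmod (x v))\<^sup>2) B"
    by (rule infsum_cong_neutral) (use tpow_vanish[OF x] in \<open>auto simp: B_def\<close>)
  finally show ?thesis using s by simp
qed

text \<open>The squared norm of a vector is the sum of the squared norms of its slices, and
  \<open>T\<close> enlarges each of these by at most the same factor
  \<open>C\<^sup>2\<close>.\<close>

private lemma ampl_summable:
  assumes x: "x \<in> vcar (tpow n)"
  shows "(\<lambda>w. (cmod (ampl T k x w))\<^sup>2) summable_on UNIV"
proof -
  obtain C where C: "C \<ge> 0" "\<And>x. x \<in> vcar (tpow 2) \<Longrightarrow> vnorm (tpow 2) (T x) \<le> C * vnorm (tpow 2) x"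
    using T_bounded by blast
  let ?s = "\<lambda>a. slice (fst a) (snd a) 2 x"
  have "(\<lambda>w. (cmod (x w))\<^sup>2) summable_on {w. length w = n}"
    using summable_on_subset_banach[OF tpow_summable[OF x]] by blast
  then have "(\<lambda>z. (cmod (x (join z)))\<^sup>2) summable_on A \<times> B"
    by (simp add: summable_on_reindex_bij_betw[OF bij, of "\<lambda>w. (cmod (x w))\<^sup>2"])
  then have "(\<lambda>a. infsum (\<lambda>v. (cmod (x (join (a, v))))\<^sup>2) B) summable_on A"
    by (intro summable_on_Sigma_banach[of "\<lambda>a v. (cmod (x (join (a, v))))\<^sup>2" A "\<lambda>_. B"])
      (simp add: case_prod_unfold)
  moreover have "infsum (\<lambda>v. (cmod (x (join (a, v))))\<^sup>2) B = (vnorm (tpow 2) (?s a))\<^sup>2" if "a \<in> A" for a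
  proof -
    have "infsum (\<lambda>v. (cmod (x (join (a, v))))\<^sup>2) B = infsum (\<lambda>v. (cmod (?s a v))\<^sup>2) B"
      using that by (intro infsum_cong) (auto simp: join_def slice_def A_def B_def)
    also have "\<dots> = (vnorm (tpow 2) (?s a))\<^sup>2"
      by (rule infsumI[OF norm_slice[OF slice_mem[OF x]]])
    finally show ?thesis .
  qed
  ultimately have "(\<lambda>a. (vnorm (tpow 2) (?s a))\<^sup>2) summable_on A"
    by (simp cong: summable_on_cong)
  then have "(\<lambda>a. C\<^sup>2 * (vnorm (tpow 2) (?s a))\<^sup>2) summable_on A"
    by (rule summable_on_cmult_right)
  then have "(\<lambda>a. (vnorm (tpow 2) (T (?s a)))\<^sup>2) summable_on A"
  proof (rule summable_on_comparison_test)
    fix a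
    have "(vnorm (tpow 2) (T (?s a)))\<^sup>2 \<le> (C * vnorm (tpow 2) (?s a))\<^sup>2"
      by (intro power_mono C slice_mem[OF x] tpow.norm_nonneg T_mem)
    then show "(vnorm (tpow 2) (T (?s a)))\<^sup>2 \<le> C\<^sup>2 * (vnorm (tpow 2) (?s a))\<^sup>2"
      by (simp add: power_mult_distrib)
  qed simp
  then have "(\<lambda>(a, v). (cmod (T (?s a) v))\<^sup>2) summable_on A \<times> B"
    by (intro summable_on_SigmaI[where g = "\<lambda>a. (vnorm (tpow 2) (T (?s a)))\<^sup>2"])
      (auto intro!: norm_slice T_mem slice_mem[OF x])
  then have "(\<lambda>z. (cmod (ampl T k x (join z)))\<^sup>2) summable_on A \<times> B"
    by (rule summable_on_cong[THEN iffD2, rotated]) (auto simp: ampl_join)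
  then have "(\<lambda>w. (cmod (ampl T k x w))\<^sup>2) summable_on {w. length w = n}"
    by (simp add: summable_on_reindex_bij_betw[OF bij, of "\<lambda>w. (cmod (ampl T k x w))\<^sup>2"])
  then show ?thesis
    by (rule summable_on_cong_neutral[THEN iffD1, rotated -1]) (use ampl_vanish[OF x] in auto)
qed

lemma ampl_mem_aux: "x \<in> vcar (tpow n) \<Longrightarrow> ampl T k x \<in> vcar (tpow n)"
  unfolding tpow_mem[of "ampl T k x"] using ampl_summable ampl_vanish by blast

lemma ampl_sym_aux:
  assumes x: "x \<in> vcar (tpow n)" and y: "y \<in> vcar (tpow n)"
  shows "ip (ampl T k x) y = ip x (ampl T k y)"
proof -
  have restrict: "infsum (\<lambda>v. a v * cnj (b v)) B = ip a b" if "a \<in> vcar (tpow 2)" for a b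
    by (rule infsum_cong_neutral) (use tpow_vanish[OF that] in \<open>auto simp: B_def\<close>)
  have "ip (ampl T k x) y = (\<Sum>\<^sub>\<infinity>(p, s)\<in>A. \<Sum>\<^sub>\<infinity>v\<in>B. ampl T k x (p @ v @ s) * cnj (y (p @ v @ s)))"
    by (rule sum_join) (use x y tpow_vanish in \<open>auto intro!: ip_summable tpow_summable ampl_mem_aux\<close>)
  also have "\<dots> = (\<Sum>\<^sub>\<infinity>(p, s)\<in>A. ip (T (slice p s 2 x)) (slice p s 2 y))"
  proof (intro infsum_cong, clarify)
    fix p s assume "(p, s) \<in> A"
    then have "(\<Sum>\<^sub>\<infinity>v\<in>B. ampl T k x (p @ v @ s) * cnj (y (p @ v @ s)))
        = (\<Sum>\<^sub>\<infinity>v\<in>B. T (slice p s 2 x) v * cnj (slice p s 2 y v))"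
      using k by (intro infsum_cong) (auto simp: A_def B_def ampl_append slice_def)
    then show "(\<Sum>\<^sub>\<infinity>v\<in>B. ampl T k x (p @ v @ s) * cnj (y (p @ v @ s))) = ip (T (slice p s 2 x)) (slice p s 2 y)"
      by (simp add: restrict T_mem slice_mem[OF x])
  qed
  also have "\<dots> = (\<Sum>\<^sub>\<infinity>(p, s)\<in>A. ip (slice p s 2 x) (T (slice p s 2 y)))"
    by (simp add: T_sym slice_mem[OF x] slice_mem[OF y])
  also have "\<dots> = (\<Sum>\<^sub>\<infinity>(p, s)\<in>A. \<Sum>\<^sub>\<infinity>v\<in>B. x (p @ v @ s) * cnj (ampl T k y (p @ v @ s)))"
  proof (intro infsum_cong, clarify)
    fix p s assume "(p, s) \<in> A"
    then have "(\<Sum>\<^sub>\<infinity>v\<in>B. x (p @ v @ s) * cnj (ampl T k y (p @ v @ s)))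
        = (\<Sum>\<^sub>\<infinity>v\<in>B. slice p s 2 x v * cnj (T (slice p s 2 y) v))"
      using k by (intro infsum_cong) (auto simp: A_def B_def ampl_append slice_def)
    then show "ip (slice p s 2 x) (T (slice p s 2 y)) = (\<Sum>\<^sub>\<infinity>v\<in>B. x (p @ v @ s) * cnj (ampl T k y (p @ v @ s)))"
      by (simp add: restrict slice_mem[OF x])
  qed
  also have "\<dots> = ip x (ampl T k y)"
    by (rule sum_join[symmetric]) (use x y tpow_vanish in \<open>auto intro!: ip_summable tpow_summable ampl_mem_aux\<close>)
  finally show ?thesis .
qed

end

text \<open>The default value in \<open>ampl\<close> yields the zero operator for indices out of
  range; this lets membership and symmetry be stated below for every k.\<close>

lemma ampl_trivial: "\<not> (1 \<le> k \<and> k < n) \<Longrightarrow> x \<in> vcar (tpow n) \<Longrightarrow> ampl T k x = (\<lambda>_. 0)"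
  using ampl_vanish[of x n] by (metis ampl_def)

lemma ampl_mem [simp, intro]: "x \<in> vcar (tpow n) \<Longrightarrow> ampl T k x \<in> vcar (tpow n)"
  by (cases "1 \<le> k \<and> k < n") (auto intro: ampl_mem_aux simp: ampl_trivial)

lemma ampl_sym: "\<lbrakk>x \<in> vcar (tpow n); y \<in> vcar (tpow n)\<rbrakk> \<Longrightarrow> ip (ampl T k x) y = ip x (ampl T k y)"
  by (cases "1 \<le> k \<and> k < n") (auto intro: ampl_sym_aux simp: ampl_trivial)

lemma ampl_linear: "linear_op (tpow n) (ampl T k)"
proof (rule linear_op_tpowI)
  have slice: "ampl T k \<xi> w = (if 1 \<le> k \<and> k < length w
      then T (slice (take (k - 1) w) (drop (k + 1) w) 2 \<xi>) [w ! (k - 1), w ! k] else 0)" for \<xi> w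
    by (simp only: ampl_def slice_def)
  fix x c assume x: "x \<in> vcar (tpow n)"
  show "ampl T k (\<lambda>w. c * x w) = (\<lambda>w. c * ampl T k x w)"
    by (auto simp: slice slice_scale T_scale slice_mem[OF x])
  fix y assume y: "y \<in> vcar (tpow n)"
  show "ampl T k (\<lambda>w. x w + y w) = (\<lambda>w. ampl T k x w + ampl T k y w)"
    by (auto simp: slice slice_add T_add slice_mem[OF x] slice_mem[OF y])
qed simp

text \<open>Relations between amplifications on a long tensor power can thereby be checked on
  slices: the Hecke relation with m = 2 and the braid relation with m = 3.\<close>

lemma slice_ampl:
  assumes x: "x \<in> vcar (tpow n)" and j: "1 \<le> j" "j < m"
  shows "slice p s m (ampl T (length p + j) x) = ampl T j (slice p s m x)"
proof
  fix v
  show "slice p s m (ampl T (length p + j) x) v = ampl T j (slice p s m x) v"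
  proof (cases "length v = m")
    case True
    obtain p' v' s' where v: "v = p' @ v' @ s'" "length p' = j - 1" "length v' = 2" "length s' = length v - (j - 1) - 2"
      by (rule split_word[of j 2 v, OF j(1)]) (use j True in linarith)
    have s': "length s' = m - j - 1" using v(4) True j by linarith
    have "slice (p @ p') (s' @ s) 2 x = slice p' s' 2 (slice p s m x)"
      using v(2) s' j by (auto simp: slice_def fun_eq_iff)
    moreover have "ampl T (length p + j) x ((p @ p') @ v' @ (s' @ s)) = T (slice (p @ p') (s' @ s) 2 x) v'"
      by (rule ampl_append) (use v(2,3) j in auto)
    ultimately show ?thesis
      using True j s' v(2,3) by (simp add: v(1) slice_def[of p s m "ampl T (length p + j) x"] ampl_append)
  next
    case False
    then show ?thesis
      using ampl_vanish[OF slice_mem[OF x] False] by (simp add: slice_def)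
  qed
qed

lemma ampl_one: "x \<in> vcar (tpow 2) \<Longrightarrow> ampl T (Suc 0) x = T x"
proof (rule tpow_eqI[of _ 2])
  fix w :: "int list" assume x: "x \<in> vcar (tpow 2)" and w: "length w = 2"
  have "slice [] [] 2 x = x"
    using tpow_vanish[OF x] by (auto simp: slice_def)
  then show "ampl T (Suc 0) x w = T x w"
    using ampl_append[of 1 "[]" w T x "[]"] w by simp
qed (auto simp: T_mem)

lemma ampl_hecke:
  assumes x: "x \<in> vcar (tpow n)" and k: "1 \<le> k" "k < n"
  shows "ampl T k (ampl T k x) = (\<lambda>w. complex_of_real (q - 1) * ampl T k x w + complex_of_real q * x w)"
proof (rule tpow_eqI[of _ n])
  fix w :: "int list" assume n: "length w = n"
  obtain p v s where w: "w = p @ v @ s" "length p = k - 1" "length v = 2" "length s = length w - (k - 1) - 2"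
    by (rule split_word[of k 2 w, OF k(1)]) (use k n in linarith)
  have "slice p s 2 (ampl T k x) = T (slice p s 2 x)"
    using slice_ampl[OF x, of 1 2 p s] w(2) k by (simp add: ampl_one slice_mem[OF x])
  then have "ampl T k (ampl T k x) w = T (T (slice p s 2 x)) v"
    using w(2,3) k by (simp add: w(1) ampl_append)
  also have "\<dots> = complex_of_real (q - 1) * T (slice p s 2 x) v + complex_of_real q * slice p s 2 x v"
    by (simp add: hecke_eq[OF slice_mem[OF x]])
  finally show "ampl T k (ampl T k x) w = complex_of_real (q - 1) * ampl T k x w + complex_of_real q * x w"
    using w(2,3) k by (simp add: w(1) ampl_append slice_def)
qed (use x in auto)

lemma ampl_braid:
  assumes x: "x \<in> vcar (tpow n)" and k: "1 \<le> k" "Suc k < n"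
  shows "ampl T k (ampl T (Suc k) (ampl T k x)) = ampl T (Suc k) (ampl T k (ampl T (Suc k) x))"
proof (rule tpow_eqI[of _ n])
  fix w :: "int list" assume n: "length w = n"
  obtain p v s where w: "w = p @ v @ s" "length p = k - 1" "length v = 3" "length s = length w - (k - 1) - 3"
    by (rule split_word[of k 3 w, OF k(1)]) (use k n in linarith)
  have 1: "slice p s 3 (ampl T k y) = ampl T 1 (slice p s 3 y)" if "y \<in> vcar (tpow n)" for y
    using slice_ampl[OF that, of 1 3 p s] w(2) k by simp
  have 2: "slice p s 3 (ampl T (Suc k) y) = ampl T 2 (slice p s 3 y)" if "y \<in> vcar (tpow n)" for y
    using slice_ampl[OF that, of 2 3 p s] w(2) k by simp
  have yb: "ampl T 1 (ampl T 2 (ampl T 1 \<xi>)) = ampl T 2 (ampl T 1 (ampl T 2 \<xi>))" if "\<xi> \<in> vcar (tpow 3)" for \<xi>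
    using that yang_baxter by (simp add: yang_baxter_def)
  have "slice p s 3 (ampl T k (ampl T (Suc k) (ampl T k x))) = slice p s 3 (ampl T (Suc k) (ampl T k (ampl T (Suc k) x)))"
    by (simp only: 1 2 x ampl_mem yb[OF slice_mem[OF x]])
  from fun_cong[OF this, of v] show "ampl T k (ampl T (Suc k) (ampl T k x)) w = ampl T (Suc k) (ampl T k (ampl T (Suc k) x)) w"
    using w(3) by (simp add: w(1) slice_def)
qed (use x in auto)

lemma slice_ket:
  assumes "length P = length P0" "length u = 2"
  shows "slice P S 2 (ket (P0 @ u @ S0)) = (\<lambda>v. (if P = P0 \<and> S = S0 then 1 else 0) * ket u v)"
  using assms by (auto simp: slice_def ket_def fun_eq_iff)

lemma ampl_ket:
  assumes "1 \<le> k" "length P = k - 1" "length P0 = k - 1" "length u = 2" "length u' = 2"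
  shows "ampl T k (ket (P0 @ u @ S0)) (P @ u' @ S) = (if P = P0 \<and> S = S0 then 1 else 0) * T (ket u) u'"
  using assms by (subst ampl_append) (auto simp: slice_ket T_scale[OF ket_mem'])

text \<open>Nested slices of a general vector do not factor. For a basis vector each slice is a
  multiple of a basis vector of the second power, and both orders of application give the product of
  the same two matrix entries of \<open>T\<close>.\<close>

lemma ampl_commute_ket:
  assumes jk: "1 \<le> j" "j + 2 \<le> k" "k < length w"
  shows "ampl T j (ampl T k (ket w)) = ampl T k (ampl T j (ket w))"
proof (rule tpow_eqI[of _ "length w"])
  have split: "\<exists>p v m u s. w' = p @ v @ m @ u @ s \<and> length p = j - 1 \<and> length v = 2
      \<and> length m = k - j - 2 \<and> length u = 2 \<and> length s = length w - k - 1"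
    if w': "length w' = length w" for w' :: "int list"
  proof -
    obtain p v t where 1: "w' = p @ v @ t" "length p = j - 1" "length v = 2" "length t = length w' - (j - 1) - 2"
      by (rule split_word[of j 2 w', OF jk(1)]) (use jk w' in linarith)
    have t: "1 \<le> k - j - 1" "k - j - 1 - 1 + 2 \<le> length t"
      using jk w' 1(4) by linarith+
    obtain m u s where 2: "t = m @ u @ s" "length m = k - j - 1 - 1" "length u = 2"
        "length s = length t - (k - j - 1 - 1) - 2"
      by (rule split_word[OF t])
    have s: "length s = length w - k - 1" "length m = k - j - 2" using 1(4) 2(2,4) jk w' by linarith+
    show ?thesis
      using 1(1-3) 2(1,3) s by (intro exI[of _ p] exI[of _ v] exI[of _ m] exI[of _ u] exI[of _ s]) simp
  qed
  obtain p v m u s where w: "w = p @ v @ m @ u @ s" "length p = j - 1" "length v = 2"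
      "length m = k - j - 2" "length u = 2" "length s = length w - k - 1"
    using split[OF refl] by blast
  fix w' :: "int list" assume "length w' = length w"
  then obtain p' v' m' u' s' where w': "w' = p' @ v' @ m' @ u' @ s'" "length p' = j - 1" "length v' = 2"
      "length m' = k - j - 2" "length u' = 2" "length s' = length w - k - 1"
    using split[of w'] by blast
  have ls: "length s = length s'" using w(6) w'(6) by simp
  have inner_k: "ampl T k (ket w) (p' @ z @ m' @ u' @ s')
      = (if p' @ z @ m' = p @ v @ m \<and> s' = s then 1 else 0) * T (ket u) u'" if "length z = 2" for z
    using ampl_ket[of k "p' @ z @ m'" "p @ v @ m" u u' s s'] that w(2-5) w'(2-5) jk unfolding w(1) by simp
  have inner_j: "ampl T j (ket w) (p' @ v' @ m' @ z @ s')
      = (if p' = p \<and> m' @ z @ s' = m @ u @ s then 1 else 0) * T (ket v) v'" if "length z = 2" for z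
    using ampl_ket[of j p' p v v' "m @ u @ s" "m' @ z @ s'"] that w(2-5) w'(2-5) jk unfolding w(1) by simp
  \<comment> \<open>Indicator that w' agrees with w away from the four active letters; every other
    entry vanishes.\<close>
  define c :: complex where "c = (if p' = p \<and> m' = m \<and> s' = s then 1 else 0)"
  have "slice p' (m' @ u' @ s') 2 (ampl T k (ket w)) = (\<lambda>z. (c * T (ket u) u') * ket v z)"
  proof
    fix z
    show "slice p' (m' @ u' @ s') 2 (ampl T k (ket w)) z = (c * T (ket u) u') * ket v z"
    proof (cases "length z = 2")
      case True
      then have "slice p' (m' @ u' @ s') 2 (ampl T k (ket w)) z = ampl T k (ket w) (p' @ z @ m' @ u' @ s')" by (simp add: slice_def)
      also note inner_k[OF True]
      finally show ?thesis using True w(2-5) w'(2-5) by (auto simp: c_def ket_apply)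
    next
      case False
      then show ?thesis using w(3,5) by (auto simp: slice_def ket_apply)
    qed
  qed
  then have "ampl T j (ampl T k (ket w)) w' = (c * T (ket u) u') * T (ket v) v'"
    using ampl_append[of j p' v' T "ampl T k (ket w)" "m' @ u' @ s'"] jk w(2-5) w'(2-5)
    by (simp add: w'(1) T_scale[OF ket_mem'])
  moreover have "slice (p' @ v' @ m') s' 2 (ampl T j (ket w)) = (\<lambda>z. (c * T (ket v) v') * ket u z)"
  proof
    fix z
    show "slice (p' @ v' @ m') s' 2 (ampl T j (ket w)) z = (c * T (ket v) v') * ket u z"
    proof (cases "length z = 2")
      case True
      then have "slice (p' @ v' @ m') s' 2 (ampl T j (ket w)) z = ampl T j (ket w) (p' @ v' @ m' @ z @ s')" by (simp add: slice_def)
      also note inner_j[OF True]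
      finally show ?thesis using True w(2-5) w'(2-5) ls by (auto simp: c_def ket_apply)
    next
      case False
      then show ?thesis using w(3,5) by (auto simp: slice_def ket_apply)
    qed
  qed
  then have "ampl T k (ampl T j (ket w)) w' = (c * T (ket v) v') * T (ket u) u'"
    using ampl_append[of k "p' @ v' @ m'" u' T "ampl T j (ket w)" s'] jk w(2-5) w'(2-5)
    by (simp add: w'(1) T_scale[OF ket_mem'])
  ultimately show "ampl T j (ampl T k (ket w)) w' = ampl T k (ampl T j (ket w)) w'" by simp
qed auto

text \<open>Coefficients are inner products with basis vectors. By symmetry both amplifications move
  onto \<open>ket w\<close>, which reduces the claim to basis vectors without any expansion of
  x.\<close>

lemma ampl_commute:
  assumes x: "x \<in> vcar (tpow n)" and jk: "1 \<le> j" "j + 2 \<le> k" "k < n"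
  shows "ampl T j (ampl T k x) = ampl T k (ampl T j x)"
proof (rule tpow_eqI[of _ n])
  fix w :: "int list" assume n: "length w = n"
  have kw: "ket w \<in> vcar (tpow n)" using n by auto
  have "ampl T j (ampl T k x) w = ip (ampl T j (ampl T k x)) (ket w)" by (simp add: ip_ket)
  also have "\<dots> = ip x (ampl T k (ampl T j (ket w)))"
    using ampl_sym[of "ampl T k x" n "ket w" j] ampl_sym[of x n "ampl T j (ket w)" k] x kw by simp
  also have "\<dots> = ip x (ampl T j (ampl T k (ket w)))"
    using ampl_commute_ket[of j k w] jk n by (simp only:)
  also have "\<dots> = ip (ampl T k (ampl T j x)) (ket w)"
    using ampl_sym[of "ampl T j x" n "ket w" k] ampl_sym[of x n "ampl T k (ket w)" j] x kw by simp
  finally show "ampl T j (ampl T k x) w = ampl T k (ampl T j x) w" by (simp add: ip_ket)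
qed (use x in auto)

end

section \<open>The deformed inner product\<close>

lemma linear_op_comp: "linear_op (tpow n) X \<Longrightarrow> linear_op (tpow n) Y \<Longrightarrow> linear_op (tpow n) (\<lambda>x. X (Y x))"
  by (auto simp: linear_op_def Pi_iff)

lemma linear_op_sumop:
  assumes "\<And>k. k \<in> K \<Longrightarrow> linear_op (tpow n) (X k)"
  shows "linear_op (tpow n) (\<lambda>x w. \<Sum>k\<in>K. X k x w)"
proof (rule linear_op_tpowI)
  fix x :: tvec and c assume x: "x \<in> vcar (tpow n)"
  show "(\<lambda>w. \<Sum>k\<in>K. X k x w) \<in> vcar (tpow n)"
    using linear_op_tpowD(1)[OF assms x] by (intro tpow_sum)
  show "(\<lambda>w. \<Sum>k\<in>K. X k (\<lambda>w. c * x w) w) = (\<lambda>w. c * (\<Sum>k\<in>K. X k x w))"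
    using linear_op_tpowD(3)[OF assms x] by (simp add: sum_distrib_left)
  fix y :: tvec assume y: "y \<in> vcar (tpow n)"
  show "(\<lambda>w. \<Sum>k\<in>K. X k (\<lambda>w. x w + y w) w) = (\<lambda>w. (\<Sum>k\<in>K. X k x w) + (\<Sum>k\<in>K. X k y w))"
    using linear_op_tpowD(2)[OF assms x y] by (simp add: sum.distrib)
qed

lemma linear_op_id: "linear_op (tpow n) (\<lambda>x. x)"
  by (simp add: linear_op_def)

section \<open>The q-integers [k]_q, the q-factorials [n]_q!, and bounds for them\<close>

definition qint :: "real \<Rightarrow> nat \<Rightarrow> real" where
  "qint q k = (\<Sum>i<k. q ^ i)"

definition qfact :: "real \<Rightarrow> nat \<Rightarrow> real" where
  "qfact q n = (\<Prod>j<n. qint q (Suc j))"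

text \<open>The second bound supplies the degree-independent constant of the row bound. The extreme
  values are [1]_q = 1 and, for negative q, [2]_q = 1 + q.\<close>

lemma qint_bounds:
  assumes q: "q \<ge> -1"
  shows "qint q (Suc n) \<ge> 0" "inverse (qint q (Suc n)) \<le> max 1 (inverse (1 + q))"
proof -
  have *: "qint q (Suc n) \<ge> 0 \<and> inverse (qint q (Suc n)) \<le> max 1 (inverse (1 + q))"
  proof (cases "q \<ge> 0")
    case True
    have "q ^ 0 \<le> qint q (Suc n)"
      unfolding qint_def using True by (intro member_le_sum) auto
    then have "qint q (Suc n) \<ge> 1" by simp
    moreover from this have "inverse (qint q (Suc n)) \<le> 1" by (rule inverse_le_1_iff[THEN iffD2, OF disjI2])
    ultimately show ?thesis by simp
  next
    case neg: False
    have eq: "qint q (Suc n) = (1 - q ^ Suc n) / (1 - q)"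
      unfolding qint_def lessThan_Suc_atMost using neg by (subst sum_gp0) auto
    show ?thesis
    proof (cases "q = -1")
      case True
      \<comment> \<open>At q = -1 the q-integers alternate between 1 and 0. Since
        \<open>inverse 0 = 0\<close>, the claimed bound reads max 1 0 = 1 and holds for both
        values.\<close>
      have "q ^ Suc n = 1 \<or> q ^ Suc n = -1"
        unfolding True by (simp add: minus_one_power_iff)
      then have "qint q (Suc n) = 0 \<or> qint q (Suc n) = 1"
        unfolding eq using True by (elim disjE) (simp_all only:, simp_all)
      then show ?thesis by auto
    next
      case False
      then have q': "-1 < q" "q < 0" using q neg by auto
      show ?thesis
      proof (cases n)
        case 0
        then show ?thesis by (simp add: qint_def)
      next
        case (Suc m)
        \<comment> \<open>Here the exponent is at least 2 and |q| < 1, so the power is at most q^2;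
          then (1 - q^2)/(1 - q) = 1 + q.\<close>
        have "q ^ Suc n \<le> \<bar>q\<bar> ^ Suc n" by (metis abs_ge_self power_abs)
        also have "\<dots> \<le> \<bar>q\<bar> ^ 2"
          using q' Suc by (intro power_decreasing) auto
        finally have "(1 - q ^ 2) / (1 - q) \<le> qint q (Suc n)"
          unfolding eq using q' by (intro divide_right_mono) auto
        moreover have "(1 - q ^ 2) / (1 - q) = 1 + q"
          using q' by (simp add: field_simps power2_eq_square)
        ultimately have le: "1 + q \<le> qint q (Suc n)" by simp
        then have "inverse (qint q (Suc n)) \<le> inverse (1 + q)"
          using q' by (intro le_imp_inverse_le) auto
        then have "inverse (qint q (Suc n)) \<le> max 1 (inverse (1 + q))"
          by (rule max.coboundedI2)
        then show ?thesis using le q' by linarith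
      qed
    qed
  qed
  then show "qint q (Suc n) \<ge> 0" "inverse (qint q (Suc n)) \<le> max 1 (inverse (1 + q))" by auto
qed

lemma qfact_nonneg: "q \<ge> -1 \<Longrightarrow> 0 \<le> qfact q n"
  unfolding qfact_def by (intro prod_nonneg ballI qint_bounds)

lemma qfact_Suc: "qfact q (Suc n) = qint q (Suc n) * qfact q n"
  by (simp add: qfact_def)

context hecke
begin

text \<open>The operators \<open>R\<^sup>(\<^sup>m\<^sup>)\<close> and \<open>P\<^sup>(\<^sup>m\<^sup>)\<close> acting on the tensor factors \<open>d+1, \<dots>, d+m\<close>,
  and their adjoints.\<close>

primrec tprod :: "nat \<Rightarrow> nat \<Rightarrow> tvec \<Rightarrow> tvec" where
  "tprod d 0 = (\<lambda>x. x)"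
| "tprod d (Suc k) = (\<lambda>x. tprod d k (ampl T (d + Suc k) x))"

primrec tprod_adj :: "nat \<Rightarrow> nat \<Rightarrow> tvec \<Rightarrow> tvec" where
  "tprod_adj d 0 = (\<lambda>x. x)"
| "tprod_adj d (Suc k) = (\<lambda>x. ampl T (d + Suc k) (tprod_adj d k x))"

definition Rd :: "nat \<Rightarrow> nat \<Rightarrow> tvec \<Rightarrow> tvec" where
  "Rd d m = (\<lambda>x w. \<Sum>k<m. tprod d k x w)"

definition Rd_adj :: "nat \<Rightarrow> nat \<Rightarrow> tvec \<Rightarrow> tvec" where
  "Rd_adj d m = (\<lambda>x w. \<Sum>k<m. tprod_adj d k x w)"

primrec Pd :: "nat \<Rightarrow> nat \<Rightarrow> tvec \<Rightarrow> tvec" where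
  "Pd 0 = (\<lambda>d x. x)"
| "Pd (Suc m) = (\<lambda>d x. Pd m (Suc d) (Rd d (Suc m) x))"

primrec Pd_adj :: "nat \<Rightarrow> nat \<Rightarrow> tvec \<Rightarrow> tvec" where
  "Pd_adj 0 = (\<lambda>d x. x)"
| "Pd_adj (Suc m) = (\<lambda>d x. Rd_adj d (Suc m) (Pd_adj m (Suc d) x))"

lemma tprod_linear: "linear_op (tpow n) (tprod d k)"
  by (induction k) (simp_all add: linear_op_id linear_op_comp[OF _ ampl_linear])

lemma tprod_adj_linear: "linear_op (tpow n) (tprod_adj d k)"
  by (induction k) (simp_all add: linear_op_id linear_op_comp[OF ampl_linear])

lemma Rd_linear: "linear_op (tpow n) (Rd d m)"
  unfolding Rd_def by (intro linear_op_sumop tprod_linear)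

lemma Rd_adj_linear: "linear_op (tpow n) (Rd_adj d m)"
  unfolding Rd_adj_def by (intro linear_op_sumop tprod_adj_linear)

lemma Pd_linear: "linear_op (tpow n) (Pd m d)"
  by (induction m arbitrary: d) (simp_all add: linear_op_id linear_op_comp[OF _ Rd_linear])

lemma Pd_adj_linear: "linear_op (tpow n) (Pd_adj m d)"
  by (induction m arbitrary: d) (simp_all add: linear_op_id linear_op_comp[OF Rd_adj_linear])

lemmas op_mem [simp] = linear_op_tpowD(1)[OF tprod_linear] linear_op_tpowD(1)[OF tprod_adj_linear]
  linear_op_tpowD(1)[OF Rd_linear] linear_op_tpowD(1)[OF Rd_adj_linear]
  linear_op_tpowD(1)[OF Pd_linear] linear_op_tpowD(1)[OF Pd_adj_linear]

lemma ip_tprod: "\<lbrakk>x \<in> vcar (tpow n); y \<in> vcar (tpow n)\<rbrakk> \<Longrightarrow> ip (tprod d k x) y = ip x (tprod_adj d k y)"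
  by (induction k arbitrary: x) (simp_all add: ampl_sym[where n = n])

lemma ip_Rd: "\<lbrakk>x \<in> vcar (tpow n); y \<in> vcar (tpow n)\<rbrakk> \<Longrightarrow> ip (Rd d m x) y = ip x (Rd_adj d m y)"
  unfolding Rd_def Rd_adj_def
  by (simp add: ip_sum_left[where n = n] ip_sum_right[where n = n] ip_tprod[where n = n] del: cnj_sum)

lemma ip_Pd: "\<lbrakk>x \<in> vcar (tpow n); y \<in> vcar (tpow n)\<rbrakk> \<Longrightarrow> ip (Pd m d x) y = ip x (Pd_adj m d y)"
  by (induction m arbitrary: d x) (simp_all add: ip_Rd[where n = n])

lemma cnj_ip: "cnj (ip x y) = ip y x"
  by (simp add: mult.commute flip: infsum_cnj)

section \<open>Absorption of the amplifications by P and the relation P P^* = [n]_q! P\<close>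

lemma tprod_far:
  assumes "x \<in> vcar (tpow n)" "d + j + 2 \<le> i" "i < n"
  shows "tprod d j (ampl T i x) = ampl T i (tprod d j x)"
  using assms
proof (induction j arbitrary: x)
  case (Suc j)
  have "ampl T (d + Suc j) (ampl T i x) = ampl T i (ampl T (d + Suc j) x)"
    by (rule ampl_commute[where n = n]) (use Suc.prems in auto)
  then show ?case using Suc by simp
qed simp

text \<open>The shift identity of the braid group, T_1...T_j T_k = T_{k+1} T_1...T_j for k < j.
  Factors beyond k+1 commute with T_k; the braid relation is then used once, and the resulting
  T_{k+1} commutes past T_1...T_{k-1}.\<close>

lemma tprod_braid:
  assumes "x \<in> vcar (tpow n)" "1 \<le> k" "k < j" "d + j < n"
  shows "tprod d j (ampl T (d + k) x) = ampl T (d + Suc k) (tprod d j x)"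
  using assms
proof (induction j arbitrary: x)
  case (Suc j)
  show ?case
  proof (cases "k < j")
    case True
    have "ampl T (d + Suc j) (ampl T (d + k) x) = ampl T (d + k) (ampl T (d + Suc j) x)"
      by (rule ampl_commute[symmetric, where n = n]) (use Suc.prems True in auto)
    then show ?thesis using Suc True by simp
  next
    case False
    then have j: "j = k" using Suc.prems by simp
    obtain i where i: "k = Suc i" using Suc.prems by (cases k) auto
    have "ampl T (d + k) (ampl T (Suc (d + k)) (ampl T (d + k) x))
        = ampl T (Suc (d + k)) (ampl T (d + k) (ampl T (Suc (d + k)) x))"
      by (rule ampl_braid[where n = n]) (use Suc.prems i in auto)
    moreover have "tprod d i (ampl T (Suc (d + k)) y) = ampl T (Suc (d + k)) (tprod d i y)"
      if "y \<in> vcar (tpow n)" for y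
      by (rule tprod_far[where n = n]) (use that Suc.prems i in auto)
    ultimately show ?thesis using Suc.prems by (simp add: j i)
  qed
qed simp

text \<open>The relation P T_k = q P. It is stated for every offset d because I \<otimes> P is P at
  the next offset, which is the form in which the induction hypothesis is used.\<close>

lemma Pd_ampl:
  assumes "x \<in> vcar (tpow n)" "1 \<le> k" "k < m" "d + m \<le> n"
  shows "Pd m d (ampl T (d + k) x) = (\<lambda>w. of_real q * Pd m d x w)"
  using assms
proof (induction m arbitrary: d k x)
  case (Suc m)
  note lin = linear_op_tpowD[OF Pd_linear[of n]]
  have IH: "Pd m (Suc d) (ampl T (d + Suc i) y) = (\<lambda>w. of_real q * Pd m (Suc d) y w)"
    if "y \<in> vcar (tpow n)" "1 \<le> i" "i < m" for i y
    using Suc.IH[of y i "Suc d"] that Suc.prems by simp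
  have expand: "Pd (Suc m) d y = (\<lambda>w. \<Sum>j<Suc m. Pd m (Suc d) (tprod d j y) w)"
    if "y \<in> vcar (tpow n)" for y
    using linear_op_sum[OF Pd_linear, of "{..<Suc m}" "\<lambda>j. tprod d j y" n m "Suc d"] that
    by (simp add: Rd_def)
  obtain l where l: "k = Suc l" using Suc.prems by (cases k) auto
  show ?case
  proof
    fix w
    define f where "f j = Pd m (Suc d) (tprod d j (ampl T (d + k) x)) w" for j
    define g where "g j = Pd m (Suc d) (tprod d j x) w" for j
    have "f j = of_real q * g j" if j: "j \<le> m" "j \<noteq> l" "j \<noteq> k" for j
    \<comment> \<open>For j < k - 1 the factor T_k commutes to the left and is index l for the
      shifted P; for j > k it comes out as T_{k+1}, which is index k there.\<close>
    proof (cases "j < k")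
      case True
      then have "tprod d j (ampl T (d + k) x) = ampl T (d + k) (tprod d j x)"
        using Suc.prems j l by (intro tprod_far[where n = n]) auto
      then show ?thesis
        using IH[of "tprod d j x" l] Suc.prems True j l by (simp add: f_def g_def)
    next
      case False
      then have "tprod d j (ampl T (d + k) x) = ampl T (d + Suc k) (tprod d j x)"
        using Suc.prems j by (intro tprod_braid[where n = n]) auto
      then show ?thesis
        using IH[of "tprod d j x" k] Suc.prems False j by (simp add: f_def g_def)
    qed
    then have "(\<Sum>j\<in>{..<Suc m} - {l, k}. f j) = (\<Sum>j\<in>{..<Suc m} - {l, k}. of_real q * g j)"
      by (intro sum.cong) auto
    \<comment> \<open>The two exceptional terms do not scale one by one: T_1...T_{k-1} T_k is the
      next product of the sum, and T_1...T_k T_k is reduced by the Hecke relation. Their sum is q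
      times the sum of the two originals.\<close>
    moreover have "f l = g k" by (simp add: f_def g_def l)
    moreover have "f k = of_real (q - 1) * g k + of_real q * g l"
    proof -
      have "tprod d l (ampl T (d + k) (ampl T (d + k) x))
          = (\<lambda>w. of_real (q - 1) * tprod d l (ampl T (d + k) x) w + of_real q * tprod d l x w)"
        using Suc.prems
        by (simp add: ampl_hecke[where n = n] linear_op_tpowD[OF tprod_linear[of n]] del: of_real_diff)
      then have "Pd m (Suc d) (tprod d l (ampl T (d + k) (ampl T (d + k) x)))
          = (\<lambda>w. of_real (q - 1) * Pd m (Suc d) (tprod d l (ampl T (d + k) x)) w
                + of_real q * Pd m (Suc d) (tprod d l x) w)"
        using Suc.prems by (simp add: lin del: of_real_diff)
      then show ?thesis by (simp add: f_def g_def l)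
    qed
    ultimately have "(\<Sum>j\<in>{..<Suc m} - {l, k}. f j) + (f l + f k)
        = (\<Sum>j\<in>{..<Suc m} - {l, k}. of_real q * g j) + (of_real q * g l + of_real q * g k)"
      by (simp add: algebra_simps)
    moreover have split: "sum h {..<Suc m} = sum h ({..<Suc m} - {l, k}) + (h l + h k)" for h :: "nat \<Rightarrow> complex"
    proof -
      have "sum h {..<Suc m} = sum h ({..<Suc m} - {l, k}) + sum h {l, k}"
        by (rule sum.subset_diff) (use Suc.prems l in auto)
      then show ?thesis using l by simp
    qed
    ultimately have "(\<Sum>j<Suc m. f j) = (\<Sum>j<Suc m. of_real q * g j)"
      by (simp only: split)
    then show "Pd (Suc m) d (ampl T (d + k) x) w = of_real q * Pd (Suc m) d x w"
      using Suc.prems(1) by (simp only: expand ampl_mem f_def g_def sum_distrib_left)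
  qed
qed simp

text \<open>The adjoint of P is built from products of amplifications, and A turns a product of j of
  them into q^j. Each adjoint of R contributes a q-integer, and the nested ones multiply to the
  q-factorial. A general A is used because it must stay fixed while the induction shrinks the range
  of factors.\<close>

lemma absorb_Pd_adj:
  assumes A: "linear_op (tpow n) A"
    and "\<And>k x. \<lbrakk>1 \<le> k; k < m; x \<in> vcar (tpow n)\<rbrakk> \<Longrightarrow> A (ampl T (d + k) x) = (\<lambda>w. of_real q * A x w)"
    and "x \<in> vcar (tpow n)"
  shows "A (Pd_adj m d x) = (\<lambda>w. of_real (qfact q m) * A x w)"
  using assms(2,3)
proof (induction m arbitrary: d)
  case 0
  then show ?case by (simp add: qfact_def)
next
  case (Suc m)
  let ?y = "Pd_adj m (Suc d) x"
  have y: "?y \<in> vcar (tpow n)" using Suc.prems by simp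
  note step = Suc.prems(1)
  have td: "A (tprod_adj d j ?y) = (\<lambda>w. of_real (q ^ j) * A ?y w)" if "j < Suc m" for j
    using that
  proof (induction j)
    case (Suc j)
    then show ?case
      using step[of "Suc j" "tprod_adj d j ?y"] y by (simp add: mult.assoc)
  qed simp
  have "A (Pd_adj (Suc m) d x) = (\<lambda>w. \<Sum>j<Suc m. A (tprod_adj d j ?y) w)"
    using linear_op_sum[OF A, of "{..<Suc m}" "\<lambda>j. tprod_adj d j ?y"] y by (simp add: Rd_adj_def)
  also have "\<dots> = (\<lambda>w. of_real (qint q (Suc m)) * A ?y w)"
    by (rule ext) (simp only: qint_def of_real_sum sum_distrib_right, intro sum.cong, auto simp: td)
  also have "A ?y = (\<lambda>w. of_real (qfact q m) * A x w)"
  proof (rule Suc.IH[OF _ Suc.prems(2)])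
    fix k y assume "1 \<le> k" "k < m" "y \<in> vcar (tpow n)"
    then show "A (ampl T (Suc d + k) y) = (\<lambda>w. of_real q * A y w)"
      using Suc.prems(1)[of "Suc k" y] by simp
  qed
  finally show ?case by (simp add: qfact_Suc mult.assoc)
qed

lemma Pd_Pd_adj:
  "x \<in> vcar (tpow n) \<Longrightarrow> Pd n 0 (Pd_adj n 0 x) = (\<lambda>w. of_real (qfact q n) * Pd n 0 x w)"
  by (rule absorb_Pd_adj[where n = n]) (use Pd_ampl[of _ n _ n 0] in \<open>auto intro: Pd_linear\<close>)

text \<open>This is the positivity of the deformed inner product. If \<open>qfact q n = 0\<close> then \<open>P\<^sup>(\<^sup>n\<^sup>)\<close>
  vanishes, in accordance with \<open>inverse 0 = 0\<close>.\<close>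

lemma ip_Pd_eq:
  assumes x: "x \<in> vcar (tpow n)" and y: "y \<in> vcar (tpow n)"
  shows "ip x (Pd n 0 y) = of_real (inverse (qfact q n)) * ip (Pd_adj n 0 x) (Pd_adj n 0 y)"
proof -
  have right: "ip x (Pd n 0 z) = ip (Pd_adj n 0 x) z" if "x \<in> vcar (tpow n)" "z \<in> vcar (tpow n)" for x z
    using ip_Pd[of z n x n 0] that cnj_ip by metis
  have PD: "ip x (Pd n 0 (Pd_adj n 0 z)) = of_real (qfact q n) * ip x (Pd n 0 z)" if "z \<in> vcar (tpow n)" for x z
    unfolding Pd_Pd_adj[OF that] by (subst infsum_cmult_right'[symmetric]) (intro infsum_cong, simp)
  show ?thesis
  proof (cases "qfact q n = 0")
    case True
    \<comment> \<open>This inner product equals that of x with P applied to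
      \<open>Pd_adj n 0 x\<close>, which is [n]_q! times that of x with P x, hence zero.\<close>
    have "ip (Pd_adj n 0 x) (Pd_adj n 0 x) = 0"
      using right[OF x, of "Pd_adj n 0 x"] PD[OF x] x True by simp
    then have "Pd_adj n 0 x = (\<lambda>_. 0)"
      using tpow_definite[of "Pd_adj n 0 x" n] x by (simp add: tpow_inner)
    then show ?thesis using right[OF x y] by simp
  next
    case False
    then show ?thesis
      using right[OF x, of "Pd_adj n 0 y"] PD[OF y, of x] y by (simp add: field_simps)
  qed
qed

lemma ampl_prod_eq: "ampl_prod T k = tprod 0 k"
  by (induction k) auto

lemma Rop_eq: "Rop T n = Rd 0 n"
  by (simp add: fun_eq_iff Rop_def Rd_def ampl_prod_eq)

lemma strip_ampl: "1 \<le> k \<Longrightarrow> strip i (ampl T (Suc k) x) = ampl T k (strip i x)"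
  by (cases k) (auto simp: strip_def ampl_def fun_eq_iff cong: if_cong)

lemma strip_tprod: "strip i (tprod (Suc d) k x) = tprod d k (strip i x)"
  by (induction k arbitrary: x) (simp_all add: strip_ampl)

lemma strip_tprod_adj: "strip i (tprod_adj (Suc d) k x) = tprod_adj d k (strip i x)"
  by (induction k arbitrary: x) (simp_all add: strip_ampl)

lemma strip_Rd: "strip i (Rd (Suc d) m x) = Rd d m (strip i x)"
  unfolding Rd_def strip_tprod[symmetric] by (simp add: strip_def)

lemma strip_Rd_adj: "strip i (Rd_adj (Suc d) m x) = Rd_adj d m (strip i x)"
  unfolding Rd_adj_def strip_tprod_adj[symmetric] by (simp add: strip_def)

lemma strip_Pd: "strip i (Pd m (Suc d) x) = Pd m d (strip i x)"
  by (induction m arbitrary: d x) (simp_all add: strip_Rd)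

lemma strip_Pd_adj: "strip i (Pd_adj m (Suc d) x) = Pd_adj m d (strip i x)"
  by (induction m arbitrary: d x) (simp_all add: strip_Rd_adj)

lemma strip_eqI:
  assumes "x \<in> vcar (tpow (Suc n))" "y \<in> vcar (tpow (Suc n))" "\<And>i. strip i x = strip i y"
  shows "x = y"
  using assms(1,2)
proof (rule tpow_eqI)
  fix w :: "int list" assume "length w = Suc n"
  then obtain i u where "w = i # u" by (auto simp: length_Suc_conv)
  then show "x w = y w" using fun_cong[OF assms(3)[of i], of u] by (simp add: strip_def)
qed

text \<open>The hypothesis on \<open>strip\<close> says that Y is I \<otimes> X; this evaluates it
  on an elementary tensor.\<close>

lemma tens_intertwine:
  assumes X: "linear_op (tpow n) X" and Y: "linear_op (tpow (Suc n)) Y"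
    and eq: "\<And>i z. strip i (Y z) = X (strip i z)" and x: "x \<in> vcar (tpow n)"
  shows "Y (tens (ket j) x) = tens (ket j) (X x)"
  by (rule strip_eqI[of _ n])
    (use x in \<open>auto simp: eq strip_tens linear_op_zero[OF X] linear_op_tpowD[OF X] linear_op_tpowD[OF Y] tens_mem\<close>)

text \<open>Identifies \<open>id_tens\<close> in the definition of P with raising the offset by one,
  since stripping the first letter lowers the offset again.\<close>

lemma Pop_eq: "x \<in> vcar (tpow n) \<Longrightarrow> Pop T n x = Pd n 0 x"
proof (induction n arbitrary: x)
  case (Suc n)
  show ?case
  proof (cases n)
    case 0
    then show ?thesis by (simp add: Rd_def)
  next
    case (Suc m)
    define y where "y = Rd 0 (Suc n) x"
    have y: "y \<in> vcar (tpow (Suc n))" using Suc.prems by (simp add: y_def)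
    have "Pop T (Suc n) x = id_tens (Pop T n) y"
      by (simp add: Suc Rop_eq y_def)
    also have "\<dots> = Pd n (Suc 0) y"
    proof
      fix w
      show "id_tens (Pop T n) y w = Pd n (Suc 0) y w"
      proof (cases w)
        case Nil
        then show ?thesis using y tpow_vanish[of "Pd n (Suc 0) y" "Suc n"] by (simp add: id_tens_def)
      next
        case (Cons i u)
        have "id_tens (Pop T n) y w = Pop T n (strip i y) u"
          by (simp add: Cons id_tens_def strip_def)
        also have "\<dots> = strip i (Pd n (Suc 0) y) u"
          using Suc.IH[OF strip_mem[OF y]] by (simp add: strip_Pd)
        finally show ?thesis by (simp add: Cons strip_def)
      qed
    qed
    finally show ?thesis by (simp add: y_def)
  qed
qed simp

subsection \<open>The pre-Fock spaces\<close>

lemma pre_fock_simps [simp]: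
  "vcar (pre_fock T n) = vcar (tpow n)" "vzero (pre_fock T n) = (\<lambda>_. 0)"
  "vadd (pre_fock T n) x y = (\<lambda>w. x w + y w)" "vscale (pre_fock T n) c x = (\<lambda>w. c * x w)"
  by (simp_all add: pre_fock_def tpow_def)

lemma pre_fock_diff: "vdiff (pre_fock T n) x y = (\<lambda>w. x w - y w)"
  by (simp add: vdiff_def)

lemma inner_pre_fock: "y \<in> vcar (tpow n) \<Longrightarrow> vinner (pre_fock T n) x y = ip x (Pd n 0 y)"
  by (simp add: pre_fock_def tpow_inner Pop_eq)

lemma inner_pre_fock_eq: "\<lbrakk>x \<in> vcar (tpow n); y \<in> vcar (tpow n)\<rbrakk> \<Longrightarrow>
    vinner (pre_fock T n) x y = of_real (inverse (qfact q n)) * vinner (tpow n) (Pd_adj n 0 x) (Pd_adj n 0 y)"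
  by (simp add: inner_pre_fock ip_Pd_eq tpow_inner)

text \<open>Linearity is taken from \<langle>x, P y\<rangle>; Hermitian symmetry and positivity from
  the symmetric form \<langle>P^* x, P^* y\<rangle> / [n]_q!.\<close>

lemma cip_pre_fock: "cip (pre_fock T n)"
proof
  fix x y assume x: "x \<in> vcar (pre_fock T n)" and y: "y \<in> vcar (pre_fock T n)"
  then have xy: "x \<in> vcar (tpow n)" "y \<in> vcar (tpow n)" by simp_all
  show "cnj (vinner (pre_fock T n) x y) = vinner (pre_fock T n) y x"
    using xy tpow.cnj_inner[of "Pd_adj n 0 x" n "Pd_adj n 0 y"] by (simp add: inner_pre_fock_eq)
  fix z assume "z \<in> vcar (pre_fock T n)"
  then show "vinner (pre_fock T n) (vadd (pre_fock T n) x y) z = vinner (pre_fock T n) x z + vinner (pre_fock T n) y z"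
    using xy tpow.inner_add_left[of x n y "Pd n 0 z"] by (simp add: inner_pre_fock tpow_inner)
next
  fix c x assume "x \<in> vcar (pre_fock T n)"
  then have x: "x \<in> vcar (tpow n)" by simp
  show "vinner (pre_fock T n) (vzero (pre_fock T n)) x = 0"
    using x by (simp add: inner_pre_fock)
  show "0 \<le> Re (vinner (pre_fock T n) x x)"
    using x qfact_nonneg[OF q, of n] tpow.inner_nonneg[of "Pd_adj n 0 x" n]
    by (simp add: inner_pre_fock_eq)
  fix z assume "z \<in> vcar (pre_fock T n)"
  then show "vinner (pre_fock T n) (vscale (pre_fock T n) c x) z = c * vinner (pre_fock T n) x z"
    using x tpow.inner_scale_left[of x n "Pd n 0 z" c] by (simp add: inner_pre_fock tpow_inner)
qed auto

sublocale pre: cip "pre_fock T n" for n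
  by (rule cip_pre_fock)

lemma norm_pre_fock_sq: "x \<in> vcar (tpow n) \<Longrightarrow>
    (vnorm (pre_fock T n) x)\<^sup>2 = inverse (qfact q n) * (vnorm (tpow n) (Pd_adj n 0 x))\<^sup>2"
  by (simp add: pre.norm_sq tpow.norm_sq inner_pre_fock_eq del: of_real_inverse)

text \<open>The annihilator of e_i before completion. Since P on n+1 factors is (I \<otimes> P) R,
  contraction with e_i after R is the adjoint of \<open>tens (ket i)\<close> for the deformed
  products, as recorded in \<open>inner_tens_ann\<close>.\<close>

definition ann :: "int \<Rightarrow> nat \<Rightarrow> tvec \<Rightarrow> tvec" where
  "ann i n x = strip i (Rd 0 (Suc n) x)"

lemma ann_mem [simp]: "x \<in> vcar (tpow (Suc n)) \<Longrightarrow> ann i n x \<in> vcar (tpow n)"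
  by (simp add: ann_def strip_mem)

lemma inner_tens_ann:
  assumes x: "x \<in> vcar (tpow n)" and y: "y \<in> vcar (tpow (Suc n))"
  shows "vinner (pre_fock T (Suc n)) (tens (ket i) x) y = vinner (pre_fock T n) x (ann i n y)"
  using x y by (simp add: inner_pre_fock ann_def strip_mem ip_tens strip_Pd)

text \<open>Pythagoras: tensors with different first letters are orthogonal in the undeformed
  product.\<close>

lemma inner_tens_sum:
  assumes "finite K" "\<And>k. k \<in> K \<Longrightarrow> \<xi> k \<in> vcar (tpow n)"
  shows "vinner (tpow (Suc n)) (\<lambda>w. \<Sum>k\<in>K. tens (ket k) (\<xi> k) w) (\<lambda>w. \<Sum>k\<in>K. tens (ket k) (\<xi> k) w)
    = (\<Sum>k\<in>K. vinner (tpow n) (\<xi> k) (\<xi> k))"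
proof -
  have "strip k (\<lambda>w. \<Sum>k\<in>K. tens (ket k) (\<xi> k) w) = \<xi> k" if "k \<in> K" for k
  proof
    fix w
    have "strip k (\<lambda>w. \<Sum>k\<in>K. tens (ket k) (\<xi> k) w) w = (\<Sum>l\<in>K. if l = k then \<xi> l w else 0)"
      unfolding strip_def by (intro sum.cong) (auto simp: tens_def ket_apply)
    then show "strip k (\<lambda>w. \<Sum>k\<in>K. tens (ket k) (\<xi> k) w) w = \<xi> k w"
      using assms that by simp
  qed
  then show ?thesis
    using assms by (simp add: tpow_inner ip_sum_left[where n = "Suc n"] tens_mem tpow_sum ip_tens del: cnj_sum)
qed

end

section \<open>The row bound on the pre-Fock spaces\<close>

locale bounded_hecke = hecke +
  assumes MT_finite: "MT T < \<infinity>"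
begin

definition M :: real where
  "M = enn2real (MT T)"

lemma M_nonneg: "0 \<le> M"
  by (simp add: M_def)

lemma Rd_bound:
  assumes x: "x \<in> vcar (tpow (Suc n))"
  shows "vnorm (tpow (Suc n)) (Rd 0 (Suc n) x) \<le> M * vnorm (tpow (Suc n)) x"
proof -
  have le: "opnorm (tpow (Suc n)) (Rd 0 (Suc n)) \<le> MT T"
    unfolding MT_def Rop_eq[symmetric] by (rule SUP_upper) simp
  then have "vnorm (tpow (Suc n)) (Rd 0 (Suc n) x)
      \<le> enn2real (opnorm (tpow (Suc n)) (Rd 0 (Suc n))) * vnorm (tpow (Suc n)) x"
    using MT_finite by (intro tpow.vnorm_le_opnorm Rd_linear x) (auto intro: le_less_trans)
  also have "\<dots> \<le> M * vnorm (tpow (Suc n)) x"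
    unfolding M_def using le MT_finite x by (intro mult_right_mono enn2real_mono) auto
  finally show ?thesis .
qed

lemma Rd_adj_bound:
  assumes x: "x \<in> vcar (tpow (Suc n))"
  shows "vnorm (tpow (Suc n)) (Rd_adj 0 (Suc n) x) \<le> M * vnorm (tpow (Suc n)) x"
proof (rule tpow.adjoint_norm_le[where y = "Rd 0 (Suc n) (Rd_adj 0 (Suc n) x)"])
  show "vinner (tpow (Suc n)) (Rd_adj 0 (Suc n) x) (Rd_adj 0 (Suc n) x)
      = vinner (tpow (Suc n)) (Rd 0 (Suc n) (Rd_adj 0 (Suc n) x)) x"
    using x by (simp add: tpow_inner ip_Rd[where n = "Suc n"])
qed (use x in \<open>simp_all add: Rd_bound M_nonneg\<close>)

text \<open>\<open>M\<^sup>2\<close> bounds R R^*, and the second factor bounds 1/[n+1]_q for every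
  n.\<close>

definition row_const :: real where
  "row_const = M\<^sup>2 * max 1 (inverse (1 + q))"

lemma row_const_nonneg: "0 \<le> row_const"
  by (simp add: row_const_def)

text \<open>Since \<open>[n+1]\<^sub>q P\<^sup>(\<^sup>n\<^sup>+\<^sup>1\<^sup>) = (I \<otimes> P\<^sup>(\<^sup>n\<^sup>)) R R\<^sup>* (I \<otimes> P\<^sup>(\<^sup>n\<^sup>)) / [n]\<^sub>q!\<close>, the form of \<open>P\<^sup>(\<^sup>n\<^sup>+\<^sup>1\<^sup>)\<close> is
  dominated by that of \<open>I \<otimes> P\<^sup>(\<^sup>n\<^sup>)\<close>.\<close>

lemma row_bound_vec:
  assumes K: "finite K" and \<xi>: "\<And>k. k \<in> K \<Longrightarrow> \<xi> k \<in> vcar (tpow n)"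
  shows "(vnorm (pre_fock T (Suc n)) (\<lambda>w. \<Sum>k\<in>K. tens (ket k) (\<xi> k) w))\<^sup>2
    \<le> row_const * (\<Sum>k\<in>K. (vnorm (pre_fock T n) (\<xi> k))\<^sup>2)"
proof -
  let ?x = "\<lambda>w. \<Sum>k\<in>K. tens (ket k) (\<xi> k) w"
  let ?y = "Pd_adj n (Suc 0) ?x"
  have x: "?x \<in> vcar (tpow (Suc n))" using \<xi> by (intro tpow_sum tens_mem)
  have y: "?y = (\<lambda>w. \<Sum>k\<in>K. tens (ket k) (Pd_adj n 0 (\<xi> k)) w)"
    using \<xi> tens_intertwine[OF Pd_adj_linear[of n n 0] Pd_adj_linear[of "Suc n" n "Suc 0"] strip_Pd_adj]
    by (simp add: linear_op_sum[OF Pd_adj_linear[of "Suc n"]] tens_mem)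
  have ny: "(vnorm (tpow (Suc n)) ?y)\<^sup>2 = (\<Sum>k\<in>K. (vnorm (tpow n) (Pd_adj n 0 (\<xi> k)))\<^sup>2)"
    using \<xi> inner_tens_sum[OF K, of "\<lambda>k. Pd_adj n 0 (\<xi> k)" n]
    by (simp add: tpow.norm_sq y tpow_sum tens_mem)
  \<comment> \<open>\<open>Pd_adj (Suc n) 0\<close> is the adjoint of R applied after
    \<open>Pd_adj n (Suc 0)\<close>, and the latter acts on the tensors behind the first
    letter.\<close>
  have "(vnorm (pre_fock T (Suc n)) ?x)\<^sup>2 = inverse (qfact q (Suc n)) * (vnorm (tpow (Suc n)) (Rd_adj 0 (Suc n) ?y))\<^sup>2"
    using norm_pre_fock_sq[OF x] by simp
  also have "\<dots> \<le> inverse (qfact q (Suc n)) * (M * vnorm (tpow (Suc n)) ?y)\<^sup>2"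
    using x qfact_nonneg[OF q] by (intro mult_left_mono power_mono Rd_adj_bound tpow.norm_nonneg) auto
  \<comment> \<open>Of 1/[n+1]_q!, the part 1/[n]_q! turns the undeformed norms of the
    \<open>Pd_adj n 0 (\<xi> k)\<close> back into deformed norms of the \<xi> k; only 1/[n+1]_q
    remains.\<close>
  also have "\<dots> = inverse (qint q (Suc n)) * M\<^sup>2 * (\<Sum>k\<in>K. (vnorm (pre_fock T n) (\<xi> k))\<^sup>2)"
    using \<xi> by (simp add: qfact_Suc power_mult_distrib ny norm_pre_fock_sq sum_distrib_left mult_ac)
  also have "\<dots> \<le> row_const * (\<Sum>k\<in>K. (vnorm (pre_fock T n) (\<xi> k))\<^sup>2)"
    unfolding row_const_def using mult_right_mono[OF qint_bounds(2)[OF q, of n], of "M\<^sup>2"]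
    by (intro mult_right_mono) (auto simp: sum_nonneg mult_ac)
  finally show ?thesis .
qed

text \<open>The left side is expanded into separate inner products because these are the quantities
  that converge along representatives in the completion and that are summed over the degrees of the
  Fock space.\<close>

lemma row_bound_pre:
  assumes K: "finite K" and \<xi>: "\<And>k. k \<in> K \<Longrightarrow> \<xi> k \<in> vcar (tpow n)"
  shows "Re (\<Sum>k\<in>K. \<Sum>l\<in>K. vinner (pre_fock T (Suc n)) (tens (ket k) (\<xi> k)) (tens (ket l) (\<xi> l)))
    \<le> row_const * (\<Sum>k\<in>K. Re (vinner (pre_fock T n) (\<xi> k) (\<xi> k)))"
proof -
  let ?x = "\<lambda>w. \<Sum>k\<in>K. tens (ket k) (\<xi> k) w"
  have x: "?x \<in> vcar (tpow (Suc n))" using \<xi> by (intro tpow_sum tens_mem)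
  have "vinner (pre_fock T (Suc n)) ?x ?x = (\<Sum>k\<in>K. ip (tens (ket k) (\<xi> k)) (Pd (Suc n) 0 ?x))"
    unfolding inner_pre_fock[OF x] using \<xi> x
    by (intro ip_sum_left[where n = "Suc n"] tens_mem op_mem)
  also have "\<dots> = (\<Sum>k\<in>K. \<Sum>l\<in>K. vinner (pre_fock T (Suc n)) (tens (ket k) (\<xi> k)) (tens (ket l) (\<xi> l)))"
    using \<xi> by (intro sum.cong refl)
      (simp add: linear_op_sum[OF Pd_linear[of "Suc n"]] ip_sum_right[where n = "Suc n"] tens_mem
        inner_pre_fock del: Pd.simps cnj_sum)
  finally have "Re (\<Sum>k\<in>K. \<Sum>l\<in>K. vinner (pre_fock T (Suc n)) (tens (ket k) (\<xi> k)) (tens (ket l) (\<xi> l)))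
      = (vnorm (pre_fock T (Suc n)) ?x)\<^sup>2"
    using x by (simp add: pre.norm_sq)
  also have "\<dots> \<le> row_const * (\<Sum>k\<in>K. (vnorm (pre_fock T n) (\<xi> k))\<^sup>2)"
    by (rule row_bound_vec[OF K \<xi>])
  finally show ?thesis using \<xi> by (simp add: pre.norm_sq)
qed

end


subsection \<open>The commutation rule on the pre-Fock spaces\<close>

context hecke
begin

lemma tprod_Suc_left: "tprod d (Suc k) x = ampl T (Suc d) (tprod (Suc d) k x)"
proof (induction k arbitrary: x)
  case (Suc k)
  have "tprod d (Suc (Suc k)) x = tprod d (Suc k) (ampl T (d + Suc (Suc k)) x)" by simp
  also have "\<dots> = ampl T (Suc d) (tprod (Suc d) k (ampl T (d + Suc (Suc k)) x))" by (rule Suc)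
  finally show ?case by simp
qed simp

text \<open>T_1 is a common left factor of every term of R but the first, so R on n+1 factors is I +
  T_1 (I \<otimes> R).\<close>

lemma Rd_tens:
  assumes x: "x \<in> vcar (tpow n)"
  shows "Rd 0 (Suc n) (tens (ket j) x) = (\<lambda>w. tens (ket j) x w + ampl T 1 (tens (ket j) (Rd 0 n x)) w)"
proof
  fix w
  have t: "tprod 1 k (tens (ket j) x) = tens (ket j) (tprod 0 k x)" for k
    using tens_intertwine[OF tprod_linear[of n 0 k] tprod_linear[of "Suc n" "Suc 0" k] strip_tprod x] by simp
  have R: "tens (ket j) (Rd 0 n x) = (\<lambda>w. \<Sum>k<n. tprod 1 k (tens (ket j) x) w)"
    unfolding t by (auto simp: fun_eq_iff Rd_def tens_def sum_distrib_left split: list.split)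
  have "Rd 0 (Suc n) (tens (ket j) x) w = tens (ket j) x w + (\<Sum>k<n. tprod 0 (Suc k) (tens (ket j) x) w)"
    unfolding Rd_def by (subst sum.lessThan_Suc_shift) simp
  also have "(\<Sum>k<n. tprod 0 (Suc k) (tens (ket j) x) w) = ampl T 1 (tens (ket j) (Rd 0 n x)) w"
    unfolding R tprod_Suc_left using x
    by (subst linear_op_sum[OF ampl_linear[of "Suc n"]]) (simp_all add: tens_mem)
  finally show "Rd 0 (Suc n) (tens (ket j) x) w = tens (ket j) x w + ampl T 1 (tens (ket j) (Rd 0 n x)) w" .
qed

lemma T_matrix_hermitian:
  assumes "length u = 2" "length v = 2"
  shows "cnj (T (ket u) v) = T (ket v) u"
proof -
  have "cnj (T (ket u) v) = cnj (ip (T (ket u)) (ket v))" by (simp only: ip_ket)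
  also have "\<dots> = cnj (ip (ket u) (T (ket v)))"
    by (subst T_sym) (auto intro: ket_mem' assms)
  also have "\<dots> = T (ket v) u" by (simp only: cnj_ip ip_ket)
  finally show ?thesis .
qed

text \<open>The slice is e_j \<otimes> v with v possibly of infinite support. Instead of expanding v
  under \<open>T\<close>, symmetry moves \<open>T\<close> onto the basis vector e_i \<otimes> e_k,
  and the infinite sum over l is then the inner product itself.\<close>

lemma ampl_one_tens:
  assumes y: "y \<in> vcar (tpow n)"
  shows "ampl T 1 (tens (ket j) y) (i # k # w) = (\<Sum>\<^sub>\<infinity>l. y (l # w) * tmat T j l i k)"
proof -
  let ?X = "slice [] w 2 (tens (ket j) y)"
  have X: "?X \<in> vcar (tpow 2)" by (rule slice_mem[OF tens_mem[OF y]])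
  have "ampl T 1 (tens (ket j) y) ([] @ [i, k] @ w) = T ?X [i, k]"
    by (rule ampl_append) auto
  also have "\<dots> = ip (T ?X) (ket [i, k])" by (simp only: ip_ket)
  also have "\<dots> = ip ?X (T (ket [i, k]))"
    by (rule T_sym[OF X]) (auto intro: ket_mem')
  also have "\<dots> = infsum (\<lambda>v. ?X v * cnj (T (ket [i, k]) v)) (range (\<lambda>l. [j, l]))"
  proof (rule infsum_cong_neutral)
    fix v :: "int list" assume "v \<in> UNIV - range (\<lambda>l. [j, l])"
    then have "?X v = 0"
      by (auto simp: slice_def tens_def ket_apply length_Suc_conv numeral_2_eq_2)
    then show "?X v * cnj (T (ket [i, k]) v) = 0" by simp
  qed auto
  also have "\<dots> = (\<Sum>\<^sub>\<infinity>l. y (l # w) * tmat T j l i k)"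
    by (subst infsum_reindex) (auto simp: inj_on_def o_def slice_def tens_def ket_apply tmat_def T_matrix_hermitian)
  finally show ?thesis by simp
qed

text \<open>The commutation rule before completion. In R = I + T_1 (I \<otimes> R) the identity
  gives the Kronecker term; expanding T_1 in matrix entries gives the other one, because contraction
  of R x with e_l is the annihilator of e_l. Degree 0 is separate, as there is nothing left to
  annihilate.\<close>

lemma ann_tens:
  assumes x: "x \<in> vcar (tpow (Suc n))" and fin: "finite {(k, l). tmat T j l i k \<noteq> 0}"
  shows "ann i (Suc n) (tens (ket j) x) = (\<lambda>w. (if i = j then 1 else 0) * x w
    + (\<Sum>(k, l)\<in>{(k, l). tmat T j l i k \<noteq> 0}. tmat T j l i k * tens (ket k) (ann l n x) w))"
    (is "_ = (\<lambda>w. _ + (\<Sum>(k, l)\<in>?F. _ k l w))")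
proof
  fix w
  define y where "y = Rd 0 (Suc n) x"
  have y: "y \<in> vcar (tpow (Suc n))" using x by (simp add: y_def)
  have "strip i (ampl T 1 (tens (ket j) y)) w = (\<Sum>(k, l)\<in>?F. tmat T j l i k * tens (ket k) (strip l y) w)"
  proof (cases w)
    case Nil
    have "ampl T 1 (tens (ket j) y) [i] = 0"
      by (rule ampl_vanish[OF tens_mem[OF y]]) simp
    then show ?thesis by (simp add: Nil strip_def tens_def)
  next
    case (Cons a u)
    \<comment> \<open>With the first letter a fixed, only the pairs (a, l) in the finite support
      contribute, so the infinite sum over l is finite.\<close>
    define L where "L = {l. tmat T j l i a \<noteq> 0}"
    have L: "finite L" "Pair a ` L \<subseteq> ?F"
      using finite_subset[of "Pair a ` L" ?F] fin by (auto simp: L_def finite_image_iff inj_on_def)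
    have "strip i (ampl T 1 (tens (ket j) y)) w = (\<Sum>\<^sub>\<infinity>l. y (l # u) * tmat T j l i a)"
      by (simp add: Cons strip_def ampl_one_tens[OF y, simplified])
    also have "\<dots> = infsum (\<lambda>l. y (l # u) * tmat T j l i a) L"
      by (rule infsum_cong_neutral) (auto simp: L_def)
    also have "\<dots> = (\<Sum>l\<in>L. y (l # u) * tmat T j l i a)"
      using L by simp
    also have "\<dots> = (\<Sum>(k, l)\<in>Pair a ` L. tmat T j l i k * tens (ket k) (strip l y) w)"
      by (subst sum.reindex) (auto simp: inj_on_def tens_def strip_def ket_apply Cons mult.commute)
    also have "\<dots> = (\<Sum>(k, l)\<in>?F. tmat T j l i k * tens (ket k) (strip l y) w)"
      by (rule sum.mono_neutral_left[OF fin L(2)]) (auto simp: tens_def Cons ket_apply L_def image_iff)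
    finally show ?thesis .
  qed
  moreover have "ann i (Suc n) (tens (ket j) x) w
      = strip i (tens (ket j) x) w + strip i (ampl T 1 (tens (ket j) y)) w"
    by (simp add: ann_def Rd_tens[OF x] y_def strip_def)
  ultimately show "ann i (Suc n) (tens (ket j) x) w = (if i = j then 1 else 0) * x w
      + (\<Sum>(k, l)\<in>?F. tmat T j l i k * tens (ket k) (ann l n x) w)"
    by (simp add: strip_tens ann_def y_def)
qed

lemma ann_tens_0:
  assumes x: "x \<in> vcar (tpow 0)"
  shows "ann i 0 (tens (ket j) x) = (\<lambda>w. (if i = j then 1 else 0) * x w)"
  by (auto simp: ann_def Rd_def strip_tens)

text \<open>The rule in weak form, with the left annihilator and the right creators moved to the
  other side as adjoints. On the Fock space the annihilators are only given as adjoints, and there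
  this is the form that can be checked.\<close>

lemma wick_pre_fock:
  assumes x: "x \<in> vcar (tpow (Suc n))" and y: "y \<in> vcar (tpow (Suc n))"
    and fin: "finite {(k, l). tmat T j l i k \<noteq> 0}"
  shows "vinner (pre_fock T (Suc (Suc n))) (tens (ket j) x) (tens (ket i) y)
    = (if i = j then 1 else 0) * vinner (pre_fock T (Suc n)) x y
    + (\<Sum>(k, l)\<in>{(k, l). tmat T j l i k \<noteq> 0}. tmat T j l i k * vinner (pre_fock T n) (ann l n x) (ann k n y))"
    (is "_ = _ + (\<Sum>(k, l)\<in>?F. _ k l)")
proof -
  have tm: "tens (ket k) (ann l n x) \<in> vcar (tpow (Suc n))" for k l
    using x by (simp add: tens_mem)
  have 1: "(\<lambda>w. (if i = j then 1 else 0) * x w) \<in> vcar (tpow (Suc n))" using x by simp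
  have 2: "(\<lambda>w. \<Sum>z\<in>?F. tmat T j (snd z) i (fst z) * tens (ket (fst z)) (ann (snd z) n x) w) \<in> vcar (tpow (Suc n))"
    by (intro tpow_sum tpow_scale tm)
  have Py: "Pd (Suc n) 0 y \<in> vcar (tpow (Suc n))" using y by simp
  have "vinner (pre_fock T (Suc (Suc n))) (tens (ket j) x) (tens (ket i) y)
      = cnj (vinner (pre_fock T (Suc (Suc n))) (tens (ket i) y) (tens (ket j) x))"
    using x y by (simp add: pre.cnj_inner tens_mem)
  also have "\<dots> = cnj (vinner (pre_fock T (Suc n)) y (ann i (Suc n) (tens (ket j) x)))"
    using x y by (simp add: inner_tens_ann tens_mem)
  also have "\<dots> = vinner (pre_fock T (Suc n)) (ann i (Suc n) (tens (ket j) x)) y"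
    using x y by (simp add: pre.cnj_inner tens_mem)
  also have "\<dots> = ip (\<lambda>w. (if i = j then 1 else 0) * x w
      + (\<Sum>z\<in>?F. tmat T j (snd z) i (fst z) * tens (ket (fst z)) (ann (snd z) n x) w)) (Pd (Suc n) 0 y)"
    using y by (simp only: inner_pre_fock ann_tens[OF x fin] case_prod_unfold)
  also have "\<dots> = ip (\<lambda>w. (if i = j then 1 else 0) * x w) (Pd (Suc n) 0 y)
      + ip (\<lambda>w. \<Sum>z\<in>?F. tmat T j (snd z) i (fst z) * tens (ket (fst z)) (ann (snd z) n x) w) (Pd (Suc n) 0 y)"
    using tpow.inner_add_left[OF 1 2 Py] by (simp only: tpow_inner tpow_simps)
  also have "ip (\<lambda>w. (if i = j then 1 else 0) * x w) (Pd (Suc n) 0 y) = (if i = j then 1 else 0) * vinner (pre_fock T (Suc n)) x y"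
    using y by (simp add: inner_pre_fock mult.assoc infsum_cmult_right' del: Pd.simps)
  also have "ip (\<lambda>w. \<Sum>z\<in>?F. tmat T j (snd z) i (fst z) * tens (ket (fst z)) (ann (snd z) n x) w) (Pd (Suc n) 0 y)
      = (\<Sum>z\<in>?F. ip (\<lambda>w. tmat T j (snd z) i (fst z) * tens (ket (fst z)) (ann (snd z) n x) w) (Pd (Suc n) 0 y))"
    by (intro ip_sum_left[where n = "Suc n"] tpow_scale tm Py)
  also have "\<dots> = (\<Sum>(k, l)\<in>?F. tmat T j l i k * vinner (pre_fock T n) (ann l n x) (ann k n y))"
  proof (intro sum.cong refl, clarify)
    fix k l
    have "vinner (pre_fock T n) (ann l n x) (ann k n y) = vinner (pre_fock T (Suc n)) (tens (ket k) (ann l n x)) y"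
      using x y by (simp add: inner_tens_ann)
    then show "ip (\<lambda>w. tmat T j (snd (k, l)) i (fst (k, l)) * tens (ket (fst (k, l))) (ann (snd (k, l)) n x) w) (Pd (Suc n) 0 y)
        = tmat T j l i k * vinner (pre_fock T n) (ann l n x) (ann k n y)"
      using y by (simp add: inner_pre_fock[of y] mult.assoc infsum_cmult_right' del: Pd.simps)
  qed
  finally show ?thesis .
qed

lemma wick_pre_fock_0:
  assumes x: "x \<in> vcar (tpow 0)" and y: "y \<in> vcar (tpow 0)"
  shows "vinner (pre_fock T (Suc 0)) (tens (ket j) x) (tens (ket i) y) = (if i = j then 1 else 0) * vinner (pre_fock T 0) x y"
proof -
  have "vinner (pre_fock T (Suc 0)) (tens (ket j) x) (tens (ket i) y)
      = vinner (pre_fock T 0) x (ann j 0 (tens (ket i) y))"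
    using x y by (intro inner_tens_ann tens_mem)
  then show ?thesis
    using x y by (simp add: ann_tens_0 inner_pre_fock)
qed

end

subsection \<open>The shift on the pre-Fock spaces\<close>

text \<open>The c-th power of \<open>shift\<close>; c = 1 and c = -1 give the tensor powers of U and
  of its inverse.\<close>

definition translate :: "int \<Rightarrow> tvec \<Rightarrow> tvec" where
  "translate c \<xi> = (\<lambda>w. \<xi> (map (\<lambda>i. i - c) w))"

lemma shift_eq: "shift = translate 1"
  by (simp add: fun_eq_iff shift_def translate_def)

lemma translate_translate: "translate c (translate d x) = translate (c + d) x"
  by (simp add: translate_def o_def algebra_simps)

lemma translate_0 [simp]: "translate 0 x = x"
  by (simp add: translate_def)

lemma bij_map_translate: "bij_betw (map (\<lambda>i. i - c :: int)) UNIV UNIV"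
  by (rule bij_betwI[where g = "map (\<lambda>i. i + c)"]) (auto simp: o_def)

lemma translate_mem [simp]:
  assumes x: "x \<in> vcar (tpow n)"
  shows "translate c x \<in> vcar (tpow n)"
  using tpow_summable[OF x] tpow_vanish[OF x]
    summable_on_reindex_bij_betw[OF bij_map_translate, of "\<lambda>w. (cmod (x w))\<^sup>2" c]
  by (simp add: tpow_mem translate_def)

lemma ip_translate: "ip (translate c x) (translate c y) = ip x y"
  using infsum_reindex_bij_betw[OF bij_map_translate, of "\<lambda>w. x w * cnj (y w)" c]
  by (simp add: translate_def)

lemma translate_tens: "translate c (tens (ket i) x) = tens (ket (i + c)) (translate c x)"
  by (auto simp: fun_eq_iff translate_def tens_def ket_apply split: list.split)

locale shift_hecke = hecke +
  assumes T_shift: "\<xi> \<in> vcar (tpow 2) \<Longrightarrow> T (shift \<xi>) = shift (T \<xi>)"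
begin

lemma ampl_shift:
  assumes x: "x \<in> vcar (tpow n)"
  shows "ampl T k (shift x) = shift (ampl T k x)"
proof
  fix w
  have "slice (take (k - 1) w) (drop (k + 1) w) 2 (shift x)
      = shift (slice (take (k - 1) (map (\<lambda>i. i - 1) w)) (drop (k + 1) (map (\<lambda>i. i - 1) w)) 2 x)"
    by (simp add: fun_eq_iff slice_def shift_def take_map drop_map)
  then have "T (slice (take (k - 1) w) (drop (k + 1) w) 2 (shift x))
      = shift (T (slice (take (k - 1) (map (\<lambda>i. i - 1) w)) (drop (k + 1) (map (\<lambda>i. i - 1) w)) 2 x))"
    by (simp only: T_shift[OF slice_mem[OF x]])
  then show "ampl T k (shift x) w = shift (ampl T k x) w"
    unfolding ampl_def slice_def by (cases "1 \<le> k \<and> k < length w") (auto simp add: shift_def)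
qed

lemma tprod_shift: "x \<in> vcar (tpow n) \<Longrightarrow> tprod d k (shift x) = shift (tprod d k x)"
  by (induction k arbitrary: x) (simp_all add: ampl_shift)

lemma Rd_shift: "x \<in> vcar (tpow n) \<Longrightarrow> Rd d m (shift x) = shift (Rd d m x)"
  by (simp add: Rd_def tprod_shift) (simp add: shift_def)

lemma Pd_shift: "x \<in> vcar (tpow n) \<Longrightarrow> Pd m d (shift x) = shift (Pd m d x)"
  by (induction m arbitrary: d x) (simp_all add: Rd_shift)

lemma inner_shift:
  assumes "x \<in> vcar (tpow n)" "y \<in> vcar (tpow n)"
  shows "vinner (pre_fock T n) (translate 1 x) (translate 1 y) = vinner (pre_fock T n) x y"
  using assms Pd_shift[of y n n 0] by (simp add: inner_pre_fock shift_eq ip_translate)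

lemma inner_unshift:
  assumes "x \<in> vcar (tpow n)" "y \<in> vcar (tpow n)"
  shows "vinner (pre_fock T n) (translate (-1) x) (translate (-1) y) = vinner (pre_fock T n) x y"
  using inner_shift[of "translate (-1) x" n "translate (-1) y"] assms by (simp add: translate_translate)

end

section \<open>Operators on the deformed Fock space\<close>

lemma (in cip_lipschitz) extend_scale:
  assumes hom: "\<And>c x. x \<in> vcar V \<Longrightarrow> \<phi> (vscale V c x) = vscale W c (\<phi> x)"
    and A: "A \<in> vcar (completion V)"
  shows "extend W \<phi> (vscale (completion V) c A) = vscale (completion W) c (extend W \<phi> A)"
proof -
  obtain s where s: "s \<in> cauchy_seqs V" "A = V.cls s" using A by (elim V.completion_cases)
  then show ?thesis
    using W.scale_cls[OF map_cauchy[OF s(1)], of c]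
    by (simp add: V.scale_completion W.scale_completion V.scale_cls V.scale_cauchy extend_cls o_def hom
        V.cauchy_seqs_mem[OF s(1)])
qed

context hilb
begin

text \<open>Operators on a carrier form no type with addition, so finite sums run over lists; zero
  times the identity serves as the zero operator.\<close>

primrec op_sum :: "('a \<Rightarrow> 'a) list \<Rightarrow> 'a \<Rightarrow> 'a" where
  "op_sum [] = op_scale V 0 (op_id V)"
| "op_sum (X # Xs) = op_add V X (op_sum Xs)"

lemma op_sum_bounded: "set Xs \<subseteq> bounded_ops V \<Longrightarrow> op_sum Xs \<in> bounded_ops V"
  by (induction Xs) auto

lemma inner_op_sum_left:
  assumes "set Xs \<subseteq> bounded_ops V" "x \<in> vcar V" "y \<in> vcar V"
  shows "vinner V (op_sum Xs x) y = (\<Sum>X\<leftarrow>Xs. vinner V (X x) y)"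
  using assms by (induction Xs) (auto simp: bounded_ops_mem op_sum_bounded)

lemma inner_op_sum_right:
  assumes "set Xs \<subseteq> bounded_ops V" "x \<in> vcar V" "y \<in> vcar V"
  shows "vinner V y (op_sum Xs x) = (\<Sum>X\<leftarrow>Xs. vinner V y (X x))"
  using assms by (induction Xs) (auto simp: bounded_ops_mem op_sum_bounded)

end

locale deformed_fock = bounded_hecke + shift_hecke +
  assumes fin: "finite {(k, l). tmat T j l i k \<noteq> 0}"
begin

sublocale fam: hilb_family "\<lambda>n. completion (pre_fock T n)"
  by (rule hilb_family.intro) (rule pre.hilb_completion)

lemma fock_eq: "fock T = hilbert_sum (\<lambda>n. completion (pre_fock T n))"
  by (simp add: fock_def)

sublocale F: hilb "fock T"
  unfolding fock_eq by (rule fam.hilb_hilbert_sum)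

abbreviation K :: "nat \<Rightarrow> (nat \<Rightarrow> tvec) set cip_space" where
  "K n \<equiv> completion (pre_fock T n)"

lemma fock_mem: "x \<in> vcar (fock T) \<longleftrightarrow> (\<forall>n. x n \<in> vcar (K n)) \<and> summable (\<lambda>n. (vnorm (K n) (x n))\<^sup>2)"
  by (simp add: fock_eq fam.hilbert_sum_mem)

lemma component_mem: "x \<in> vcar (fock T) \<Longrightarrow> x n \<in> vcar (K n)"
  by (simp add: fock_mem)

lemma fock_simps:
  "vzero (fock T) = (\<lambda>n. vzero (K n))" "vadd (fock T) x y = (\<lambda>n. vadd (K n) (x n) (y n))"
  "vscale (fock T) c x = (\<lambda>n. vscale (K n) c (x n))"
  "vinner (fock T) x y = (\<Sum>n. vinner (K n) (x n) (y n))"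
  by (simp_all add: fock_eq hilbert_sum_def)

lemma K_zero: "vzero (K n) = embed (pre_fock T n) (\<lambda>_. 0)"
  by (simp add: completion_def)

text \<open>The homogeneous vector of degree n represented by \<xi>. Inner products with these
  vectors separate the Fock space, so identities of vectors and of bounded operators are checked on
  them.\<close>

definition dvec :: "nat \<Rightarrow> tvec \<Rightarrow> fock_vec" where
  "dvec n \<xi> = fam.slot n (embed (pre_fock T n) \<xi>)"

lemma dvec_apply: "dvec n \<xi> m = (if m = n then embed (pre_fock T n) \<xi> else embed (pre_fock T m) (\<lambda>_. 0))"
  by (simp add: dvec_def fam.slot_def K_zero)

lemma embed_mem [simp]: "\<xi> \<in> vcar (tpow n) \<Longrightarrow> embed (pre_fock T n) \<xi> \<in> vcar (K n)"
  by (rule pre.embed_mem) simp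

lemma dvec_mem [simp, intro]: "\<xi> \<in> vcar (tpow n) \<Longrightarrow> dvec n \<xi> \<in> vcar (fock T)"
  unfolding dvec_def fock_eq by (intro fam.slot_mem) simp

lemma inner_dvec_right:
  "x \<in> vcar (fock T) \<Longrightarrow> \<xi> \<in> vcar (tpow n) \<Longrightarrow>
    vinner (fock T) x (dvec n \<xi>) = vinner (K n) (x n) (embed (pre_fock T n) \<xi>)"
  unfolding dvec_def fock_eq by (intro fam.inner_slot) simp_all

lemma inner_dvec:
  assumes "\<xi> \<in> vcar (tpow n)" "\<eta> \<in> vcar (tpow m)"
  shows "vinner (fock T) (dvec n \<xi>) (dvec m \<eta>) = (if n = m then vinner (pre_fock T n) \<xi> \<eta> else 0)"
  using assms by (auto simp: inner_dvec_right dvec_apply pre.inner_embed inner_pre_fock)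

lemma fock_vec_eqI:
  assumes x: "x \<in> vcar (fock T)" and y: "y \<in> vcar (fock T)"
    and eq: "\<And>n \<xi>. \<xi> \<in> vcar (tpow n) \<Longrightarrow> vinner (fock T) x (dvec n \<xi>) = vinner (fock T) y (dvec n \<xi>)"
  shows "x = y"
proof
  fix n
  show "x n = y n"
  proof (rule pre.completion_vec_eqI[OF component_mem[OF x] component_mem[OF y]])
    fix \<xi> assume "\<xi> \<in> vcar (pre_fock T n)"
    then show "vinner (K n) (x n) (embed (pre_fock T n) \<xi>) = vinner (K n) (y n) (embed (pre_fock T n) \<xi>)"
      using eq[of \<xi> n] by (simp add: inner_dvec_right[OF x] inner_dvec_right[OF y])
  qed
qed

text \<open>Instead of approximating a general vector, the adjoints are compared: their values are
  determined by inner products with homogeneous vectors, where X and Y agree. Taking adjoints again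
  gives the claim.\<close>

lemma op_eq_dvecI:
  assumes X: "X \<in> bounded_ops (fock T)" and Y: "Y \<in> bounded_ops (fock T)"
    and eq: "\<And>n \<xi>. \<xi> \<in> vcar (tpow n) \<Longrightarrow> X (dvec n \<xi>) = Y (dvec n \<xi>)"
  shows "X = Y"
proof -
  have "op_adj (fock T) X = op_adj (fock T) Y"
  proof (rule extensionalityI[of _ "vcar (fock T)"])
    fix y assume y: "y \<in> vcar (fock T)"
    show "op_adj (fock T) X y = op_adj (fock T) Y y"
      by (rule fock_vec_eqI) (use X Y y eq in \<open>simp_all add: F.inner_op_adj_left dvec_mem\<close>)
  qed auto
  then show ?thesis using F.op_adj_simps(1)[OF X] F.op_adj_simps(1)[OF Y] by metis
qed

lemma op_eq_inner_dvecI: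
  assumes X: "X \<in> bounded_ops (fock T)" and Y: "Y \<in> bounded_ops (fock T)"
    and eq: "\<And>n \<xi> m \<eta>. \<xi> \<in> vcar (tpow n) \<Longrightarrow> \<eta> \<in> vcar (tpow m) \<Longrightarrow>
      vinner (fock T) (X (dvec n \<xi>)) (dvec m \<eta>) = vinner (fock T) (Y (dvec n \<xi>)) (dvec m \<eta>)"
  shows "X = Y"
  by (rule op_eq_dvecI[OF X Y]) (rule fock_vec_eqI, auto simp: F.bounded_ops_mem[OF X] F.bounded_ops_mem[OF Y] eq)

subsection \<open>Creation and annihilation operators\<close>

text \<open>The row bound with a single index; it makes the creation operators well defined on the
  completions.\<close>

lemma tens_lipschitz: "cip_lipschitz (pre_fock T n) (pre_fock T (Suc n)) (tens (ket i)) (sqrt row_const)"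
proof
  fix x y :: tvec assume x: "x \<in> vcar (pre_fock T n)" and y: "y \<in> vcar (pre_fock T n)"
  show "tens (ket i) x \<in> vcar (pre_fock T (Suc n))" using x by (simp add: tens_mem)
  have d: "vdiff (pre_fock T n) x y \<in> vcar (tpow n)" using pre.diff_mem[OF x y] by simp
  have "vdiff (pre_fock T (Suc n)) (tens (ket i) x) (tens (ket i) y) = tens (ket i) (vdiff (pre_fock T n) x y)"
    by (simp add: pre_fock_diff tens_diff)
  moreover have "(vnorm (pre_fock T (Suc n)) (tens (ket i) (vdiff (pre_fock T n) x y)))\<^sup>2
      \<le> row_const * (vnorm (pre_fock T n) (vdiff (pre_fock T n) x y))\<^sup>2"
    using row_bound_vec[of "{i}" "\<lambda>_. vdiff (pre_fock T n) x y" n] d by simp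
  then have "sqrt ((vnorm (pre_fock T (Suc n)) (tens (ket i) (vdiff (pre_fock T n) x y)))\<^sup>2)
      \<le> sqrt (row_const * (vnorm (pre_fock T n) (vdiff (pre_fock T n) x y))\<^sup>2)"
    by (rule real_sqrt_le_mono)
  then have "vnorm (pre_fock T (Suc n)) (tens (ket i) (vdiff (pre_fock T n) x y))
      \<le> sqrt row_const * vnorm (pre_fock T n) (vdiff (pre_fock T n) x y)"
    using d tens_mem[OF d] by (simp add: real_sqrt_mult)
  ultimately show "vnorm (pre_fock T (Suc n)) (vdiff (pre_fock T (Suc n)) (tens (ket i) x) (tens (ket i) y))
      \<le> sqrt row_const * vnorm (pre_fock T n) (vdiff (pre_fock T n) x y)" by simp
qed

abbreviation ext_tens :: "int \<Rightarrow> nat \<Rightarrow> (nat \<Rightarrow> tvec) set \<Rightarrow> (nat \<Rightarrow> tvec) set" where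
  "ext_tens i n \<equiv> extend (pre_fock T (Suc n)) (tens (ket i))"

lemma ext_tens_mem: "A \<in> vcar (K n) \<Longrightarrow> ext_tens i n A \<in> vcar (K (Suc n))"
  by (rule cip_lipschitz.extend_mem[OF tens_lipschitz])

lemma ext_tens_scale: "A \<in> vcar (K n) \<Longrightarrow> ext_tens i n (vscale (K n) c A) = vscale (K (Suc n)) c (ext_tens i n A)"
  by (rule cip_lipschitz.extend_scale[OF tens_lipschitz]) (simp_all add: tens_scale)

lemma ext_tens_add: "\<lbrakk>A \<in> vcar (K n); B \<in> vcar (K n)\<rbrakk> \<Longrightarrow>
    ext_tens i n (vadd (K n) A B) = vadd (K (Suc n)) (ext_tens i n A) (ext_tens i n B)"
  by (rule cip_lipschitz.extend_add[OF tens_lipschitz]) (simp_all add: tens_add)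

text \<open>As I is finite, both sides are limits, along representing Cauchy sequences, of the
  corresponding expressions on the pre-Fock space.\<close>

lemma row_bound_completion:
  assumes I: "finite I" and A: "\<And>k. k \<in> I \<Longrightarrow> A k \<in> vcar (K n)"
  shows "Re (\<Sum>k\<in>I. \<Sum>l\<in>I. vinner (K (Suc n)) (ext_tens k n (A k)) (ext_tens l n (A l)))
    \<le> row_const * (\<Sum>k\<in>I. Re (vinner (K n) (A k) (A k)))"
proof -
  have "\<forall>k\<in>I. \<exists>s\<in>cauchy_seqs (pre_fock T n). A k = pre.cls n s"
    using A pre.completion_cases by blast
  then obtain s where s: "\<And>k. k \<in> I \<Longrightarrow> s k \<in> cauchy_seqs (pre_fock T n)" "\<And>k. k \<in> I \<Longrightarrow> A k = pre.cls n (s k)"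
    by metis
  have lim: "(\<lambda>m. Re (\<Sum>k\<in>I. \<Sum>l\<in>I. vinner (pre_fock T (Suc n)) (tens (ket k) (s k m)) (tens (ket l) (s l m))))
      \<longlonglongrightarrow> Re (\<Sum>k\<in>I. \<Sum>l\<in>I. vinner (K (Suc n)) (ext_tens k n (A k)) (ext_tens l n (A l)))"
  proof (intro tendsto_Re tendsto_sum)
    fix k l assume "k \<in> I" "l \<in> I"
    then show "(\<lambda>m. vinner (pre_fock T (Suc n)) (tens (ket k) (s k m)) (tens (ket l) (s l m)))
        \<longlonglongrightarrow> vinner (K (Suc n)) (ext_tens k n (A k)) (ext_tens l n (A l))"
      using pre.inner_completion[OF cip_lipschitz.map_cauchy[OF tens_lipschitz s(1)[of k]]
          cip_lipschitz.map_cauchy[OF tens_lipschitz s(1)[of l]], of k l]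
      by (simp add: s cip_lipschitz.extend_cls[OF tens_lipschitz])
  qed
  have lim': "(\<lambda>m. row_const * (\<Sum>k\<in>I. Re (vinner (pre_fock T n) (s k m) (s k m))))
      \<longlonglongrightarrow> row_const * (\<Sum>k\<in>I. Re (vinner (K n) (A k) (A k)))"
    using s pre.inner_completion by (intro tendsto_mult_left tendsto_sum tendsto_Re) auto
  show ?thesis
  proof (rule LIMSEQ_le[OF lim lim'], intro exI allI impI)
    fix m
    have "s k m \<in> vcar (tpow n)" if "k \<in> I" for k
      using pre.cauchy_seqs_mem[OF s(1)[OF that], of m] by simp
    then show "Re (\<Sum>k\<in>I. \<Sum>l\<in>I. vinner (pre_fock T (Suc n)) (tens (ket k) (s k m)) (tens (ket l) (s l m)))
        \<le> row_const * (\<Sum>k\<in>I. Re (vinner (pre_fock T n) (s k m) (s k m)))"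
      by (rule row_bound_pre[OF I])
  qed
qed

lemma norm_ext_tens:
  assumes A: "A \<in> vcar (K n)"
  shows "(vnorm (K (Suc n)) (ext_tens i n A))\<^sup>2 \<le> row_const * (vnorm (K n) A)\<^sup>2"
  using row_bound_completion[of "{i}" "\<lambda>_. A" n] A by (simp add: fam.S.norm_sq ext_tens_mem)

abbreviation cr :: "int \<Rightarrow> fock_vec \<Rightarrow> fock_vec" where
  "cr i \<equiv> creation T (ket i)"

abbreviation an :: "int \<Rightarrow> fock_vec \<Rightarrow> fock_vec" where
  "an i \<equiv> annihilation T (ket i)"

lemma cr_0: "x \<in> vcar (fock T) \<Longrightarrow> cr i x 0 = vzero (K 0)"
  and cr_Suc: "x \<in> vcar (fock T) \<Longrightarrow> cr i x (Suc m) = ext_tens i m (x m)"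
  by (simp_all add: creation_def)

lemma cr_mem:
  assumes x: "x \<in> vcar (fock T)"
  shows "cr i x \<in> vcar (fock T)"
proof -
  have "summable (\<lambda>m. (vnorm (K (Suc m)) (cr i x (Suc m)))\<^sup>2)"
  proof (rule summable_comparison_test')
    show "summable (\<lambda>m. row_const * (vnorm (K m) (x m))\<^sup>2)"
      using x by (intro summable_mult) (simp add: fock_mem)
    show "norm ((vnorm (K (Suc m)) (cr i x (Suc m)))\<^sup>2) \<le> row_const * (vnorm (K m) (x m))\<^sup>2" for m
      using x component_mem[OF x] by (simp add: cr_Suc norm_ext_tens)
  qed
  then have "summable (\<lambda>m. (vnorm (K m) (cr i x m))\<^sup>2)"
    by (subst (asm) summable_Suc_iff)
  moreover have "cr i x m \<in> vcar (K m)" for m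
    using x component_mem[OF x] by (cases m) (simp_all add: cr_0 cr_Suc ext_tens_mem)
  ultimately show ?thesis by (simp add: fock_mem)
qed

lemma inner_cr:
  assumes x: "x \<in> vcar (fock T)" and y: "y \<in> vcar (fock T)"
  shows "(\<lambda>m. vinner (K (Suc m)) (ext_tens i m (x m)) (ext_tens j m (y m)))
    sums vinner (fock T) (cr i x) (cr j y)"
proof -
  have "(\<lambda>m. vinner (K m) (cr i x m) (cr j y m)) sums vinner (fock T) (cr i x) (cr j y)"
    unfolding fock_simps(4)
    using fam.summable_inner[of "cr i x" "cr j y"] cr_mem[OF x] cr_mem[OF y]
    by (simp add: fock_eq summable_sums)
  moreover have "vinner (K 0) (cr i x 0) (cr j y 0) = 0"
    using y by (simp add: x cr_0)
  ultimately show ?thesis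
    using x y sums_Suc_iff[of "\<lambda>m. vinner (K m) (cr i x m) (cr j y m)"] by (simp add: cr_Suc)
qed

text \<open>The constant is the same in every degree, so the degreewise inequalities can be
  summed.\<close>

lemma row_bound_fock:
  assumes I: "finite I" and x: "\<And>k. k \<in> I \<Longrightarrow> x k \<in> vcar (fock T)"
  shows "Re (\<Sum>k\<in>I. \<Sum>l\<in>I. vinner (fock T) (cr k (x k)) (cr l (x l)))
    \<le> row_const * (\<Sum>k\<in>I. (vnorm (fock T) (x k))\<^sup>2)"
proof (rule sums_le)
  show "(\<lambda>m. Re (\<Sum>k\<in>I. \<Sum>l\<in>I. vinner (K (Suc m)) (ext_tens k m (x k m)) (ext_tens l m (x l m))))
      sums Re (\<Sum>k\<in>I. \<Sum>l\<in>I. vinner (fock T) (cr k (x k)) (cr l (x l)))"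
    by (intro sums_Re sums_sum inner_cr x)
  show "(\<lambda>m. row_const * (\<Sum>k\<in>I. Re (vinner (K m) (x k m) (x k m))))
      sums (row_const * (\<Sum>k\<in>I. (vnorm (fock T) (x k))\<^sup>2))"
  proof (intro sums_mult sums_sum)
    fix k assume k: "k \<in> I"
    have "(\<lambda>m. vinner (K m) (x k m) (x k m)) sums vinner (fock T) (x k) (x k)"
      unfolding fock_simps(4) using fam.summable_inner[of "x k" "x k"] x[OF k]
      by (simp add: fock_eq summable_sums)
    then show "(\<lambda>m. Re (vinner (K m) (x k m) (x k m))) sums (vnorm (fock T) (x k))\<^sup>2"
      using sums_Re x[OF k] by (simp add: F.norm_sq)
  qed
  show "Re (\<Sum>k\<in>I. \<Sum>l\<in>I. vinner (K (Suc m)) (ext_tens k m (x k m)) (ext_tens l m (x l m)))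
      \<le> row_const * (\<Sum>k\<in>I. Re (vinner (K m) (x k m) (x k m)))" for m
    using x by (intro row_bound_completion[OF I] component_mem)
qed

lemma cr_bounded [simp, intro]: "cr i \<in> bounded_ops (fock T)"
proof (rule F.bounded_opsI)
  show "cr i \<in> extensional (vcar (fock T))" by (simp add: creation_def)
  fix x assume x: "x \<in> vcar (fock T)"
  show "cr i x \<in> vcar (fock T)" by (rule cr_mem[OF x])
  have "(vnorm (fock T) (cr i x))\<^sup>2 \<le> row_const * (vnorm (fock T) x)\<^sup>2"
    using row_bound_fock[of "{i}" "\<lambda>_. x"] x by (simp add: F.norm_sq cr_mem)
  then have "sqrt ((vnorm (fock T) (cr i x))\<^sup>2) \<le> sqrt (row_const * (vnorm (fock T) x)\<^sup>2)"
    by (rule real_sqrt_le_mono)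
  then show "vnorm (fock T) (cr i x) \<le> sqrt row_const * vnorm (fock T) x"
    using x by (simp add: real_sqrt_mult cr_mem)
  show "cr i (vscale (fock T) c x) = vscale (fock T) c (cr i x)" for c
  proof
    fix m
    have cx: "vscale (fock T) c x \<in> vcar (fock T)" using x by auto
    show "cr i (vscale (fock T) c x) m = vscale (fock T) c (cr i x) m"
    proof (cases m)
      case 0
      have "vzero (K 0) = vscale (K 0) c (vzero (K 0))" by (rule fam.S.vec_eqI) auto
      then show ?thesis using x cx by (simp add: 0 fock_simps cr_0)
    next
      case (Suc n)
      then show ?thesis
        using x cx ext_tens_scale[OF component_mem[OF x, of n]]
        by (simp add: cr_Suc fock_simps)
    qed
  qed
  fix y assume y: "y \<in> vcar (fock T)"
  show "cr i (vadd (fock T) x y) = vadd (fock T) (cr i x) (cr i y)"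
  proof
    fix m
    have xy: "vadd (fock T) x y \<in> vcar (fock T)" using x y by auto
    show "cr i (vadd (fock T) x y) m = vadd (fock T) (cr i x) (cr i y) m"
    proof (cases m)
      case 0
      have "vzero (K 0) = vadd (K 0) (vzero (K 0)) (vzero (K 0))" by (rule fam.S.vec_eqI) auto
      then show ?thesis using x y xy by (simp add: 0 fock_simps cr_0)
    next
      case (Suc n)
      then show ?thesis
        using x y xy ext_tens_add[OF component_mem[OF x, of n] component_mem[OF y, of n]]
        by (simp add: cr_Suc fock_simps)
    qed
  qed
qed

lemma cr_dvec:
  assumes \<xi>: "\<xi> \<in> vcar (tpow n)"
  shows "cr i (dvec n \<xi>) = dvec (Suc n) (tens (ket i) \<xi>)"
proof
  fix m
  have t0: "tens (ket i) (\<lambda>_. 0) = (\<lambda>_. 0)" by (auto simp: tens_def split: list.split)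
  show "cr i (dvec n \<xi>) m = dvec (Suc n) (tens (ket i) \<xi>) m"
    using \<xi> by (cases m)
      (simp_all add: cr_0 cr_Suc dvec_mem dvec_apply K_zero cip_lipschitz.extend_embed[OF tens_lipschitz] t0)
qed

lemma an_bounded [simp, intro]: "an i \<in> bounded_ops (fock T)"
  by (simp add: annihilation_def F.op_adj_bounded)

lemma inner_an_left: "x \<in> vcar (fock T) \<Longrightarrow> y \<in> vcar (fock T) \<Longrightarrow>
    vinner (fock T) (an i x) y = vinner (fock T) x (cr i y)"
  and inner_an_right: "x \<in> vcar (fock T) \<Longrightarrow> y \<in> vcar (fock T) \<Longrightarrow>
    vinner (fock T) x (an i y) = vinner (fock T) (cr i x) y"
  by (simp_all add: annihilation_def F.inner_op_adj F.inner_op_adj_left)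

lemma adj_an [simp]: "op_adj (fock T) (an i) = cr i"
  by (simp add: annihilation_def F.op_adj_simps)

lemma adj_cr [simp]: "op_adj (fock T) (cr i) = an i"
  by (simp add: annihilation_def)

text \<open>\<open>an\<close> is given abstractly as an adjoint; testing against homogeneous vectors
  identifies it with the explicit \<open>ann\<close>.\<close>

lemma an_dvec_Suc:
  assumes \<xi>: "\<xi> \<in> vcar (tpow (Suc n))"
  shows "an i (dvec (Suc n) \<xi>) = dvec n (ann i n \<xi>)"
proof (rule fock_vec_eqI)
  fix m \<eta> assume \<eta>: "\<eta> \<in> vcar (tpow m)"
  have "vinner (pre_fock T (Suc n)) \<xi> (tens (ket i) \<eta>) = vinner (pre_fock T n) (ann i n \<xi>) \<eta>" if "m = n"
  proof -
    have "vinner (pre_fock T (Suc n)) \<xi> (tens (ket i) \<eta>) = cnj (vinner (pre_fock T (Suc n)) (tens (ket i) \<eta>) \<xi>)"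
      using \<xi> \<eta> that by (subst pre.cnj_inner) (simp_all add: tens_mem)
    also have "\<dots> = cnj (vinner (pre_fock T n) \<eta> (ann i n \<xi>))"
      using \<xi> \<eta> that by (simp only: inner_tens_ann)
    also have "\<dots> = vinner (pre_fock T n) (ann i n \<xi>) \<eta>"
      using \<xi> \<eta> that by (subst pre.cnj_inner) simp_all
    finally show ?thesis .
  qed
  then show "vinner (fock T) (an i (dvec (Suc n) \<xi>)) (dvec m \<eta>) = vinner (fock T) (dvec n (ann i n \<xi>)) (dvec m \<eta>)"
    using \<xi> \<eta> by (cases "m = n") (simp_all add: inner_an_left dvec_mem cr_dvec inner_dvec tens_mem)
qed (use \<xi> F.bounded_ops_mem[OF an_bounded] in auto)

lemma an_dvec_0:
  assumes \<xi>: "\<xi> \<in> vcar (tpow 0)"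
  shows "an i (dvec 0 \<xi>) = vzero (fock T)"
proof (rule fock_vec_eqI)
  fix m \<eta> assume \<eta>: "\<eta> \<in> vcar (tpow m)"
  show "vinner (fock T) (an i (dvec 0 \<xi>)) (dvec m \<eta>) = vinner (fock T) (vzero (fock T)) (dvec m \<eta>)"
    using \<xi> \<eta> by (simp add: inner_an_left dvec_mem cr_dvec inner_dvec tens_mem)
qed (use \<xi> F.bounded_ops_mem[OF an_bounded] in auto)

text \<open>The list xs enumerates the finite support of the matrix entries. The identity is
  verified between homogeneous vectors: the weak rule settles equal degrees, and for different
  degrees both sides vanish.\<close>

lemma wick:
  obtains xs where "op_mult (fock T) (an i) (cr j)
    = op_add (fock T) (op_scale (fock T) (if i = j then 1 else 0) (op_id (fock T)))
        (F.op_sum (map (\<lambda>(k, l). op_scale (fock T) (tmat T j l i k) (op_mult (fock T) (cr k) (an l))) xs))"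
proof -
  let ?F = "{(k, l). tmat T j l i k \<noteq> 0}"
  let ?Y = "\<lambda>(k, l). op_scale (fock T) (tmat T j l i k) (op_mult (fock T) (cr k) (an l))"
  obtain xs where xs: "set xs = ?F" "distinct xs" using finite_distinct_list[OF fin] by blast
  have Y: "set (map ?Y xs) \<subseteq> bounded_ops (fock T)"
    by (auto intro!: F.op_scale_bounded F.op_mult_bounded)
  have "op_mult (fock T) (an i) (cr j)
    = op_add (fock T) (op_scale (fock T) (if i = j then 1 else 0) (op_id (fock T))) (F.op_sum (map ?Y xs))"
  proof (rule op_eq_inner_dvecI)
    fix n \<xi> m \<eta> assume \<xi>: "\<xi> \<in> vcar (tpow n)" and \<eta>: "\<eta> \<in> vcar (tpow m)"
    note [simp] = dvec_mem[OF \<xi>] dvec_mem[OF \<eta>] F.bounded_ops_mem[OF cr_bounded]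
      F.bounded_ops_mem[OF an_bounded] F.bounded_ops_mem[OF F.op_sum_bounded[OF Y]]
    have "vinner (fock T) (F.op_sum (map ?Y xs) (dvec n \<xi>)) (dvec m \<eta>)
        = (\<Sum>z\<leftarrow>xs. vinner (fock T) (?Y z (dvec n \<xi>)) (dvec m \<eta>))"
      by (subst F.inner_op_sum_left[OF Y]) (simp_all add: o_def)
    also have "\<dots> = (\<Sum>z\<in>?F. vinner (fock T) (?Y z (dvec n \<xi>)) (dvec m \<eta>))"
      by (simp only: sum_list_distinct_conv_sum_set[OF xs(2)] xs(1))
    also have "\<dots> = (\<Sum>(k, l)\<in>?F. tmat T j l i k * vinner (fock T) (an l (dvec n \<xi>)) (an k (dvec m \<eta>)))"
      by (intro sum.cong refl) (auto simp: inner_an_right)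
    finally have "vinner (fock T) (op_add (fock T) (op_scale (fock T) (if i = j then 1 else 0) (op_id (fock T)))
          (F.op_sum (map ?Y xs)) (dvec n \<xi>)) (dvec m \<eta>)
        = (if i = j then 1 else 0) * vinner (fock T) (dvec n \<xi>) (dvec m \<eta>)
          + (\<Sum>(k, l)\<in>?F. tmat T j l i k * vinner (fock T) (an l (dvec n \<xi>)) (an k (dvec m \<eta>)))"
      by simp
    also have "\<dots> = vinner (fock T) (cr j (dvec n \<xi>)) (cr i (dvec m \<eta>))"
    proof (cases "n = m")
      case True
      show ?thesis
      proof (cases n)
        \<comment> \<open>In degree 0 all annihilators give zero, so only the Kronecker term is
          left.\<close>
        case 0
        then have "(\<Sum>(k, l)\<in>?F. tmat T j l i k * vinner (fock T) (an l (dvec n \<xi>)) (an k (dvec m \<eta>))) = 0"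
          using \<xi> \<eta> True by (intro sum.neutral) (auto simp: an_dvec_0)
        then show ?thesis
          using \<xi> \<eta> True 0 wick_pre_fock_0[of \<xi> \<eta> j i] by (simp add: inner_dvec cr_dvec tens_mem)
      next
        case (Suc p)
        have "(\<Sum>(k, l)\<in>?F. tmat T j l i k * vinner (fock T) (an l (dvec n \<xi>)) (an k (dvec m \<eta>)))
            = (\<Sum>(k, l)\<in>?F. tmat T j l i k * vinner (pre_fock T p) (ann l p \<xi>) (ann k p \<eta>))"
          using \<xi> \<eta> True Suc by (intro sum.cong refl) (auto simp: an_dvec_Suc inner_dvec)
        then show ?thesis
          using \<xi> \<eta> True Suc wick_pre_fock[of \<xi> p \<eta> j i, OF _ _ fin] by (simp add: inner_dvec cr_dvec tens_mem)
      qed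
    next
      case False
      have "vinner (fock T) (an l (dvec n \<xi>)) (an k (dvec m \<eta>)) = 0" for k l
        using \<xi> \<eta> False by (cases n; cases m) (auto simp: an_dvec_0 an_dvec_Suc inner_dvec)
      then show ?thesis using \<xi> \<eta> False by (simp add: inner_dvec cr_dvec tens_mem case_prod_unfold)
    qed
    also have "\<dots> = vinner (fock T) (op_mult (fock T) (an i) (cr j) (dvec n \<xi>)) (dvec m \<eta>)"
      by (simp add: inner_an_left)
    finally show "vinner (fock T) (op_mult (fock T) (an i) (cr j) (dvec n \<xi>)) (dvec m \<eta>)
        = vinner (fock T) (op_add (fock T) (op_scale (fock T) (if i = j then 1 else 0) (op_id (fock T)))
            (F.op_sum (map ?Y xs)) (dvec n \<xi>)) (dvec m \<eta>)" ..
  qed (intro F.op_add_bounded F.op_scale_bounded F.op_mult_bounded F.op_sum_bounded[OF Y]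
      F.op_id_bounded an_bounded cr_bounded)+
  then show ?thesis by (rule that)
qed

end

subsection \<open>The shift automorphism\<close>

context deformed_fock
begin

lemma inner_translate:
  assumes "c = 1 \<or> c = -1" "x \<in> vcar (tpow n)" "y \<in> vcar (tpow n)"
  shows "vinner (pre_fock T n) (translate c x) (translate c y) = vinner (pre_fock T n) x y"
  using assms inner_shift inner_unshift by metis

lemma translate_lipschitz:
  assumes c: "c = 1 \<or> c = -1"
  shows "cip_lipschitz (pre_fock T n) (pre_fock T n) (translate c) 1"
proof
  fix x y :: tvec assume x: "x \<in> vcar (pre_fock T n)" and y: "y \<in> vcar (pre_fock T n)"
  show "translate c x \<in> vcar (pre_fock T n)" using x by simp
  have d: "vdiff (pre_fock T n) x y \<in> vcar (tpow n)" using pre.diff_mem[OF x y] by simp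
  have "vdiff (pre_fock T n) (translate c x) (translate c y) = translate c (vdiff (pre_fock T n) x y)"
    by (simp add: pre_fock_diff translate_def)
  then show "vnorm (pre_fock T n) (vdiff (pre_fock T n) (translate c x) (translate c y))
      \<le> 1 * vnorm (pre_fock T n) (vdiff (pre_fock T n) x y)"
    by (simp add: vnorm_def inner_translate[OF c d d])
qed

abbreviation ext_trans :: "int \<Rightarrow> nat \<Rightarrow> (nat \<Rightarrow> tvec) set \<Rightarrow> (nat \<Rightarrow> tvec) set" where
  "ext_trans c n \<equiv> extend (pre_fock T n) (translate c)"

definition U :: "int \<Rightarrow> fock_vec \<Rightarrow> fock_vec" where
  "U c = (\<lambda>x\<in>vcar (fock T). \<lambda>n. ext_trans c n (x n))"

lemma fock_shift_eq: "fock_shift T = U 1"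
  by (simp add: fock_shift_def U_def shift_eq)

context
  fixes c :: int
  assumes c: "c = 1 \<or> c = -1"
begin

lemma ext_trans_mem: "A \<in> vcar (K n) \<Longrightarrow> ext_trans c n A \<in> vcar (K n)"
  by (rule cip_lipschitz.extend_mem[OF translate_lipschitz[OF c]])

lemma inner_ext_trans:
  assumes A: "A \<in> vcar (K n)" and B: "B \<in> vcar (K n)"
  shows "vinner (K n) (ext_trans c n A) (ext_trans c n B) = vinner (K n) A B"
proof -
  obtain s t where s: "s \<in> cauchy_seqs (pre_fock T n)" "A = pre.cls n s"
    and t: "t \<in> cauchy_seqs (pre_fock T n)" "B = pre.cls n t"
    using A B pre.completion_cases by metis
  note lip = translate_lipschitz[OF c]
  have "s k \<in> vcar (tpow n)" "t k \<in> vcar (tpow n)" for k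
    using pre.cauchy_seqs_mem[OF s(1), of k] pre.cauchy_seqs_mem[OF t(1), of k] by simp_all
  then have "(\<lambda>k. vinner (pre_fock T n) ((translate c \<circ> s) k) ((translate c \<circ> t) k))
      = (\<lambda>k. vinner (pre_fock T n) (s k) (t k))"
    by (simp add: inner_translate[OF c])
  then show ?thesis
    using pre.inner_completion[OF cip_lipschitz.map_cauchy[OF lip s(1)] cip_lipschitz.map_cauchy[OF lip t(1)]]
      pre.inner_completion[OF s(1) t(1)] s t
    by (simp add: cip_lipschitz.extend_cls[OF lip] LIMSEQ_unique)
qed

lemma U_apply: "x \<in> vcar (fock T) \<Longrightarrow> U c x n = ext_trans c n (x n)"
  by (simp add: U_def)

lemma U_mem:
  assumes x: "x \<in> vcar (fock T)"
  shows "U c x \<in> vcar (fock T)"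
proof -
  have "vnorm (K n) (U c x n) = vnorm (K n) (x n)" for n
    by (simp add: vnorm_def U_apply[OF x] inner_ext_trans component_mem[OF x])
  then show ?thesis
    using x by (simp add: fock_mem U_apply ext_trans_mem)
qed

lemma inner_U: "\<lbrakk>x \<in> vcar (fock T); y \<in> vcar (fock T)\<rbrakk> \<Longrightarrow>
    vinner (fock T) (U c x) (U c y) = vinner (fock T) x y"
  by (simp add: fock_simps U_apply inner_ext_trans component_mem)

lemma norm_U: "x \<in> vcar (fock T) \<Longrightarrow> vnorm (fock T) (U c x) = vnorm (fock T) x"
  by (simp add: vnorm_def inner_U)

lemma U_bounded [simp, intro]: "U c \<in> bounded_ops (fock T)"
proof (rule F.bounded_opsI)
  show "U c \<in> extensional (vcar (fock T))" by (simp add: U_def)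
  fix x assume x: "x \<in> vcar (fock T)"
  show "U c x \<in> vcar (fock T)" by (rule U_mem[OF x])
  show "vnorm (fock T) (U c x) \<le> 1 * vnorm (fock T) x" by (simp add: norm_U[OF x])
  show "U c (vscale (fock T) a x) = vscale (fock T) a (U c x)" for a
  proof
    fix m
    have "vscale (fock T) a x \<in> vcar (fock T)" using x by auto
    then show "U c (vscale (fock T) a x) m = vscale (fock T) a (U c x) m"
      using cip_lipschitz.extend_scale[OF translate_lipschitz[OF c] _ component_mem[OF x]] x
      by (simp add: U_apply fock_simps translate_def)
  qed
  fix y assume y: "y \<in> vcar (fock T)"
  show "U c (vadd (fock T) x y) = vadd (fock T) (U c x) (U c y)"
  proof
    fix m
    have "vadd (fock T) x y \<in> vcar (fock T)" using x y by auto
    then show "U c (vadd (fock T) x y) m = vadd (fock T) (U c x) (U c y) m"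
      using cip_lipschitz.extend_add[OF translate_lipschitz[OF c] _ component_mem[OF x] component_mem[OF y]] x y
      by (simp add: U_apply fock_simps translate_def)
  qed
qed

lemma U_dvec:
  assumes \<xi>: "\<xi> \<in> vcar (tpow n)"
  shows "U c (dvec n \<xi>) = dvec n (translate c \<xi>)"
proof
  fix m
  have t0: "translate c (\<lambda>_. 0) = (\<lambda>_. 0)" by (simp add: translate_def)
  show "U c (dvec n \<xi>) m = dvec n (translate c \<xi>) m"
    using \<xi> by (simp add: U_apply dvec_mem dvec_apply cip_lipschitz.extend_embed[OF translate_lipschitz[OF c]] t0)
qed

end

lemma U_inverse:
  assumes c: "c = 1 \<or> c = -1" and x: "x \<in> vcar (fock T)"
  shows "U c (U (- c) x) = x"
proof -
  have c': "- c = 1 \<or> - c = -1" using c by auto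
  have "op_mult (fock T) (U c) (U (- c)) = op_id (fock T)"
  proof (rule op_eq_dvecI)
    fix n \<xi> assume "\<xi> \<in> vcar (tpow n)"
    then show "op_mult (fock T) (U c) (U (- c)) (dvec n \<xi>) = op_id (fock T) (dvec n \<xi>)"
      by (simp add: dvec_mem U_dvec[OF c] U_dvec[OF c'] translate_translate)
  qed (auto intro!: F.op_mult_bounded U_bounded[OF c] U_bounded[OF c'])
  from fun_cong[OF this, of x] show ?thesis using x by simp
qed

lemma adj_U:
  assumes c: "c = 1 \<or> c = -1"
  shows "op_adj (fock T) (U c) = U (- c)"
proof (rule F.op_adj_eqI)
  have c': "- c = 1 \<or> - c = -1" using c by auto
  show "U c \<in> bounded_ops (fock T)" "U (- c) \<in> bounded_ops (fock T)"
    using U_bounded[OF c] U_bounded[OF c'] by auto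
  fix x y assume x: "x \<in> vcar (fock T)" and y: "y \<in> vcar (fock T)"
  show "vinner (fock T) (U c x) y = vinner (fock T) x (U (- c) y)"
    using inner_U[OF c x U_mem[OF c' y]] by (simp add: U_inverse[OF c y])
qed

text \<open>Conjugation by U c, whose adjoint is U (-c). The value c = -1 provides the inverse
  automorphism.\<close>

definition \<alpha> :: "int \<Rightarrow> (fock_vec \<Rightarrow> fock_vec) \<Rightarrow> fock_vec \<Rightarrow> fock_vec" where
  "\<alpha> c X = op_mult (fock T) (U c) (op_mult (fock T) X (U (- c)))"

lemma shift_aut_eq: "shift_aut T = \<alpha> 1"
  by (simp add: fun_eq_iff shift_aut_def \<alpha>_def fock_shift_eq adj_U)

context
  fixes c :: int
  assumes c: "c = 1 \<or> c = -1"
begin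

private lemma c': "- c = 1 \<or> - c = -1"
  using c by auto

lemma \<alpha>_apply: "x \<in> vcar (fock T) \<Longrightarrow> \<alpha> c X x = U c (X (U (- c) x))"
  by (simp add: \<alpha>_def U_mem[OF c'])

lemma \<alpha>_bounded [simp, intro]: "X \<in> bounded_ops (fock T) \<Longrightarrow> \<alpha> c X \<in> bounded_ops (fock T)"
  unfolding \<alpha>_def by (intro F.op_mult_bounded U_bounded[OF c] U_bounded[OF c'])

lemma \<alpha>_bound:
  assumes X: "X \<in> bounded_ops (fock T)"
    and b: "\<And>x. x \<in> vcar (fock T) \<Longrightarrow> vnorm (fock T) (X x) \<le> e * vnorm (fock T) x"
    and x: "x \<in> vcar (fock T)"
  shows "vnorm (fock T) (\<alpha> c X x) \<le> e * vnorm (fock T) x"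
proof -
  have "vnorm (fock T) (\<alpha> c X x) = vnorm (fock T) (X (U (- c) x))"
    using x by (simp add: \<alpha>_apply norm_U[OF c] F.bounded_ops_mem[OF X] U_mem[OF c'])
  also have "\<dots> \<le> e * vnorm (fock T) (U (- c) x)" using x by (intro b U_mem[OF c'])
  finally show ?thesis using x by (simp add: norm_U[OF c'])
qed

lemma inner_\<alpha>:
  assumes X: "X \<in> bounded_ops (fock T)" and x: "x \<in> vcar (fock T)" and y: "y \<in> vcar (fock T)"
  shows "vinner (fock T) (\<alpha> c X x) y = vinner (fock T) (X (U (- c) x)) (U (- c) y)"
  using inner_U[OF c F.bounded_ops_mem[OF X U_mem[OF c' x]] U_mem[OF c' y]]
  by (simp add: \<alpha>_apply[OF x] U_inverse[OF c y])

lemma \<alpha>_inverse: "X \<in> bounded_ops (fock T) \<Longrightarrow> \<alpha> c (\<alpha> (- c) X) = X"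
proof (rule extensionalityI[of _ "vcar (fock T)"])
  fix x assume X: "X \<in> bounded_ops (fock T)" and x: "x \<in> vcar (fock T)"
  have "\<alpha> (- c) X (U (- c) x) = U (- c) (X (U c (U (- c) x)))"
    by (simp add: \<alpha>_def U_mem[OF c'] U_mem[OF c] x)
  then show "\<alpha> c (\<alpha> (- c) X) x = X x"
    using X x by (simp add: \<alpha>_apply U_inverse[OF c] F.bounded_ops_mem)
qed (auto simp: \<alpha>_def F.bounded_ops_ext)

lemma \<alpha>_id: "\<alpha> c (op_id (fock T)) = op_id (fock T)"
  by (rule extensionalityI[of _ "vcar (fock T)"])
    (auto simp: \<alpha>_apply U_mem[OF c'] U_inverse[OF c] simp: \<alpha>_def)

lemma \<alpha>_add: "\<lbrakk>X \<in> bounded_ops (fock T); Y \<in> bounded_ops (fock T)\<rbrakk> \<Longrightarrow>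
    \<alpha> c (op_add (fock T) X Y) = op_add (fock T) (\<alpha> c X) (\<alpha> c Y)"
  by (rule F.op_eqI) (simp_all add: inner_\<alpha> \<alpha>_bounded F.op_add_bounded U_mem[OF c'] F.bounded_ops_mem)

lemma \<alpha>_scale: "X \<in> bounded_ops (fock T) \<Longrightarrow> \<alpha> c (op_scale (fock T) a X) = op_scale (fock T) a (\<alpha> c X)"
  by (rule F.op_eqI) (simp_all add: inner_\<alpha> \<alpha>_bounded F.op_scale_bounded U_mem[OF c'] F.bounded_ops_mem)

lemma \<alpha>_mult:
  assumes X: "X \<in> bounded_ops (fock T)" and Y: "Y \<in> bounded_ops (fock T)"
  shows "\<alpha> c (op_mult (fock T) X Y) = op_mult (fock T) (\<alpha> c X) (\<alpha> c Y)"
proof (rule extensionalityI[of _ "vcar (fock T)"])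
  fix x assume x: "x \<in> vcar (fock T)"
  have "U (- c) (U c (Y (U (- c) x))) = Y (U (- c) x)"
    using U_inverse[OF c', of "Y (U (- c) x)"] x Y by (simp add: F.bounded_ops_mem U_mem[OF c'])
  then show "\<alpha> c (op_mult (fock T) X Y) x = op_mult (fock T) (\<alpha> c X) (\<alpha> c Y) x"
    using X Y x by (simp add: \<alpha>_apply U_mem[OF c'] U_mem[OF c] F.bounded_ops_mem)
qed (auto simp: \<alpha>_def)

lemma \<alpha>_adj:
  assumes X: "X \<in> bounded_ops (fock T)"
  shows "\<alpha> c (op_adj (fock T) X) = op_adj (fock T) (\<alpha> c X)"
proof (rule F.op_adj_eqI[symmetric])
  fix x y assume x: "x \<in> vcar (fock T)" and y: "y \<in> vcar (fock T)"
  have "vinner (fock T) x (\<alpha> c (op_adj (fock T) X) y) = cnj (vinner (fock T) (\<alpha> c (op_adj (fock T) X) y) x)"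
    using X x y by (subst F.cnj_inner) (auto intro: F.bounded_ops_mem[OF \<alpha>_bounded])
  also have "\<dots> = vinner (fock T) (\<alpha> c X x) y"
    using X x y by (simp add: inner_\<alpha> F.op_adj_bounded F.inner_op_adj_left U_mem[OF c'] F.bounded_ops_mem)
  finally show "vinner (fock T) (\<alpha> c X x) y = vinner (fock T) x (\<alpha> c (op_adj (fock T) X) y)" ..
qed (use X in auto)

lemma \<alpha>_cr: "\<alpha> c (cr i) = cr (i + c)"
proof (rule op_eq_dvecI)
  fix n \<xi> assume "\<xi> \<in> vcar (tpow n)"
  then show "\<alpha> c (cr i) (dvec n \<xi>) = cr (i + c) (dvec n \<xi>)"
    by (simp add: \<alpha>_apply dvec_mem U_dvec[OF c] U_dvec[OF c'] cr_dvec translate_tens translate_translate tens_mem)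
qed auto

lemma \<alpha>_an: "\<alpha> c (an i) = an (i + c)"
  using \<alpha>_adj[of "cr i"] by (simp add: \<alpha>_cr)

end

section \<open>Restriction of the automorphism to the generated algebra\<close>

lemma RT_eq: "RT T = cstar_gen (fock T) (range an)"
  by (simp add: RT_def)

lemma range_an: "range an \<subseteq> bounded_ops (fock T)"
  by auto

lemmas RT_iff = F.cstar_gen_iff[OF range_an, folded RT_eq]
  and star_bounded = F.star_alg_gen_bounded[OF range_an]
  and star_RT = F.star_alg_gen_subset_cstar_gen[OF range_an, folded RT_eq]
  and RT_unital = F.unital_cstar_subalgebra_cstar_gen[OF range_an, folded RT_eq]

lemma RT_closed:
  shows RT_bounded: "X \<in> RT T \<Longrightarrow> X \<in> bounded_ops (fock T)"
    and RT_id: "op_id (fock T) \<in> RT T"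
    and RT_add: "X \<in> RT T \<Longrightarrow> Y \<in> RT T \<Longrightarrow> op_add (fock T) X Y \<in> RT T"
    and RT_mult: "X \<in> RT T \<Longrightarrow> Y \<in> RT T \<Longrightarrow> op_mult (fock T) X Y \<in> RT T"
    and RT_scale: "X \<in> RT T \<Longrightarrow> op_scale (fock T) a X \<in> RT T"
    and RT_adj: "X \<in> RT T \<Longrightarrow> op_adj (fock T) X \<in> RT T"
  using RT_unital unfolding unital_cstar_subalgebra_def by blast+

lemma an_RT: "an i \<in> RT T"
  by (intro star_RT star_alg_gen.gen) simp

lemma cr_RT: "cr i \<in> RT T"
  using RT_adj[OF an_RT[of i]] by simp

lemma \<alpha>_star:
  assumes c: "c = 1 \<or> c = -1" and X: "X \<in> star_alg_gen (fock T) (range an)"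
  shows "\<alpha> c X \<in> star_alg_gen (fock T) (range an)"
  using X
proof induction
  case (gen X)
  then show ?case by (auto simp: \<alpha>_an[OF c] intro: star_alg_gen.gen)
qed (auto simp: \<alpha>_id[OF c] \<alpha>_add[OF c] \<alpha>_scale[OF c] \<alpha>_mult[OF c] \<alpha>_adj[OF c] star_bounded intro: star_alg_gen.intros)

lemma \<alpha>_close:
  assumes c: "c = 1 \<or> c = -1" and X: "X \<in> bounded_ops (fock T)" and Y: "Y \<in> bounded_ops (fock T)"
    and close: "F.op_close e X Y"
  shows "F.op_close e (\<alpha> c X) (\<alpha> c Y)"
  unfolding F.op_close_def
proof
  fix x assume x: "x \<in> vcar (fock T)"
  have "op_diff (fock T) (\<alpha> c X) (\<alpha> c Y) = \<alpha> c (op_diff (fock T) X Y)"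
    using X Y by (simp add: F.op_diff_eq \<alpha>_add[OF c] \<alpha>_scale[OF c] \<alpha>_bounded[OF c] F.op_scale_bounded)
  then have "vdiff (fock T) (\<alpha> c X x) (\<alpha> c Y x) = \<alpha> c (op_diff (fock T) X Y) x"
    using F.op_apply(4)[OF x, of "\<alpha> c X" "\<alpha> c Y"] by simp
  moreover have "vnorm (fock T) (\<alpha> c (op_diff (fock T) X Y) x) \<le> e * vnorm (fock T) x"
    by (rule \<alpha>_bound[OF c _ _ x]) (use X Y close in \<open>auto simp: F.op_close_def\<close>)
  ultimately show "vnorm (fock T) (vdiff (fock T) (\<alpha> c X x) (\<alpha> c Y x)) \<le> e * vnorm (fock T) x" by simp
qed

text \<open>Conjugation by a unitary preserves operator distances, and it maps the star-algebra into
  itself because it sends \<open>an i\<close> to \<open>an (i + c)\<close>.\<close>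

lemma \<alpha>_RT:
  assumes c: "c = 1 \<or> c = -1" and X: "X \<in> RT T"
  shows "\<alpha> c X \<in> RT T"
  unfolding RT_iff
proof (intro conjI allI impI)
  show "\<alpha> c X \<in> bounded_ops (fock T)" using RT_bounded[OF X] \<alpha>_bounded[OF c] by blast
  fix e :: real assume "e > 0"
  then obtain Y where Y: "Y \<in> star_alg_gen (fock T) (range an)" "F.op_close e Y X"
    using X unfolding RT_iff by blast
  then show "\<exists>Y\<in>star_alg_gen (fock T) (range an). F.op_close e Y (\<alpha> c X)"
    using \<alpha>_close[OF c star_bounded[OF Y(1)] RT_bounded[OF X] Y(2)] \<alpha>_star[OF c Y(1)] by blast
qed

theorem dynamical_system: "cstar_dynamical_system (fock T) (RT T) (\<alpha> 1)"
  unfolding cstar_dynamical_system_def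
proof (intro conjI ballI allI RT_unital)
  show "bij_betw (\<alpha> 1) (RT T) (RT T)"
    by (rule bij_betwI[where g = "\<alpha> (-1)"])
      (use \<alpha>_inverse[of 1] \<alpha>_inverse[of "-1"] RT_bounded in \<open>auto simp: \<alpha>_RT\<close>)
qed (auto simp: \<alpha>_add \<alpha>_mult \<alpha>_scale \<alpha>_adj RT_bounded)

lemma \<alpha>_pow_RT: "X \<in> RT T \<Longrightarrow> (\<alpha> 1 ^^ n) X \<in> RT T"
  by (induction n) (auto simp: \<alpha>_RT)

lemma \<alpha>_pow_id: "(\<alpha> 1 ^^ n) (op_id (fock T)) = op_id (fock T)"
  by (induction n) (simp_all add: \<alpha>_id)

lemma \<alpha>_pow_cr: "(\<alpha> 1 ^^ n) (cr i) = cr (i + int n)"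
  by (induction n) (simp_all add: \<alpha>_cr algebra_simps)

lemma \<alpha>_pow_bounded: "X \<in> RT T \<Longrightarrow> (\<alpha> 1 ^^ n) X \<in> bounded_ops (fock T)"
  by (intro RT_bounded \<alpha>_pow_RT)

context
  fixes X :: "fock_vec \<Rightarrow> fock_vec"
  assumes X: "X \<in> RT T"
begin

lemma \<alpha>_pow_scale: "(\<alpha> 1 ^^ n) (op_scale (fock T) a X) = op_scale (fock T) a ((\<alpha> 1 ^^ n) X)"
  by (induction n) (simp_all add: \<alpha>_scale \<alpha>_pow_bounded[OF X])

lemma \<alpha>_pow_adj: "(\<alpha> 1 ^^ n) (op_adj (fock T) X) = op_adj (fock T) ((\<alpha> 1 ^^ n) X)"
  by (induction n) (simp_all add: \<alpha>_adj \<alpha>_pow_bounded[OF X])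

lemma \<alpha>_pow_add: "Y \<in> RT T \<Longrightarrow>
    (\<alpha> 1 ^^ n) (op_add (fock T) X Y) = op_add (fock T) ((\<alpha> 1 ^^ n) X) ((\<alpha> 1 ^^ n) Y)"
  by (induction n) (simp_all add: \<alpha>_add \<alpha>_pow_bounded[OF X] \<alpha>_pow_bounded)

lemma \<alpha>_pow_mult: "Y \<in> RT T \<Longrightarrow>
    (\<alpha> 1 ^^ n) (op_mult (fock T) X Y) = op_mult (fock T) ((\<alpha> 1 ^^ n) X) ((\<alpha> 1 ^^ n) Y)"
  by (induction n) (simp_all add: \<alpha>_mult \<alpha>_pow_bounded[OF X] \<alpha>_pow_bounded)

lemma \<alpha>_pow_bound:
  assumes b: "\<And>x. x \<in> vcar (fock T) \<Longrightarrow> vnorm (fock T) (X x) \<le> e * vnorm (fock T) x"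
    and x: "x \<in> vcar (fock T)"
  shows "vnorm (fock T) ((\<alpha> 1 ^^ n) X x) \<le> e * vnorm (fock T) x"
  using x
proof (induction n arbitrary: x)
  case (Suc n)
  have "vnorm (fock T) (\<alpha> 1 ((\<alpha> 1 ^^ n) X) x) \<le> e * vnorm (fock T) x"
    by (rule \<alpha>_bound[OF _ \<alpha>_pow_bounded[OF X] Suc.IH Suc.prems]) simp_all
  then show ?case by simp
qed (simp add: b)

lemma \<alpha>_pow_close:
  assumes Y: "Y \<in> RT T" and close: "F.op_close e X Y"
  shows "F.op_close e ((\<alpha> 1 ^^ n) X) ((\<alpha> 1 ^^ n) Y)"
proof (induction n)
  case (Suc n)
  have "F.op_close e (\<alpha> 1 ((\<alpha> 1 ^^ n) X)) (\<alpha> 1 ((\<alpha> 1 ^^ n) Y))"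
    by (rule \<alpha>_close[OF _ \<alpha>_pow_bounded[OF X] \<alpha>_pow_bounded[OF Y] Suc.IH]) simp
  then show ?case by simp
qed (simp add: close)

end

subsection \<open>Mixing\<close>

lemma dualD:
  assumes "f \<in> cstar_dual (fock T) (RT T)"
  shows dual_add: "\<lbrakk>X \<in> RT T; Y \<in> RT T\<rbrakk> \<Longrightarrow> f (op_add (fock T) X Y) = f X + f Y"
    and dual_scale: "X \<in> RT T \<Longrightarrow> f (op_scale (fock T) a X) = a * f X"
    and dual_bound: "\<exists>C\<ge>0. \<forall>X\<in>RT T. cmod (f X) \<le> C * enn2real (opnorm (fock T) X)"
proof -
  show "\<lbrakk>X \<in> RT T; Y \<in> RT T\<rbrakk> \<Longrightarrow> f (op_add (fock T) X Y) = f X + f Y"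
    "X \<in> RT T \<Longrightarrow> f (op_scale (fock T) a X) = a * f X"
    using assms by (auto simp: cstar_dual_def)
  obtain C where C: "\<And>X. X \<in> RT T \<Longrightarrow> cmod (f X) \<le> C * enn2real (opnorm (fock T) X)"
    using assms unfolding cstar_dual_def by blast
  have "cmod (f X) \<le> max C 0 * enn2real (opnorm (fock T) X)" if "X \<in> RT T" for X
    using C[OF that] mult_right_mono[of C "max C 0" "enn2real (opnorm (fock T) X)"] by fastforce
  then show "\<exists>C\<ge>0. \<forall>X\<in>RT T. cmod (f X) \<le> C * enn2real (opnorm (fock T) X)"
    by (intro exI[of _ "max C 0"]) auto
qed

lemma opnorm_real_le:
  assumes "\<And>x. x \<in> vcar (fock T) \<Longrightarrow> vnorm (fock T) (X x) \<le> C * vnorm (fock T) x" "0 \<le> C"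
  shows "enn2real (opnorm (fock T) X) \<le> C"
  using enn2real_leI[OF assms(2) F.opnorm_le[OF assms]] .

lemma op_sum_RT: "set Xs \<subseteq> RT T \<Longrightarrow> F.op_sum Xs \<in> RT T"
  by (induction Xs) (auto intro: RT_add RT_scale RT_id)

lemma dual_op_sum:
  assumes f: "f \<in> cstar_dual (fock T) (RT T)" and Xs: "set Xs \<subseteq> RT T"
  shows "f (F.op_sum Xs) = (\<Sum>X\<leftarrow>Xs. f X)"
  using Xs by (induction Xs) (auto simp: dual_scale[OF f RT_id] dual_add[OF f] op_sum_RT)

text \<open>By multiplicativity the n-th translate of \<open>cr i\<close> Z starts with
  \<open>cr (i + int n)\<close>. The translates thus use distinct creation operators, and the row
  bound applies to the vectors y n, whose norms are at most the norm of Z times that of x.\<close>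

lemma sum_translates_bound:
  assumes Z: "Z \<in> RT T" and S: "finite S" and z: "\<And>n. n \<in> S \<Longrightarrow> cmod (z n) \<le> 1"
    and x: "x \<in> vcar (fock T)"
  shows "vnorm (fock T) (F.op_sum (map (\<lambda>n. op_scale (fock T) (z n) ((\<alpha> 1 ^^ n) (op_mult (fock T) (cr i) Z)))
      (sorted_list_of_set S)) x)
    \<le> sqrt row_const * enn2real (opnorm (fock T) Z) * sqrt (card S) * vnorm (fock T) x"
proof -
  let ?X = "\<lambda>n. op_scale (fock T) (z n) ((\<alpha> 1 ^^ n) (op_mult (fock T) (cr i) Z))"
  let ?Xs = "map ?X (sorted_list_of_set S)"
  let ?D = "enn2real (opnorm (fock T) Z)"
  have RT: "(\<alpha> 1 ^^ n) (op_mult (fock T) (cr i) Z) \<in> RT T" for n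
    by (intro \<alpha>_pow_RT RT_mult cr_RT Z)
  have Xs: "set ?Xs \<subseteq> bounded_ops (fock T)"
    using RT by (auto intro: F.op_scale_bounded RT_bounded)
  define y where "y n = vscale (fock T) (z n) ((\<alpha> 1 ^^ n) Z x)" for n
  have y: "y n \<in> vcar (fock T)" for n
    unfolding y_def using F.bounded_ops_mem[OF \<alpha>_pow_bounded[OF Z] x] by auto
  have X: "?X n x = cr (i + int n) (y n)" for n
    using x F.bounded_ops_mem[OF \<alpha>_pow_bounded[OF Z] x]
    by (simp add: y_def \<alpha>_pow_mult[OF cr_RT Z] \<alpha>_pow_cr F.bounded_ops_scale[OF cr_bounded])
  have ny: "(vnorm (fock T) (y n))\<^sup>2 \<le> (?D * vnorm (fock T) x)\<^sup>2" if n: "n \<in> S" for n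
  proof (rule power_mono)
    have Zx: "vnorm (fock T) ((\<alpha> 1 ^^ n) Z x) \<le> ?D * vnorm (fock T) x"
      by (rule \<alpha>_pow_bound[OF Z F.bounded_ops_opnorm[OF RT_bounded[OF Z]] x])
    have m: "(\<alpha> 1 ^^ n) Z x \<in> vcar (fock T)" by (rule F.bounded_ops_mem[OF \<alpha>_pow_bounded[OF Z] x])
    have "cmod (z n) * vnorm (fock T) ((\<alpha> 1 ^^ n) Z x) \<le> 1 * vnorm (fock T) ((\<alpha> 1 ^^ n) Z x)"
      using z[OF n] F.norm_nonneg[OF m] by (rule mult_right_mono)
    then show "vnorm (fock T) (y n) \<le> ?D * vnorm (fock T) x"
      using Zx by (simp add: y_def F.norm_scale[OF m])
  qed (rule F.norm_nonneg[OF y])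
  \<comment> \<open>The row bound is indexed by letters, so the times n are renamed to the letters i
    + n; w undoes the renaming.\<close>
  define I where "I = (\<lambda>n. i + int n) ` S"
  have inj: "inj_on (\<lambda>n. i + int n) S" by (auto simp: inj_on_def)
  define w where "w k = y (nat (k - i))" for k
  have W: "F.op_sum ?Xs x \<in> vcar (fock T)"
    by (rule F.bounded_ops_mem[OF F.op_sum_bounded[OF Xs] x])
  have list_sum: "(\<Sum>n\<leftarrow>sorted_list_of_set S. g n) = (\<Sum>n\<in>S. g n)" for g :: "nat \<Rightarrow> complex"
    using S by (simp add: sum_list_distinct_conv_sum_set)
  have "vinner (fock T) (F.op_sum ?Xs x) (F.op_sum ?Xs x)
      = (\<Sum>n\<in>S. \<Sum>m\<in>S. vinner (fock T) (cr (i + int n) (y n)) (cr (i + int m) (y m)))"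
    using cr_mem[OF y]
    by (simp only: F.inner_op_sum_left[OF Xs x W] map_map o_def list_sum)
      (intro sum.cong refl, simp only: F.inner_op_sum_right[OF Xs x] X map_map o_def list_sum)
  also have "\<dots> = (\<Sum>k\<in>I. \<Sum>l\<in>I. vinner (fock T) (cr k (w k)) (cr l (w l)))"
    unfolding I_def by (simp add: sum.reindex[OF inj] w_def)
  finally have "(vnorm (fock T) (F.op_sum ?Xs x))\<^sup>2 = Re (\<Sum>k\<in>I. \<Sum>l\<in>I. vinner (fock T) (cr k (w k)) (cr l (w l)))"
    by (simp only: F.norm_sq[OF W])
  also have "\<dots> \<le> row_const * (\<Sum>k\<in>I. (vnorm (fock T) (w k))\<^sup>2)"
    by (rule row_bound_fock) (auto simp: I_def w_def S y)
  also have "(\<Sum>k\<in>I. (vnorm (fock T) (w k))\<^sup>2) = (\<Sum>n\<in>S. (vnorm (fock T) (y n))\<^sup>2)"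
    unfolding I_def by (simp add: sum.reindex[OF inj] w_def)
  also have "row_const * \<dots> \<le> row_const * (\<Sum>n\<in>S. (?D * vnorm (fock T) x)\<^sup>2)"
    by (intro mult_left_mono sum_mono ny row_const_nonneg)
  also have "\<dots> = (sqrt row_const * ?D * sqrt (card S) * vnorm (fock T) x)\<^sup>2"
    using row_const_nonneg by (simp add: power_mult_distrib)
  finally show ?thesis
    by (rule power2_le_imp_le) (use x row_const_nonneg in simp)
qed

text \<open>A set S of times at which |f| \<ge> e satisfies |S| e \<le> B sqrt |S|, hence |S| \<le>
  (B/e)^2, whatever S is. So the set of all such times is finite.\<close>

lemma mixing_creation:
  assumes f: "f \<in> cstar_dual (fock T) (RT T)" and Z: "Z \<in> RT T"
  shows "(\<lambda>n. f ((\<alpha> 1 ^^ n) (op_mult (fock T) (cr i) Z))) \<longlonglongrightarrow> 0"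
proof (rule LIMSEQ_I)
  fix e :: real assume e: "e > 0"
  let ?X = "\<lambda>n. (\<alpha> 1 ^^ n) (op_mult (fock T) (cr i) Z)"
  obtain C where C: "C \<ge> 0" "\<And>X. X \<in> RT T \<Longrightarrow> cmod (f X) \<le> C * enn2real (opnorm (fock T) X)"
    using dual_bound[OF f] by blast
  define B where "B = C * (sqrt row_const * enn2real (opnorm (fock T) Z))"
  have X: "?X n \<in> RT T" for n by (intro \<alpha>_pow_RT RT_mult cr_RT Z)
  have card: "card S * e\<^sup>2 \<le> B\<^sup>2" if S: "finite S" "\<And>n. n \<in> S \<Longrightarrow> e \<le> cmod (f (?X n))" for S
  proof (cases "S = {}")
    case False
    \<comment> \<open>The conjugate phase makes each term of the sum real and nonnegative, so that
      no cancellation occurs; where f vanishes, \<open>sgn\<close> gives 0, which is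
      harmless.\<close>
    define z where "z n = cnj (sgn (f (?X n)))" for n
    have z: "cmod (z n) \<le> 1" "z n * f (?X n) = of_real (cmod (f (?X n)))" for n
    proof -
      show "cmod (z n) \<le> 1" by (simp add: z_def norm_sgn)
      have "z n * f (?X n) = (f (?X n) * cnj (f (?X n))) / of_real (cmod (f (?X n)))"
        by (simp add: z_def sgn_eq)
      also have "\<dots> = of_real (cmod (f (?X n)))"
        unfolding complex_norm_square[symmetric] by (simp add: power2_eq_square)
      finally show "z n * f (?X n) = of_real (cmod (f (?X n)))" .
    qed
    let ?Xs = "map (\<lambda>n. op_scale (fock T) (z n) (?X n)) (sorted_list_of_set S)"
    have Xs: "set ?Xs \<subseteq> RT T" using X by (auto intro: RT_scale)
    have "f (F.op_sum ?Xs) = (\<Sum>n\<leftarrow>sorted_list_of_set S. of_real (cmod (f (?X n))))"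
      by (simp only: dual_op_sum[OF f Xs] map_map o_def dual_scale[OF f X] z(2))
    also have "\<dots> = of_real (\<Sum>n\<in>S. cmod (f (?X n)))"
      using S(1) by (simp add: sum_list_distinct_conv_sum_set)
    finally have "cmod (f (F.op_sum ?Xs)) = \<bar>\<Sum>n\<in>S. cmod (f (?X n))\<bar>"
      by (simp only: norm_of_real)
    then have "cmod (f (F.op_sum ?Xs)) = (\<Sum>n\<in>S. cmod (f (?X n)))"
      by (simp only: abs_of_nonneg sum_nonneg norm_ge_zero)
    moreover have "card S * e \<le> (\<Sum>n\<in>S. cmod (f (?X n)))"
      using sum_mono[of S "\<lambda>_. e" "\<lambda>n. cmod (f (?X n))"] S(2) by simp
    moreover have "cmod (f (F.op_sum ?Xs)) \<le> C * enn2real (opnorm (fock T) (F.op_sum ?Xs))"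
      by (rule C(2)[OF op_sum_RT[OF Xs]])
    moreover have "enn2real (opnorm (fock T) (F.op_sum ?Xs)) \<le> sqrt row_const * enn2real (opnorm (fock T) Z) * sqrt (card S)"
      by (rule opnorm_real_le[OF sum_translates_bound[OF Z S(1) z(1)]]) (use row_const_nonneg in simp_all)
    then have "C * enn2real (opnorm (fock T) (F.op_sum ?Xs)) \<le> B * sqrt (card S)"
      unfolding B_def using C(1) by (simp add: mult_left_mono mult.assoc)
    ultimately have "card S * e \<le> B * sqrt (card S)" by linarith
    moreover have "sqrt (card S) * (sqrt (card S) * e) = card S * e"
      by (simp flip: mult.assoc)
    ultimately have "sqrt (card S) * (sqrt (card S) * e) \<le> sqrt (card S) * B"
      by (simp only: mult.commute[of B])
    \<comment> \<open>Cancelling sqrt |S| requires S to be nonempty, hence the case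
      distinction.\<close>
    then have le: "sqrt (card S) * e \<le> B"
      using False S(1) by (simp add: card_gt_0_iff)
    have "(sqrt (card S) * e)\<^sup>2 \<le> B\<^sup>2"
      by (rule power_mono[OF le]) (use e in simp)
    then show ?thesis by (simp add: power_mult_distrib)
  qed simp
  have "finite {n. e \<le> cmod (f (?X n))}"
  proof (rule ccontr)
    assume "infinite {n. e \<le> cmod (f (?X n))}"
    obtain N where N: "B\<^sup>2 / e\<^sup>2 < real N" using reals_Archimedean2 by blast
    obtain S where "S \<subseteq> {n. e \<le> cmod (f (?X n))}" "finite S" "card S = N"
      using infinite_arbitrarily_large[OF \<open>infinite _\<close>] by blast
    then have "real N * e\<^sup>2 \<le> B\<^sup>2" using card[of S] by auto
    then show False using N e by (simp add: field_simps)
  qed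
  then obtain N where "\<forall>n\<in>{n. e \<le> cmod (f (?X n))}. n < N"
    using finite_nat_set_iff_bounded by blast
  then show "\<exists>N. \<forall>n\<ge>N. norm (f (?X n) - 0) < e"
    by (intro exI[of _ N]) (auto simp: not_le[symmetric])
qed

text \<open>The conjugate functional, through which mixing passes from creation to annihilation
  operators.\<close>

lemma dual_adj:
  assumes f: "f \<in> cstar_dual (fock T) (RT T)"
  shows "(\<lambda>X. cnj (f (op_adj (fock T) X))) \<in> cstar_dual (fock T) (RT T)"
proof -
  obtain C where C: "C \<ge> 0" "\<And>X. X \<in> RT T \<Longrightarrow> cmod (f X) \<le> C * enn2real (opnorm (fock T) X)"
    using dual_bound[OF f] by blast
  have "cmod (cnj (f (op_adj (fock T) X))) \<le> C * enn2real (opnorm (fock T) X)" if X: "X \<in> RT T" for X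
  proof -
    have "enn2real (opnorm (fock T) (op_adj (fock T) X)) \<le> enn2real (opnorm (fock T) X)"
    proof (rule opnorm_real_le)
      fix y assume y: "y \<in> vcar (fock T)"
      note B = RT_bounded[OF X]
      show "vnorm (fock T) (op_adj (fock T) X y) \<le> enn2real (opnorm (fock T) X) * vnorm (fock T) y"
        by (rule F.adjoint_norm_le[where y = "X (op_adj (fock T) X y)"])
          (use y B in \<open>auto simp: F.inner_op_adj intro: F.bounded_ops_mem[OF B] F.bounded_ops_opnorm[OF B]\<close>)
    qed simp
    then show ?thesis using C(2)[OF RT_adj[OF X]] C(1) by (auto intro: order_trans mult_left_mono)
  qed
  then show ?thesis
    unfolding cstar_dual_def using f by (auto simp: dual_add dual_scale RT_adj RT_bounded)
qed

text \<open>Z a_i is the adjoint of a_i^\<dagger> Z^*, and the automorphism commutes with adjoints,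
  so the creation case is applied to the conjugate functional.\<close>

lemma mixing_annihilation:
  assumes f: "f \<in> cstar_dual (fock T) (RT T)" and Z: "Z \<in> RT T"
  shows "(\<lambda>n. f ((\<alpha> 1 ^^ n) (op_mult (fock T) Z (an i)))) \<longlonglongrightarrow> 0"
proof -
  have "op_adj (fock T) (op_mult (fock T) (cr i) (op_adj (fock T) Z)) = op_mult (fock T) Z (an i)"
    using RT_bounded[OF Z] by simp
  moreover have "op_mult (fock T) (cr i) (op_adj (fock T) Z) \<in> RT T"
    by (intro RT_mult cr_RT RT_adj Z)
  ultimately have "f ((\<alpha> 1 ^^ n) (op_mult (fock T) Z (an i)))
      = cnj (cnj (f (op_adj (fock T) ((\<alpha> 1 ^^ n) (op_mult (fock T) (cr i) (op_adj (fock T) Z))))))" for n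
    by (simp flip: \<alpha>_pow_adj)
  then show ?thesis
    using tendsto_cnj[OF mixing_creation[OF dual_adj[OF f] RT_adj[OF Z], of i]] by simp
qed


subsection \<open>Wick ordering\<close>

definition ann_word :: "int list \<Rightarrow> fock_vec \<Rightarrow> fock_vec" where
  "ann_word js = foldr (\<lambda>j Z. op_mult (fock T) (an j) Z) js (op_id (fock T))"

definition wick_word :: "int list \<Rightarrow> int list \<Rightarrow> fock_vec \<Rightarrow> fock_vec" where
  "wick_word is js = foldr (\<lambda>i Z. op_mult (fock T) (cr i) Z) is (ann_word js)"

inductive_set wick_span :: "(fock_vec \<Rightarrow> fock_vec) set" where
  word: "wick_word is js \<in> wick_span"
| add: "X \<in> wick_span \<Longrightarrow> Y \<in> wick_span \<Longrightarrow> op_add (fock T) X Y \<in> wick_span"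
| scale: "X \<in> wick_span \<Longrightarrow> op_scale (fock T) a X \<in> wick_span"

lemma ann_word_RT: "ann_word js \<in> RT T"
  by (induction js) (auto simp: ann_word_def intro: RT_mult RT_id an_RT)

lemma wick_word_RT: "wick_word is js \<in> RT T"
  by (induction "is") (auto simp: wick_word_def intro: RT_mult ann_word_RT cr_RT)

lemma wick_span_RT: "X \<in> wick_span \<Longrightarrow> X \<in> RT T"
  by (induction rule: wick_span.induct) (auto intro: wick_word_RT RT_add RT_scale)

lemmas wick_span_bounded = RT_bounded[OF wick_span_RT]

lemma op_mult_add_right:
  assumes "X \<in> bounded_ops (fock T)" "Y \<in> bounded_ops (fock T)" "Z \<in> bounded_ops (fock T)"
  shows "op_mult (fock T) X (op_add (fock T) Y Z) = op_add (fock T) (op_mult (fock T) X Y) (op_mult (fock T) X Z)"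
  by (rule extensionalityI[of _ "vcar (fock T)"]) (use assms in \<open>auto simp: F.bounded_opsD\<close>)

lemma op_mult_scale_right:
  assumes "X \<in> bounded_ops (fock T)" "Y \<in> bounded_ops (fock T)"
  shows "op_mult (fock T) X (op_scale (fock T) a Y) = op_scale (fock T) a (op_mult (fock T) X Y)"
  by (rule extensionalityI[of _ "vcar (fock T)"]) (use assms in \<open>auto simp: F.bounded_opsD\<close>)

lemma op_mult_add_left:
  assumes "X \<in> bounded_ops (fock T)" "Y \<in> bounded_ops (fock T)" "Z \<in> bounded_ops (fock T)"
  shows "op_mult (fock T) (op_add (fock T) X Y) Z = op_add (fock T) (op_mult (fock T) X Z) (op_mult (fock T) Y Z)"
  by (rule extensionalityI[of _ "vcar (fock T)"]) (use assms in \<open>auto simp: F.bounded_opsD\<close>)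

lemma op_mult_scale_left:
  assumes "X \<in> bounded_ops (fock T)" "Y \<in> bounded_ops (fock T)"
  shows "op_mult (fock T) (op_scale (fock T) a X) Y = op_scale (fock T) a (op_mult (fock T) X Y)"
  by (rule extensionalityI[of _ "vcar (fock T)"]) (use assms in \<open>auto simp: F.bounded_opsD\<close>)

text \<open>Left multiplication by a bounded operator is linear, so invariance of the span needs to
  be checked on words only.\<close>

lemma wick_span_linear:
  assumes X: "X \<in> bounded_ops (fock T)" and word: "\<And>is js. op_mult (fock T) X (wick_word is js) \<in> wick_span"
    and Y: "Y \<in> wick_span"
  shows "op_mult (fock T) X Y \<in> wick_span"
  using Y
proof induction
  case (add Y Z)
  then show ?case by (simp add: op_mult_add_right X wick_span_bounded wick_span.add)
next
  case (scale Y a)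
  then show ?case by (simp add: op_mult_scale_right X wick_span_bounded wick_span.scale)
qed (rule word)

lemma cr_wick_span: "Y \<in> wick_span \<Longrightarrow> op_mult (fock T) (cr i) Y \<in> wick_span"
proof (rule wick_span_linear)
  show "op_mult (fock T) (cr i) (wick_word is js) \<in> wick_span" for "is" js
    using wick_span.word[of "i # is" js] by (simp add: wick_word_def)
qed auto

lemma op_sum_mult_wick_span:
  assumes "\<And>X. X \<in> set Xs \<Longrightarrow> X \<in> bounded_ops (fock T) \<and> op_mult (fock T) X Z \<in> wick_span"
    and Z: "Z \<in> wick_span"
  shows "op_mult (fock T) (F.op_sum Xs) Z \<in> wick_span"
  using assms(1)
proof (induction Xs)
  case Nil
  then show ?case using Z by (simp add: op_mult_scale_left wick_span_bounded wick_span.scale)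
next
  case (Cons X Xs)
  then have "F.op_sum Xs \<in> bounded_ops (fock T)" by (intro F.op_sum_bounded) auto
  then show ?case using Cons Z by (simp add: op_mult_add_left wick_span_bounded wick_span.add)
qed

text \<open>Induction on the number of creators in the word. Exchanging the annihilator with the
  first creator leaves the shorter word W itself and terms in which some \<open>an l\<close> acts on
  W before a creator is put in front.\<close>

lemma an_wick_span: "Y \<in> wick_span \<Longrightarrow> op_mult (fock T) (an i) Y \<in> wick_span"
proof (rule wick_span_linear)
  fix "is" js
  show "op_mult (fock T) (an i) (wick_word is js) \<in> wick_span"
  \<comment> \<open>The index must be free because the commutation rule replaces i by the new
    indices l.\<close>
  proof (induction "is" arbitrary: i)
    case Nil
    show ?case using wick_span.word[of "[]" "i # js"] by (simp add: wick_word_def ann_word_def)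
  next
    case (Cons j "is")
    let ?W = "wick_word is js"
    note W = wick_span.word[of "is" js]
    note B = wick_span_bounded[OF W]
    obtain xs where xs: "op_mult (fock T) (an i) (cr j)
      = op_add (fock T) (op_scale (fock T) (if i = j then 1 else 0) (op_id (fock T)))
          (F.op_sum (map (\<lambda>(k, l). op_scale (fock T) (tmat T j l i k) (op_mult (fock T) (cr k) (an l))) xs))"
      by (rule wick)
    let ?Xs = "map (\<lambda>(k, l). op_scale (fock T) (tmat T j l i k) (op_mult (fock T) (cr k) (an l))) xs"
    have Xs: "set ?Xs \<subseteq> bounded_ops (fock T)"
      by (auto intro!: F.op_scale_bounded F.op_mult_bounded)
    have "X \<in> bounded_ops (fock T) \<and> op_mult (fock T) X ?W \<in> wick_span" if mem: "X \<in> set ?Xs" for X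
    proof -
      obtain z where z: "X = (\<lambda>(k, l). op_scale (fock T) (tmat T j l i k) (op_mult (fock T) (cr k) (an l))) z"
        using mem by (auto simp only: set_map)
      define k l where "k = fst z" and "l = snd z"
      have X: "X = op_scale (fock T) (tmat T j l i k) (op_mult (fock T) (cr k) (an l))"
        by (simp add: z k_def l_def case_prod_unfold)
      have "op_mult (fock T) X ?W = op_scale (fock T) (tmat T j l i k) (op_mult (fock T) (cr k) (op_mult (fock T) (an l) ?W))"
        unfolding X by (subst op_mult_scale_left) (simp_all add: F.op_mult_bounded B F.op_mult_assoc)
      then show ?thesis
        using Xs mem Cons.IH[of l] cr_wick_span wick_span.scale by auto
    qed
    then have sum: "op_mult (fock T) (F.op_sum ?Xs) ?W \<in> wick_span"
      by (rule op_sum_mult_wick_span[OF _ W])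
    have "op_mult (fock T) (an i) (wick_word (j # is) js) = op_mult (fock T) (op_mult (fock T) (an i) (cr j)) ?W"
      by (simp add: wick_word_def F.op_mult_assoc[OF an_bounded cr_bounded B[unfolded wick_word_def]])
    also have "\<dots> = op_add (fock T) (op_scale (fock T) (if i = j then 1 else 0) ?W) (op_mult (fock T) (F.op_sum ?Xs) ?W)"
      unfolding xs
      by (subst op_mult_add_left[OF F.op_scale_bounded[OF F.op_id_bounded] F.op_sum_bounded[OF Xs] B],
          subst op_mult_scale_left[OF F.op_id_bounded B]) (simp only: F.op_id_mult B)
    finally show ?case
      using wick_span.add[OF wick_span.scale[OF W] sum] by simp
  qed
qed auto

text \<open>The span is shown invariant under left multiplication by X and by its adjoint
  simultaneously; carrying both through the induction takes care of the adjoint rule of the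
  star-algebra. Acting on the identity, itself a word, recovers X.\<close>

lemma star_alg_wick_span:
  assumes X: "X \<in> star_alg_gen (fock T) (range an)"
  shows "X \<in> wick_span"
proof -
  have "\<forall>Y\<in>wick_span. op_mult (fock T) X Y \<in> wick_span \<and> op_mult (fock T) (op_adj (fock T) X) Y \<in> wick_span"
    using X
  proof induction
    case (gen X)
    then show ?case by (auto simp: an_wick_span cr_wick_span)
  next
    case (add X Z)
    then show ?case
      by (auto simp: star_bounded op_mult_add_left wick_span_bounded F.op_adj_bounded intro!: wick_span.add)
  next
    case (scale X c)
    then show ?case
      by (auto simp: star_bounded op_mult_scale_left wick_span_bounded F.op_adj_bounded intro!: wick_span.scale)
  next
    case (mult X Z)
    then show ?case by (auto simp: star_bounded F.op_mult_assoc wick_span_bounded F.op_adj_bounded)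
  qed (auto simp: wick_span_bounded star_bounded F.op_adj_simps(5)[OF F.op_id_bounded])
  moreover have "op_id (fock T) \<in> wick_span"
    using wick_span.word[of "[]" "[]"] by (simp add: wick_word_def ann_word_def)
  ultimately show ?thesis using F.op_id_mult(2)[OF star_bounded[OF X]] by metis
qed

subsection \<open>The vacuum state\<close>

lemma vacuum_eq: "vacuum T = dvec 0 (ket [])"
  by (auto simp: fun_eq_iff vacuum_def dvec_apply)

lemma ket_Nil [simp]: "ket [] \<in> vcar (tpow 0)"
  by (rule ket_mem') simp

lemma vacuum_mem [simp]: "vacuum T \<in> vcar (fock T)"
  by (simp add: vacuum_eq dvec_mem)

lemma inner_vacuum [simp]: "vinner (fock T) (vacuum T) (vacuum T) = 1"
  by (simp add: vacuum_eq inner_dvec inner_pre_fock ip_ket) (simp add: ket_apply)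

lemma norm_vacuum: "vnorm (fock T) (vacuum T) = 1"
  by (simp add: vnorm_def)

lemma an_vacuum: "an i (vacuum T) = vzero (fock T)"
  by (simp add: vacuum_eq an_dvec_0)

lemma U_vacuum: "c = 1 \<or> c = -1 \<Longrightarrow> U c (vacuum T) = vacuum T"
proof -
  assume c: "c = 1 \<or> c = -1"
  have "translate c (ket []) = ket []"
    by (auto simp: translate_def ket_apply fun_eq_iff)
  then show ?thesis by (simp add: vacuum_eq U_dvec[OF c])
qed

lemma vacuum_state_le:
  assumes X: "X \<in> bounded_ops (fock T)"
    and b: "\<And>x. x \<in> vcar (fock T) \<Longrightarrow> vnorm (fock T) (X x) \<le> e * vnorm (fock T) x"
  shows "cmod (vacuum_state T X) \<le> e"
  unfolding vacuum_state_def
  using F.Cauchy_Schwarz[OF F.bounded_ops_mem[OF X vacuum_mem] vacuum_mem] b[OF vacuum_mem]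
  by (simp add: norm_vacuum)

lemma vacuum_state_add: "\<lbrakk>X \<in> bounded_ops (fock T); Y \<in> bounded_ops (fock T)\<rbrakk> \<Longrightarrow>
    vacuum_state T (op_add (fock T) X Y) = vacuum_state T X + vacuum_state T Y"
  by (simp add: vacuum_state_def F.bounded_ops_mem)

lemma vacuum_state_scale: "X \<in> bounded_ops (fock T) \<Longrightarrow>
    vacuum_state T (op_scale (fock T) a X) = a * vacuum_state T X"
  by (simp add: vacuum_state_def F.bounded_ops_mem)

lemma vacuum_state_id: "vacuum_state T (op_id (fock T)) = 1"
  by (simp add: vacuum_state_def)

text \<open>The creator moves to the other side as an annihilator and meets the vacuum
  there.\<close>

lemma vacuum_state_cr: "Z \<in> bounded_ops (fock T) \<Longrightarrow> vacuum_state T (op_mult (fock T) (cr i) Z) = 0"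
  using inner_an_right[of "Z (vacuum T)" "vacuum T" i]
  by (simp add: vacuum_state_def an_vacuum F.bounded_ops_mem)

lemma vacuum_state_an:
  assumes Z: "Z \<in> bounded_ops (fock T)"
  shows "vacuum_state T (op_mult (fock T) Z (an i)) = 0"
proof -
  have "vinner (fock T) (Z (vzero (fock T))) (vacuum T) = vinner (fock T) (vzero (fock T)) (op_adj (fock T) Z (vacuum T))"
    using Z by (intro F.inner_op_adj[symmetric]) auto
  also have "\<dots> = 0" using Z by (intro F.inner_zero_left) auto
  finally show ?thesis by (simp add: vacuum_state_def an_vacuum)
qed

lemma vacuum_invariant_state: "invariant_state (fock T) (RT T) (\<alpha> 1) (vacuum_state T)"
  unfolding invariant_state_def cstar_state_def
proof (intro conjI ballI)
  have "cmod (vacuum_state T X) \<le> 1 * enn2real (opnorm (fock T) X)" if "X \<in> RT T" for X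
    using vacuum_state_le[OF RT_bounded[OF that] F.bounded_ops_opnorm[OF RT_bounded[OF that]]] by simp
  then show "vacuum_state T \<in> cstar_dual (fock T) (RT T)"
    unfolding cstar_dual_def
    by (intro CollectI conjI ballI allI exI[of _ 1]) (simp_all add: vacuum_state_add vacuum_state_scale RT_bounded)
  show "vacuum_state T (op_id (fock T)) = 1" by (rule vacuum_state_id)
next
  fix X assume X: "X \<in> RT T"
  note B = RT_bounded[OF X]
  have XV: "X (vacuum T) \<in> vcar (fock T)" by (rule F.bounded_ops_mem[OF B vacuum_mem])
  have "vacuum_state T (op_mult (fock T) (op_adj (fock T) X) X) = vinner (fock T) (X (vacuum T)) (X (vacuum T))"
    using F.inner_op_adj_left[OF B XV vacuum_mem] by (simp add: vacuum_state_def)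
  also have "\<dots> = of_real ((vnorm (fock T) (X (vacuum T)))\<^sup>2)" by (rule F.inner_self[OF XV])
  finally show "vacuum_state T (op_mult (fock T) (op_adj (fock T) X) X) \<in> \<real>\<^sub>\<ge>\<^sub>0"
    by (simp only: nonneg_Reals_of_real_iff zero_le_power2)
  show "vacuum_state T (\<alpha> 1 X) = vacuum_state T X"
    using inner_\<alpha>[of 1 X "vacuum T" "vacuum T"] B U_vacuum[of "-1"] by (simp add: vacuum_state_def)
qed

text \<open>Words are built from the left, whereas \<open>mixing_annihilation\<close> needs the
  annihilator as the last factor.\<close>

lemma ann_word_snoc: "ann_word (js @ [j]) = op_mult (fock T) (ann_word js) (an j)"
proof (induction js)
  case (Cons i js)
  then show ?case
    using F.op_mult_assoc[OF an_bounded[of i] RT_bounded[OF ann_word_RT[of js]] an_bounded[of j]]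
    by (simp add: ann_word_def)
qed (simp add: ann_word_def)

text \<open>For a word with a creator in front or an annihilator at the end the translates tend to
  0, and the vacuum expectation is 0 too. For the empty word the sequence is constant and the
  expectation is 1.\<close>

lemma mixing_wick_span:
  assumes f: "f \<in> cstar_dual (fock T) (RT T)" and X: "X \<in> wick_span"
  shows "(\<lambda>n. f ((\<alpha> 1 ^^ n) X)) \<longlonglongrightarrow> f (op_id (fock T)) * vacuum_state T X"
  using X
proof induction
  case (word "is" js)
  show ?case
  proof (cases "is")
    case (Cons i "is'")
    then show ?thesis
      using mixing_creation[OF f wick_word_RT, of i "is'" js] vacuum_state_cr[OF RT_bounded[OF wick_word_RT], of i "is'" js]
      by (simp add: wick_word_def)
  next
    case Nil
    show ?thesis
    proof (cases js rule: rev_cases)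
      case Nil
      then show ?thesis
        using \<open>is = []\<close> by (simp add: wick_word_def ann_word_def \<alpha>_pow_id vacuum_state_id)
    next
      case (snoc js' j)
      then show ?thesis
        using \<open>is = []\<close> mixing_annihilation[OF f ann_word_RT, of js' j]
          vacuum_state_an[OF RT_bounded[OF ann_word_RT], of js' j]
        by (simp add: wick_word_def ann_word_snoc)
    qed
  qed
next
  case (add X Y)
  note R = wick_span_RT[OF add.hyps(1)] wick_span_RT[OF add.hyps(2)]
  have "(\<lambda>n. f ((\<alpha> 1 ^^ n) (op_add (fock T) X Y))) = (\<lambda>n. f ((\<alpha> 1 ^^ n) X) + f ((\<alpha> 1 ^^ n) Y))"
    by (simp add: \<alpha>_pow_add[OF R] dual_add[OF f \<alpha>_pow_RT[OF R(1)] \<alpha>_pow_RT[OF R(2)]])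
  then show ?case
    using tendsto_add[OF add.IH] R by (simp add: vacuum_state_add RT_bounded distrib_left)
next
  case (scale X a)
  note R = wick_span_RT[OF scale.hyps]
  have "(\<lambda>n. f ((\<alpha> 1 ^^ n) (op_scale (fock T) a X))) = (\<lambda>n. a * f ((\<alpha> 1 ^^ n) X))"
    by (simp add: \<alpha>_pow_scale[OF R] dual_scale[OF f \<alpha>_pow_RT[OF R]])
  then show ?case
    using tendsto_mult_left[OF scale.IH, of a] R by (simp add: vacuum_state_scale RT_bounded mult_ac)
qed

text \<open>Used both for f along the orbit and for the vacuum state, to replace an element of the
  algebra by an approximant from the star-algebra.\<close>

lemma linear_functional_close:
  assumes f: "\<And>X Y. X \<in> RT T \<Longrightarrow> Y \<in> RT T \<Longrightarrow> f (op_add (fock T) X Y) = f X + f Y"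
      "\<And>a X. X \<in> RT T \<Longrightarrow> f (op_scale (fock T) a X) = a * f X"
      "\<And>X. X \<in> RT T \<Longrightarrow> cmod (f X) \<le> C * enn2real (opnorm (fock T) X)" "0 \<le> C"
    and X: "X \<in> RT T" and Y: "Y \<in> RT T" and close: "F.op_close e X Y" "0 \<le> e"
  shows "cmod (f X - f Y) \<le> C * e"
proof -
  have D: "op_diff (fock T) X Y = op_add (fock T) X (op_scale (fock T) (-1) Y)"
    by (rule F.op_diff_eq[OF RT_bounded[OF X] RT_bounded[OF Y]])
  then have R: "op_diff (fock T) X Y \<in> RT T" using X Y by (simp add: RT_add RT_scale)
  have "enn2real (opnorm (fock T) (op_diff (fock T) X Y)) \<le> e"
    by (rule opnorm_real_le) (use close in \<open>auto simp: F.op_close_def\<close>)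
  then have "C * enn2real (opnorm (fock T) (op_diff (fock T) X Y)) \<le> C * e"
    using f(4) by (rule mult_left_mono)
  moreover have "f (op_diff (fock T) X Y) = f X - f Y"
    unfolding D using X Y by (simp add: f(1,2) RT_scale)
  ultimately show ?thesis using f(3)[OF R] by simp
qed

theorem mixing:
  assumes f: "f \<in> cstar_dual (fock T) (RT T)" and X: "X \<in> RT T"
  shows "(\<lambda>n. f ((\<alpha> 1 ^^ n) X)) \<longlonglongrightarrow> f (op_id (fock T)) * vacuum_state T X"
proof (rule LIMSEQ_I)
  fix e :: real assume e: "e > 0"
  obtain C where C: "C \<ge> 0" "\<And>X. X \<in> RT T \<Longrightarrow> cmod (f X) \<le> C * enn2real (opnorm (fock T) X)"
    using dual_bound[OF f] by blast
  let ?a = "f (op_id (fock T))"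
  \<comment> \<open>Replacing X by Y costs C d in the orbit, uniformly in n, and |f(I)| d in the
    limit; together these stay below e/2, and the convergence for Y uses the other half. The summand
    1 keeps the denominator positive and the inequality strict.\<close>
  define d where "d = e / (2 * (C + cmod ?a + 1))"
  have pos: "C + cmod ?a + 1 > 0" using C(1) by (simp add: add_nonneg_pos)
  then have d: "d > 0" "(C + cmod ?a) * d < e / 2"
    using e by (simp_all add: d_def field_simps)
  obtain Y where Y: "Y \<in> star_alg_gen (fock T) (range an)" "F.op_close d Y X"
    using X d(1) unfolding RT_iff by blast
  have YR: "Y \<in> RT T" by (rule star_RT[OF Y(1)])
  have "(\<lambda>n. f ((\<alpha> 1 ^^ n) Y)) \<longlonglongrightarrow> ?a * vacuum_state T Y"
    by (rule mixing_wick_span[OF f star_alg_wick_span[OF Y(1)]])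
  then obtain N where N: "\<And>n. n \<ge> N \<Longrightarrow> cmod (f ((\<alpha> 1 ^^ n) Y) - ?a * vacuum_state T Y) < e / 2"
    using LIMSEQ_D[of _ _ "e / 2"] e by (metis half_gt_zero)
  have 1: "cmod (f ((\<alpha> 1 ^^ n) Y) - f ((\<alpha> 1 ^^ n) X)) \<le> C * d" for n
    by (rule linear_functional_close[OF dual_add[OF f] dual_scale[OF f] C(2) C(1) \<alpha>_pow_RT[OF YR] \<alpha>_pow_RT[OF X]
        \<alpha>_pow_close[OF YR X Y(2)] less_imp_le[OF d(1)]])
  have "cmod (vacuum_state T Y - vacuum_state T X) \<le> 1 * d"
  proof (rule linear_functional_close[OF _ _ _ _ YR X Y(2)])
    show "cmod (vacuum_state T X) \<le> 1 * enn2real (opnorm (fock T) X)" if "X \<in> RT T" for X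
      using vacuum_state_le[OF RT_bounded[OF that] F.bounded_ops_opnorm[OF RT_bounded[OF that]]] by simp
  qed (use d in \<open>simp_all add: vacuum_state_add vacuum_state_scale RT_bounded\<close>)
  then have 2: "cmod (?a * vacuum_state T Y - ?a * vacuum_state T X) \<le> cmod ?a * d"
    by (simp add: norm_mult mult_left_mono flip: right_diff_distrib)
  have "norm (f ((\<alpha> 1 ^^ n) X) - ?a * vacuum_state T X) < e" if "n \<ge> N" for n
  proof -
    define u v w where "u = f ((\<alpha> 1 ^^ n) Y) - f ((\<alpha> 1 ^^ n) X)"
      and "v = f ((\<alpha> 1 ^^ n) Y) - ?a * vacuum_state T Y"
      and "w = ?a * vacuum_state T Y - ?a * vacuum_state T X"
    have "cmod (v + w - u) \<le> cmod v + cmod w + cmod u"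
      by (rule order_trans[OF norm_triangle_ineq4 add_right_mono[OF norm_triangle_ineq]])
    moreover have "cmod u \<le> C * d" "cmod v < e / 2" "cmod w \<le> cmod ?a * d"
      using 1[of n] N[OF that] 2 by (simp_all only: u_def v_def w_def)
    moreover have "C * d + cmod ?a * d < e / 2" using d(2) by (simp only: distrib_right)
    moreover have "f ((\<alpha> 1 ^^ n) X) - ?a * vacuum_state T X = v + w - u"
      by (simp add: u_def v_def w_def)
    ultimately show ?thesis by simp
  qed
  then show "\<exists>N. \<forall>n\<ge>N. norm (f ((\<alpha> 1 ^^ n) X) - ?a * vacuum_state T X) < e" by blast
qed

text \<open>An invariant state is constant along every orbit, while mixing says that these constants
  converge to the vacuum expectation.\<close>

theorem unique_state: "unique_invariant_state (fock T) (RT T) (\<alpha> 1) (vacuum_state T)"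
  unfolding unique_invariant_state_def
proof (intro conjI allI impI ballI vacuum_invariant_state)
  fix \<phi> X assume \<phi>: "invariant_state (fock T) (RT T) (\<alpha> 1) \<phi>" and X: "X \<in> RT T"
  then have dual: "\<phi> \<in> cstar_dual (fock T) (RT T)" and one: "\<phi> (op_id (fock T)) = 1"
    by (auto simp: invariant_state_def cstar_state_def)
  have "\<phi> ((\<alpha> 1 ^^ n) X) = \<phi> X" for n
  proof (induction n)
    case (Suc n)
    then show ?case using \<phi> \<alpha>_pow_RT[OF X, of n] by (simp add: invariant_state_def)
  qed simp
  then show "\<phi> X = vacuum_state T X"
    using mixing[OF dual X] by (simp add: one LIMSEQ_const_iff)
qed

end

theorem theorem4p3:
  fixes T :: "tvec \<Rightarrow> tvec"
  assumes "yang_baxter_hecke T"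
    and "\<And>i j. finite {(k, l). tmat T j l i k \<noteq> 0}"
    and "MT T < \<infinity>"
    and "\<And>\<xi>. \<xi> \<in> vcar (tpow 2) \<Longrightarrow> T (shift \<xi>) = shift (T \<xi>)"
  shows "cstar_dynamical_system (fock T) (RT T) (shift_aut T) \<and>
     unique_invariant_state (fock T) (RT T) (shift_aut T) (vacuum_state T) \<and>
     (\<forall>X\<in>RT T. \<forall>f\<in>cstar_dual (fock T) (RT T).
        (\<lambda>n. f ((shift_aut T ^^ n) X)) \<longlonglongrightarrow> f (op_id (fock T)) * vacuum_state T X)"
proof -
  obtain q :: real where "q \<ge> -1" "yang_baxter T"
    "\<forall>\<xi>\<in>vcar (tpow 2). T (T \<xi>) = (\<lambda>w. complex_of_real (q - 1) * T \<xi> w + complex_of_real q * \<xi> w)"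
    using assms(1) unfolding yang_baxter_hecke_def by blast
  then interpret deformed_fock T q
    using assms(2-4) by unfold_locales auto
  show ?thesis
    unfolding shift_aut_eq using dynamical_system unique_state mixing by blast
qed

end
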